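(* Let $n\in\mathbb N$ and $t>0$. The map $\operatorname{RSK}_t:\mathcal D^n_t\to\mathcal G^n_t$, $f\mapsto(W_tf,G_tf)$, is a bijection with inverse $\operatorname{RSK}_t^{-1}=\Gamma_t\circ M\circ O_t$.
   Context: $\mathcal D^n$ is the set of $f=(f_1,\dots,f_n)$ where each $f_i:[0,\infty)\to\mathbb R$ is cadlag (right-continuous with left limits), has no negative jumps ($f_i(x)\ge f_i(x^-)$), and $f_i(0)\ge 0$; by convention $f_i(0^-)=0$. $\mathcal D^n_t$ is the analogous set of $n$-tuples of functions on $[0,t]$. Each $f$ defines a finitely additive signed measure $df$ by $df([x,y]\times\{i\})=f_i(y)-f_i(x^-)$. For $p=(x,\ell)$, $q=(y,m)$ with $0\le x\le y$, $n\ge\ell\ge m\ge1$, a path from $p$ to $q$ is a set $\pi=\bigcup_{i=m}^{\ell}[t_i,t_{i-1}]\times\{i\}$ with $x=t_\ell\le t_{\ell-1}\le\dots\le t_m\le t_{m-1}=y$. Paths are essentially disjoint if their intersection is finite. $f[p^k\to q^k]=\sup df(\pi_1\cup\dots\cup\pi_k)$ over $k$-tuples of pairwise essentially disjoint paths from $p$ to $q$; $f[p^0\to q^0]=0$. $W_t:\mathcal D^n_t\to\mathcal D^n_t$ is $W_tf_k(y)=f[(0,n)^k\to(y,1)^k]-f[(0,n)^{k-1}\to(y,1)^{k-1}]$, $k=1,\dots,n$, $y\in[0,t]$. $R_t:\mathcal D^n_t\to\mathcal D^n_t$ is $(R_tf)_i(x)=f_{n+1-i}(t)-f_{n+1-i}((t-x)^-)$.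 For $f\in\mathcal D^n$, $Mf=\lim_{s\to\infty}R_sW_sR_s(f|_{[0,s]})$ (limit uniform on compact sets; it exists and $M:\mathcal D^n\to\mathcal D^n$). $\mathcal D^n_{t\uparrow}$ is the set of $w\in\mathcal D^n_t$ with $w_{i+1}(s)\le w_i(s^-)$ for all $s\in[0,t]$, $1\le i\le n-1$. $\operatorname{GT}_n$ is the set of real triangular arrays $g=\{g_i(j):1\le i\le j\le n\}$ with $g_i(j)\ge g_i(j-1)$ and $g_i(j-1)\ge g_{i+1}(j)$ whenever these are defined; $g(n)=(g_1(n),\dots,g_n(n))$. $\mathcal G^n_t=\{(w,g)\in\mathcal D^n_{t\uparrow}\times\operatorname{GT}_n: w(t)=g(n)\}$. $G_tf\in\operatorname{GT}_n$ is determined by $\sum_{i=1}^kG_tf_i(s)=f[(0,n)^k\to(t,n-s+1)^k]$ for $1\le k\le s\le n$. For $g\in\operatorname{GT}_n$ and $\alpha\geq 0$, $\Delta_{t,\alpha}g=(\Delta_{t,\alpha}g_1,\dots,\Delta_{t,\alpha}g_n)$ is the $n$-tuple of functions on $[t,\infty)$ that is constant on each $[t+k-1,t+k)$, $k=1,\dots,n$, and on $[t+n,\infty)$, with $\Delta_{t,\alpha}g(t)=g(n)$ and, for $k,\ell\in\{1,\dots,n\}$, $$\sum_{i=1}^\ell\Delta_{t,\alpha}g_i(t+k)=\sum_{i=1+(k-\ell)^+}^k\alpha i+\sum_{i=1}^\ell g_i(n-(k-\ell)^+).$$ The map $O_t:\mathcal G^n_t\to\mathcal D^n$ is $O_t(w,g)=w\oplus\Delta_{t,\alpha_g}g$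 with $\alpha_g=(n-1)(g_1(n)-g_n(n))$, where $w\oplus h$ equals $w$ on $[0,t]$ and $h$ on $[t,\infty)$. $\Gamma_t:\mathcal D^n\to\mathcal D^n_t$ is restriction to $[0,t]$. *)

theory Defs
  imports "HOL-Analysis.Analysis"
begin

text \<open>
  An \<open>n\<close>-tuple of real functions on a set \<open>T\<close> of times is a curried function \<open>f i x\<close>, extensional
  in both arguments: it is \<open>undefined\<close> for \<open>i\<close> outside \<open>{1..n}\<close> and \<open>f i x\<close> is \<open>undefined\<close> for \<open>x\<close>
  outside \<open>T\<close>. Thus equality in HOL is equality of the tuples. The relevant \<open>T\<close> are \<open>{0..t}\<close> and
  \<open>{0..}\<close>. Points of the semi-discrete plane are pairs (time, line) of type \<open>real \<times> nat\<close>.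
\<close>

type_synonym tuple = "nat \<Rightarrow> real \<Rightarrow> real"

text \<open>The left limit \<open>f(x\<^sup>-)\<close>, with the convention \<open>f(0\<^sup>-) = 0\<close>.\<close>

definition left_lim :: "(real \<Rightarrow> real) \<Rightarrow> real \<Rightarrow> real" where
  "left_lim f x = (if x \<le> 0 then 0 else Lim (at_left x) f)"

definition cadlag_on :: "real set \<Rightarrow> (real \<Rightarrow> real) \<Rightarrow> bool" where
  "cadlag_on T f \<longleftrightarrow>
     (\<forall>x\<in>T. continuous (at x within T \<inter> {x..}) f \<and>
            (0 < x \<longrightarrow> (\<exists>l. (f \<longlongrightarrow> l) (at_left x))))"

definition Dtuples :: "nat \<Rightarrow> real set \<Rightarrow> tuple set" where
  "Dtuples n T =
     {f \<in> {1..n} \<rightarrow>\<^sub>E (T \<rightarrow>\<^sub>E (UNIV :: real set)).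
        \<forall>i\<in>{1..n}. cadlag_on T (f i) \<and> (\<forall>x\<in>T. left_lim (f i) x \<le> f i x) \<and> 0 \<le> f i 0}"

definition tuple_restrict :: "nat \<Rightarrow> real set \<Rightarrow> tuple \<Rightarrow> tuple" where
  "tuple_restrict n T f = (\<lambda>i\<in>{1..n}. \<lambda>x\<in>T. f i x)"

text \<open>
  The measure \<open>df\<close> is only ever evaluated on finite unions \<open>A\<close> of boxes \<open>[x,y] \<times> {i}\<close>. The connected
  components of the slices of such an \<open>A\<close> are finitely many disjoint compact intervals, so finite
  additivity together with \<open>df ([x,y] \<times> {i}) = f\<^sub>i(y) - f\<^sub>i(x\<^sup>-)\<close> forces the value below;
  \<open>df_box\<close> and \<open>df_Un_disjoint\<close> confirm these two properties.
\<close>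

definition slice :: "(real \<times> nat) set \<Rightarrow> nat \<Rightarrow> real set" where
  "slice A i = {x. (x, i) \<in> A}"

definition df :: "tuple \<Rightarrow> (real \<times> nat) set \<Rightarrow> real" where
  "df f A = (\<Sum>i\<in>snd ` A. \<Sum>C\<in>components (slice A i). f i (Sup C) - left_lim (f i) (Inf C))"

definition elementary :: "(real \<times> nat) set \<Rightarrow> bool" where
  "elementary A \<longleftrightarrow>
     (\<exists>B. finite B \<and> (\<forall>b\<in>B. \<exists>x y i. x \<le> y \<and> b = {x..y} \<times> {i}) \<and> A = \<Union>B)"

lemma df_box:
  assumes "x \<le> y"
  shows "df f ({x..y} \<times> {i}) = f i y - left_lim (f i) x"
proof -
  have "slice ({x..y} \<times> {i}) i = {x..y}" by (auto simp: slice_def)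
  moreover have "components {x..y} = {{x..y}}"
    using assms by (simp add: components_eq_sing_iff)
  ultimately show ?thesis using assms by (simp add: df_def)
qed

lemma finite_components_Union:
  fixes I :: "'a::topological_space set set"
  assumes "finite I" "\<And>T. T \<in> I \<Longrightarrow> connected T"
  shows "finite (components (\<Union>I))"
proof -
  have "components (\<Union>I) \<subseteq> (\<lambda>T. connected_component_set (\<Union>I) (SOME x. x \<in> T)) ` I"
  proof
    fix C assume "C \<in> components (\<Union>I)"
    then obtain x T where x: "x \<in> T" "T \<in> I" "C = connected_component_set (\<Union>I) x"
      by (auto simp: components_def)
    define z where "z = (SOME z. z \<in> T)"
    have "z \<in> T" unfolding z_def using x(1) by (rule someI)
    hence "connected_component (\<Union>I) x z"
      unfolding connected_component_def using x assms(2) by blast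
    hence "C = connected_component_set (\<Union>I) z"
      using x(3) connected_component_eq by (metis mem_Collect_eq)
    thus "C \<in> (\<lambda>T. connected_component_set (\<Union>I) (SOME x. x \<in> T)) ` I"
      using x(2) z_def by blast
  qed
  thus ?thesis using assms(1) finite_surj by blast
qed

lemma components_Un_disjoint_closed:
  fixes S T :: "'a::topological_space set"
  assumes "closed S" "closed T" "S \<inter> T = {}"
  shows "components (S \<union> T) = components S \<union> components T"
proof -
  have *: "connected_component_set (S \<union> T) x = connected_component_set S x"
    if "closed S" "closed T" "S \<inter> T = {}" "x \<in> S" for S T :: "'a set" and x
  proof
    let ?C = "connected_component_set (S \<union> T) x"
    have C: "connected ?C" "?C \<subseteq> S \<union> T" "x \<in> ?C"
      using that(4) by (auto simp: connected_component_subset connected_component_refl)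
    have "S \<inter> ?C = {} \<or> T \<inter> ?C = {}"
      using C that by (intro connected_closedD[OF C(1)]) auto
    hence "?C \<subseteq> S" using C that(4) by blast
    thus "?C \<subseteq> connected_component_set S x"
      using C by (intro connected_component_maximal) auto
    show "connected_component_set S x \<subseteq> ?C" by (rule connected_component_mono) simp
  qed
  have "components (S \<union> T) =
      connected_component_set (S \<union> T) ` S \<union> connected_component_set (S \<union> T) ` T"
    by (simp add: components_def image_Un)
  also have "\<dots> = components S \<union> components T"
    using *[OF assms] *[OF assms(2,1)] assms(3)
    by (auto simp: components_def Un_commute Int_commute)
  finally show ?thesis .
qed

lemma slice_elementary:
  assumes "elementary A"
  shows "closed (slice A i)" "finite (components (slice A i))" "finite (snd ` A)"
proof -
  obtain B where B: "finite B" "\<And>b. b \<in> B \<Longrightarrow> \<exists>x y j. x \<le> y \<and> b = {x..y} \<times> {j}" "A = \<Union>B"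
    using assms unfolding elementary_def by blast
  have eq: "slice A i = \<Union>((\<lambda>b. slice b i) ` B)" by (auto simp: slice_def B(3))
  have sl: "closed (slice b i) \<and> connected (slice b i) \<and> finite (snd ` b)" if b: "b \<in> B" for b
  proof -
    obtain x y j where b_eq: "b = {x..y} \<times> {j}" using B(2)[OF b] by blast
    hence "slice b i = (if i = j then {x..y} else {})" by (auto simp: slice_def)
    thus ?thesis using b_eq by (auto intro: finite_subset[of _ "{j}"])
  qed
  show "closed (slice A i)" unfolding eq using B(1) sl by (intro closed_Union) auto
  show "finite (components (slice A i))"
    unfolding eq using B(1) sl by (intro finite_components_Union) auto
  show "finite (snd ` A)" unfolding B(3) image_Union using B(1) sl by auto
qed

lemma df_Un_disjoint:
  assumes A: "elementary A" and B: "elementary B" and disj: "A \<inter> B = {}"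
  shows "df f (A \<union> B) = df f A + df f B"
proof -
  let ?h = "\<lambda>A i. \<Sum>C\<in>components (slice A i). f i (Sup C) - left_lim (f i) (Inf C)"
  let ?I = "snd ` A \<union> snd ` B"
  have ext: "df f X = (\<Sum>i\<in>?I. ?h X i)" if "snd ` X \<subseteq> ?I" for X
    unfolding df_def
  proof (rule sum.mono_neutral_left)
    show "finite ?I" using slice_elementary(3) A B by blast
    have "slice X i = {}" if "i \<notin> snd ` X" for i using that by (force simp: slice_def)
    thus "\<forall>i\<in>?I - snd ` X. ?h X i = 0" by simp
  qed (use that in auto)
  have "?h (A \<union> B) i = ?h A i + ?h B i" for i
  proof -
    have d: "slice A i \<inter> slice B i = {}" using disj by (auto simp: slice_def)
    have "slice (A \<union> B) i = slice A i \<union> slice B i" by (auto simp: slice_def)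
    hence "components (slice (A \<union> B) i) = components (slice A i) \<union> components (slice B i)"
      using slice_elementary A B d by (simp add: components_Un_disjoint_closed)
    moreover have "components (slice A i) \<inter> components (slice B i) = {}"
      using d in_components_subset in_components_nonempty by fastforce
    ultimately show ?thesis
      using slice_elementary A B by (simp add: sum.union_disjoint)
  qed
  moreover have "df f (A \<union> B) = (\<Sum>i\<in>?I. ?h (A \<union> B) i)" by (rule ext) auto
  ultimately show ?thesis using ext[of A] ext[of B] by (simp add: sum.distrib)
qed

text \<open>
  Paths from \<open>(x,l)\<close> to \<open>(y,m)\<close>, where \<open>l \<ge> m \<ge> 1\<close> (so that \<open>m - 1\<close> is not truncated);
  \<open>\<tau> i\<close> is the time \<open>t\<^sub>i\<close>.
\<close>

definition paths :: "real \<times> nat \<Rightarrow> real \<times> nat \<Rightarrow> (real \<times> nat) set set" where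
  "paths p q =
     {\<pi>. \<exists>\<tau> :: nat \<Rightarrow> real. \<tau> (snd p) = fst p \<and> \<tau> (snd q - 1) = fst q \<and>
          (\<forall>i\<in>{snd q..snd p}. \<tau> i \<le> \<tau> (i - 1)) \<and>
          \<pi> = (\<Union>i\<in>{snd q..snd p}. {\<tau> i..\<tau> (i - 1)} \<times> {i})}"

definition disjoint_path_tuples ::
  "nat \<Rightarrow> real \<times> nat \<Rightarrow> real \<times> nat \<Rightarrow> (nat \<Rightarrow> (real \<times> nat) set) set" where
  "disjoint_path_tuples k p q =
     {\<pi>. (\<forall>j\<in>{1..k}. \<pi> j \<in> paths p q) \<and>
          (\<forall>i\<in>{1..k}. \<forall>j\<in>{1..k}. i \<noteq> j \<longrightarrow> finite (\<pi> i \<inter> \<pi> j))}"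

text \<open>The last passage value \<open>f[p\<^sup>k \<rightarrow> q\<^sup>k]\<close>.\<close>

definition last_passage :: "tuple \<Rightarrow> nat \<Rightarrow> real \<times> nat \<Rightarrow> real \<times> nat \<Rightarrow> real" where
  "last_passage f k p q =
     (if k = 0 then 0
      else SUP \<pi>\<in>disjoint_path_tuples k p q. df f (\<Union>j\<in>{1..k}. \<pi> j))"

definition Wmap :: "nat \<Rightarrow> real \<Rightarrow> tuple \<Rightarrow> tuple" where
  "Wmap n t f =
     (\<lambda>k\<in>{1..n}. \<lambda>y\<in>{0..t}.
        last_passage f k (0, n) (y, 1) - last_passage f (k - 1) (0, n) (y, 1))"

definition Rmap :: "nat \<Rightarrow> real \<Rightarrow> tuple \<Rightarrow> tuple" where
  "Rmap n t f =
     (\<lambda>i\<in>{1..n}. \<lambda>x\<in>{0..t}. f (n + 1 - i) t - left_lim (f (n + 1 - i)) (t - x))"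

text \<open>The limit of \<open>R\<^sub>s W\<^sub>s R\<^sub>s (f|\<^bsub>[0,s]\<^esub>)\<close> as \<open>s \<rightarrow> \<infinity>\<close>, uniform on compact sets.\<close>

definition Mmap :: "nat \<Rightarrow> tuple \<Rightarrow> tuple" where
  "Mmap n f =
     (THE h. h \<in> Dtuples n {0..} \<and>
        (\<forall>i\<in>{1..n}. \<forall>K. compact K \<and> K \<subseteq> {0..} \<longrightarrow>
           uniform_limit K
             (\<lambda>s. Rmap n s (Wmap n s (Rmap n s (tuple_restrict n {0..s} f))) i) (h i) at_top))"

definition Dtuples_ordered :: "nat \<Rightarrow> real \<Rightarrow> tuple set" where
  "Dtuples_ordered n t =
     {w \<in> Dtuples n {0..t}.
        \<forall>s\<in>{0..t}. \<forall>i. 1 \<le> i \<and> i \<le> n - 1 \<longrightarrow> w (i + 1) s \<le> left_lim (w i) s}"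

text \<open>Gelfand--Tsetlin patterns; \<open>g i j\<close> is \<open>g\<^sub>i(j)\<close>, and \<open>undefined\<close> unless \<open>1 \<le> i \<le> j \<le> n\<close>.\<close>

definition GTpatterns :: "nat \<Rightarrow> (nat \<Rightarrow> nat \<Rightarrow> real) set" where
  "GTpatterns n =
     {g \<in> (\<Pi>\<^sub>E i\<in>{1..n}. {i..n} \<rightarrow>\<^sub>E (UNIV :: real set)).
        \<forall>i j. 1 \<le> i \<and> i \<le> j - 1 \<and> j \<le> n \<longrightarrow> g i (j - 1) \<le> g i j \<and> g (i + 1) j \<le> g i (j - 1)}"

definition RSKtarget :: "nat \<Rightarrow> real \<Rightarrow> (tuple \<times> (nat \<Rightarrow> nat \<Rightarrow> real)) set" where
  "RSKtarget n t =
     {(w, g). w \<in> Dtuples_ordered n t \<and> g \<in> GTpatterns n \<and> (\<forall>i\<in>{1..n}. w i t = g i n)}"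

definition Gmap :: "nat \<Rightarrow> real \<Rightarrow> tuple \<Rightarrow> nat \<Rightarrow> nat \<Rightarrow> real" where
  "Gmap n t f =
     (\<lambda>i\<in>{1..n}. \<lambda>s\<in>{i..n}.
        last_passage f i (0, n) (t, n - s + 1) - last_passage f (i - 1) (0, n) (t, n - s + 1))"

lemma Gmap_sum:
  assumes "1 \<le> k" "k \<le> s" "s \<le> n"
  shows "(\<Sum>i=1..k. Gmap n t f i s) = last_passage f k (0, n) (t, n - s + 1)"
proof -
  have "(\<Sum>i=1..k. Gmap n t f i s) =
      (\<Sum>i=1..k. last_passage f i (0, n) (t, n - s + 1) - last_passage f (i - 1) (0, n) (t, n - s + 1))"
    using assms by (intro sum.cong) (auto simp: Gmap_def)
  also have "\<dots> = last_passage f k (0, n) (t, n - s + 1)"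
    by (induction k) (auto simp: last_passage_def)
  finally show ?thesis .
qed

definition Delta_sum :: "nat \<Rightarrow> real \<Rightarrow> (nat \<Rightarrow> nat \<Rightarrow> real) \<Rightarrow> nat \<Rightarrow> nat \<Rightarrow> real" where
  "Delta_sum n \<alpha> g k l =
     (\<Sum>i=1 + (k - l)..k. \<alpha> * real i) + (\<Sum>i=1..l. g i (n - (k - l)))"

text \<open>
  Subtraction on \<open>nat\<close> gives the positive part \<open>(k - l)\<^sup>+\<close> in \<open>Delta_sum\<close>. For \<open>x \<ge> t\<close> the index
  \<open>k\<close> below is the one with \<open>x\<close> in \<open>[t+k, t+k+1)\<close>, or \<open>n\<close> if \<open>x \<ge> t + n\<close>; \<open>k = 0\<close> gives \<open>g(n)\<close>.
\<close>

definition Delta :: "nat \<Rightarrow> real \<Rightarrow> real \<Rightarrow> (nat \<Rightarrow> nat \<Rightarrow> real) \<Rightarrow> tuple" where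
  "Delta n t \<alpha> g =
     (\<lambda>l\<in>{1..n}. \<lambda>x\<in>{t..}.
        let k = min n (nat \<lfloor>x - t\<rfloor>)
        in if k = 0 then g l n else Delta_sum n \<alpha> g k l - Delta_sum n \<alpha> g k (l - 1))"

lemma Delta_start: "l \<in> {1..n} \<Longrightarrow> Delta n t \<alpha> g l t = g l n"
  by (simp add: Delta_def)

lemma Delta_const:
  assumes "l \<in> {1..n}" "k \<in> {1..n}" "t + real k - 1 \<le> x" "x < t + real k"
  shows "Delta n t \<alpha> g l x = Delta n t \<alpha> g l (t + real k - 1)"
proof -
  have "\<lfloor>x - t\<rfloor> = int k - 1" using assms by (intro floor_unique) auto
  moreover have "\<lfloor>real k - 1\<rfloor> = int k - 1" by (intro floor_unique) auto
  ultimately show ?thesis using assms by (auto simp: Delta_def)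
qed

lemma Delta_const_end:
  assumes "l \<in> {1..n}" "t + real n \<le> x"
  shows "Delta n t \<alpha> g l x = Delta n t \<alpha> g l (t + real n)"
proof -
  have "int n \<le> \<lfloor>x - t\<rfloor>" using assms by (simp add: le_floor_iff)
  thus ?thesis using assms by (auto simp: Delta_def min_def)
qed

lemma Delta_sum:
  assumes "l \<in> {1..n}" "k \<in> {1..n}"
  shows "(\<Sum>i=1..l. Delta n t \<alpha> g i (t + real k)) =
    (\<Sum>i=1 + (k - l)..k. \<alpha> * real i) + (\<Sum>i=1..l. g i (n - (k - l)))"
proof -
  have "(\<Sum>i=1..l. Delta n t \<alpha> g i (t + real k)) =
      (\<Sum>i=1..l. Delta_sum n \<alpha> g k i - Delta_sum n \<alpha> g k (i - 1))"
    using assms by (intro sum.cong) (auto simp: Delta_def)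
  also have "\<dots> = Delta_sum n \<alpha> g k l"
    by (induction l) (auto simp: Delta_sum_def)
  finally show ?thesis by (simp add: Delta_sum_def)
qed

definition tuple_concat :: "nat \<Rightarrow> real \<Rightarrow> tuple \<Rightarrow> tuple \<Rightarrow> tuple" where
  "tuple_concat n t w h = (\<lambda>i\<in>{1..n}. \<lambda>x\<in>{0..}. if x \<le> t then w i x else h i x)"

definition Omap :: "nat \<Rightarrow> real \<Rightarrow> tuple \<times> (nat \<Rightarrow> nat \<Rightarrow> real) \<Rightarrow> tuple" where
  "Omap n t = (\<lambda>(w, g). tuple_concat n t w (Delta n t (real (n - 1) * (g 1 n - g n n)) g))"

definition RSK :: "nat \<Rightarrow> real \<Rightarrow> tuple \<Rightarrow> tuple \<times> (nat \<Rightarrow> nat \<Rightarrow> real)" where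
  "RSK n t f = (Wmap n t f, Gmap n t f)"

end

theory Submission
  imports Defs
begin

text \<open>
  Every time is stretched to an interval on which line \<open>n\<close> rises first and line \<open>1\<close> last. Cadlag
  tuples become continuous tuples on a linear continuum, last passage values are unchanged, and
  overlaps of paths no longer carry weight. For continuous tuples the two-line Pitman operation
  preserves all last passage values between lines \<open>n\<close> and \<open>1\<close>: at the level where two lines meet, the
  turning times of disjoint paths range independently over intervals, and on each interval the change
  is explicit. Row insertion by Pitman operations produces an ordered tuple, from which last passage
  values starting at time \<open>0\<close> are read off; hence it computes \<open>W\<close> and the Gelfand--Tsetlin pattern, and
  inverting it row by row, with the pattern as terminal values, gives surjectivity.

  For the inverse, continue \<open>f\<close> after \<open>t\<close> as a constant plus a jump of size \<open>\<alpha> i\<close> in line \<open>i\<close> at time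
  \<open>t + i\<close>. A path collects at most one jump, and \<open>\<alpha>\<close> is so large that \<open>k\<close> optimal paths collect the \<open>k\<close>
  latest available ones. So \<open>W\<close> of the continuation \<open>F\<close> is \<open>O(RSK f)\<close>, and \<open>k\<close> optimal paths from
  time \<open>z\<close> to a late time stay in the \<open>k\<close> bottom lines. Since \<open>R W R\<close> of \<open>W F\<close> is expressed by last
  passage values of \<open>W F\<close>, which are those of \<open>F\<close>, it equals \<open>F\<close> on compact sets.
\<close>

section \<open>Continuous functions on a linear continuum\<close>

text \<open>At a jump time the weight of a union of paths is not the sum of their weights:
  essentially disjoint paths may touch, and a jump at a common point counts once. Paths that touch
  therefore have to be told apart inside a single instant. The order of the rises is dictated by the
  paths: at one time a path may pass several lines in decreasing order and collect all their jumps,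
  so line \<open>n\<close> has to rise before line \<open>1\<close>. Stretching all times alike, and
  not only the jump times, keeps the space independent of \<open>f\<close>; but
  \<open>[0,\<infinity>) x [0,1]\<close> in lexicographic order is not metrizable, hence the work
  over a general linear continuum with a least element. The constant
  \<open>(n-1)(g_1(n)-g_n(n))\<close> bounds the price of keeping \<open>k\<close> paths out of the
  first \<open>M \<ge> 1\<close> lines up to time \<open>t\<close>: this price is a sum of
  \<open>k \<le> n-1\<close> differences of pattern entries, each at most
  \<open>g_1(n)-g_n(n)\<close>.\<close>

class timeline = linear_continuum_topology + order_bot + no_top

text \<open>Heine-Borel by the supremum argument: \<open>Q\<close> collects the points reached by
  finite subcovers. A member of the cover around \<open>Sup Q\<close> carries a finite subcover up
  to \<open>Sup Q\<close>, and beyond it unless \<open>Sup Q = b\<close>.\<close>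

lemma compact_atLeastAtMost:
  fixes a b :: "'a::linear_continuum_topology"
  shows "compact {a..b}"
proof (cases "a \<le> b")
  case ab: True
  show ?thesis
  proof (rule compactI)
    fix C assume C: "\<forall>c\<in>C. open c" "{a..b} \<subseteq> \<Union>C"
    define Q where "Q = {x\<in>{a..b}. \<exists>D\<subseteq>C. finite D \<and> {a..x} \<subseteq> \<Union>D}"
    have aQ: "a \<in> Q"
    proof -
      have "a \<in> \<Union>C" using C(2) ab by auto
      then obtain c where "c \<in> C" "a \<in> c" by blast
      then have "{c} \<subseteq> C \<and> finite {c} \<and> {a..a} \<subseteq> \<Union>{c}" by auto
      then have "\<exists>D\<subseteq>C. finite D \<and> {a..a} \<subseteq> \<Union>D" by metis
      then show ?thesis using ab unfolding Q_def by simp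
    qed
    have bdd: "bdd_above Q" unfolding Q_def by (rule bdd_aboveI[of _ b]) auto
    define s where "s = Sup Q"
    have s: "a \<le> s" "s \<le> b"
    proof -
      show "a \<le> s" using cSup_upper[OF aQ bdd] unfolding s_def .
      have "\<And>x. x \<in> Q \<Longrightarrow> x \<le> b" unfolding Q_def by simp
      then show "s \<le> b" unfolding s_def using aQ by (intro cSup_least) blast+
    qed
    have "s \<in> \<Union>C" using C(2) s by auto
    then obtain c where c: "c \<in> C" "s \<in> c" by blast
    have reach: "\<exists>x\<in>Q. {x..s} \<subseteq> c"
    proof (cases "a = s")
      case True then have "s \<in> Q" "{s..s} \<subseteq> c" using aQ c by simp_all
      then show ?thesis by blast
    next
      case False
      then have "a < s" "open c" using s c C(1) by auto
      then obtain l where l: "l < s" "{l<..s} \<subseteq> c"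
        using open_left[OF _ c(2)] by blast
      then obtain x where x: "x \<in> Q" "l < x" using less_cSupD[of Q l] aQ unfolding s_def by blast
      then have "{x..s} \<subseteq> {l<..s}" by auto
      then show ?thesis using l x by blast
    qed
    then obtain x D where x: "x \<in> Q" "{x..s} \<subseteq> c" "D \<subseteq> C" "finite D" "{a..x} \<subseteq> \<Union>D"
      unfolding Q_def by blast
    have cover: "{a..s} \<subseteq> \<Union>(insert c D)"
    proof
      fix z assume "z \<in> {a..s}"
      then have "z \<in> {a..x} \<or> z \<in> {x..s}" by auto
      then show "z \<in> \<Union>(insert c D)" using x(2,5) by blast
    qed
    have "s = b"
    proof (rule ccontr)
      assume "s \<noteq> b"
      then have "s < b" using s by auto
      moreover have "open c" using c C(1) by blast
      ultimately obtain u where u: "s < u" "{s..<u} \<subseteq> c" using open_right[OF _ c(2)] by blast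
      then have "s < min u b" using \<open>s < b\<close> by simp
      then obtain v where v: "s < v" "v < min u b" using dense by blast
      have "{a..v} \<subseteq> \<Union>(insert c D)"
      proof
        fix z assume z: "z \<in> {a..v}"
        show "z \<in> \<Union>(insert c D)"
        proof (cases "z \<le> s")
          case True then have "z \<in> {a..s}" using z by auto
          then show ?thesis using cover by blast
        next
          case False then have "z \<in> {s..<u}" using z v by auto
          then show ?thesis using u(2) by blast
        qed
      qed
      moreover have "insert c D \<subseteq> C \<and> finite (insert c D)" using c x by auto
      ultimately have "\<exists>D\<subseteq>C. finite D \<and> {a..v} \<subseteq> \<Union>D" by blast
      then have "v \<in> Q" unfolding Q_def using v s by auto
      then have "v \<le> s" using cSup_upper[OF _ bdd] unfolding s_def by blast
      then show False using v by simp
    qed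
    moreover have "insert c D \<subseteq> C \<and> finite (insert c D)" using c x by auto
    ultimately show "\<exists>D\<subseteq>C. finite D \<and> {a..b} \<subseteq> \<Union>D" using cover by blast
  qed
qed auto

lemma continuous_bounded_interval:
  fixes X :: "'a::linear_continuum_topology \<Rightarrow> real"
  assumes "continuous_on UNIV X"
  shows "\<exists>M. \<forall>z\<in>{a..b}. \<bar>X z\<bar> \<le> M"
proof -
  have "compact (X ` {a..b})"
    using assms by (intro compact_continuous_image compact_atLeastAtMost) (auto intro: continuous_on_subset)
  from compact_imp_bounded[OF this] show ?thesis unfolding bounded_real by auto
qed

text \<open>One criterion for both \<open>runmax\<close> and \<open>future_min\<close>: wherever
  \<open>S\<close> moves, its increment is paid for by an oscillation of \<open>X\<close> over the
  same interval, so continuity passes from \<open>X\<close> to \<open>S\<close>.\<close>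

lemma continuous_of_oscillation:
  fixes X S :: "'a::timeline \<Rightarrow> real"
  assumes X: "continuous_on UNIV X" and S: "mono S"
    and osc: "\<And>x y. x < y \<Longrightarrow> S x = S y \<or> (\<exists>u\<in>{x..y}. \<exists>v\<in>{x..y}. S y - S x \<le> X u - X v)"
  shows "continuous_on UNIV S"
proof -
  have near: "dist (S w) (S z) < e"
    if "w \<le> z" "e > 0" "\<forall>u\<in>{w..z}. dist (X u) c < e / 2" for w z e c
  proof (cases "w = z")
    case False
    then have "w < z" using that by simp
    have "X u - X v < e" if "u \<in> {w..z}" "v \<in> {w..z}" for u v
    proof -
      have "dist (X u) c < e / 2" "dist (X v) c < e / 2"
        using that \<open>\<forall>u\<in>{w..z}. dist (X u) c < e / 2\<close> by blast+
      then show ?thesis unfolding dist_real_def by linarith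
    qed
    then have "S z - S w < e" using osc[OF \<open>w < z\<close>] \<open>e > 0\<close> by force
    moreover have "S w \<le> S z" using S \<open>w \<le> z\<close> by (auto simp: mono_def)
    ultimately show ?thesis by (simp add: dist_real_def)
  qed (use that in simp)
  have Xl: "(X \<longlongrightarrow> X z) (at z)" for z
    using X by (simp add: continuous_on_def)
  have "(S \<longlongrightarrow> S z) (at z)" for z
    proof (subst at_eq_sup_left_right, rule filterlim_sup)
    show "(S \<longlongrightarrow> S z) (at_right z)"
    proof (rule tendstoI)
      fix e :: real assume e: "e > 0"
      have "eventually (\<lambda>w. dist (X w) (X z) < e / 2) (at_right z)"
        using tendstoD[OF Xl[of z], of "e/2"] e by (simp add: eventually_at_split)
      moreover obtain y where "z < y" using gt_ex by blast
      ultimately obtain b where b: "z < b" "\<And>w. z < w \<Longrightarrow> w < b \<Longrightarrow> dist (X w) (X z) < e / 2"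
        unfolding eventually_at_right[OF \<open>z < y\<close>] by auto
      have "dist (S w) (S z) < e" if "z < w" "w < b" for w
      proof -
        have "dist (X u) (X z) < e / 2" if "u \<in> {z..w}" for u
          using that b(2)[of u] \<open>z < w\<close> \<open>w < b\<close> e by (cases "u = z") auto
        then have "dist (S z) (S w) < e" using that e by (intro near[of z w _ "X z"]) auto
        then show ?thesis by (simp only: dist_commute)
      qed
      then show "eventually (\<lambda>w. dist (S w) (S z) < e) (at_right z)"
        unfolding eventually_at_right[OF b(1)] using b(1) by auto
    qed
    show "(S \<longlongrightarrow> S z) (at_left z)"
    proof (cases "z = bot")
      case True
      then have "at_left z = bot"
        by (metis at_within_empty bot.extremum_strict equals0I lessThan_iff)
      then show ?thesis by simp
    next
      case False
      then have "bot < z" using bot.not_eq_extremum by blast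
      show ?thesis
      proof (rule tendstoI)
        fix e :: real assume e: "e > 0"
        have "eventually (\<lambda>w. dist (X w) (X z) < e / 2) (at_left z)"
          using tendstoD[OF Xl[of z], of "e/2"] e by (simp add: eventually_at_split)
        then obtain b where b: "b < z" "\<And>w. b < w \<Longrightarrow> w < z \<Longrightarrow> dist (X w) (X z) < e / 2"
          unfolding eventually_at_left[OF \<open>bot < z\<close>] by auto
        have "dist (S w) (S z) < e" if "b < w" "w < z" for w
        proof -
          have "dist (X u) (X z) < e / 2" if "u \<in> {w..z}" for u
            using that b(2)[of u] \<open>b < w\<close> \<open>w < z\<close> e by (cases "u = z") auto
          then show ?thesis using that e by (intro near[of w z _ "X z"]) auto
        qed
        then show "eventually (\<lambda>w. dist (S w) (S z) < e) (at_left z)"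
          unfolding eventually_at_left[OF b(1)] using b(1) by auto
      qed
    qed
  qed
  then show ?thesis by (simp add: continuous_on_def)
qed

section \<open>First passage times and running maxima\<close>

lemma first_passage:
  fixes X :: "'a::linear_continuum_topology \<Rightarrow> real"
  assumes X: "continuous_on UNIV X" and "a \<le> b" "X a \<le> v" "v \<le> X b"
  shows "\<exists>u\<in>{a..b}. X u = v \<and> (\<forall>z\<in>{a..<u}. X z < v)"
proof -
  define K where "K = {a..b} \<inter> X -` {v..}"
  have "closed (X -` {v..})" using X by (simp add: continuous_on_closed_vimage)
  then have "compact K" unfolding K_def by (intro compact_Int_closed compact_atLeastAtMost)
  moreover have "K \<noteq> {}" using assms unfolding K_def by auto
  ultimately obtain u where u: "u \<in> K" "\<And>z. z \<in> K \<Longrightarrow> u \<le> z" using compact_attains_inf by meson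
  have before: "X z < v" if "z \<in> {a..<u}" for z
    using u that unfolding K_def by (force simp: not_le[symmetric])
  obtain z where z: "a \<le> z" "z \<le> u" "X z = v"
    using IVT'[of X a v u] X u(1) assms(3) unfolding K_def by (auto intro: continuous_on_subset)
  then have "z = u" using before by force
  then show ?thesis using u z before unfolding K_def by (intro bexI[of _ u]) auto
qed

definition runmax :: "('a::timeline \<Rightarrow> real) \<Rightarrow> 'a \<Rightarrow> real" where
  "runmax X y = Sup (X ` {..y})"

lemma
  fixes X :: "'a::timeline \<Rightarrow> real"
  assumes X: "continuous_on UNIV X"
  shows runmax_upper: "u \<le> y \<Longrightarrow> X u \<le> runmax X y"
    and runmax_attained: "\<exists>u\<le>y. runmax X y = X u"
proof -
  have eq: "{..y} = {bot..y}" for y :: 'a by auto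
  have "{bot..y} \<noteq> {}" by simp
  then obtain u where u: "u \<in> {bot..y}" "\<And>z. z \<in> {bot..y} \<Longrightarrow> X z \<le> X u"
    using continuous_attains_sup[of "{bot..y}" X] compact_atLeastAtMost[of bot y] X
    by (metis continuous_on_subset subset_UNIV)
  then have "runmax X y = X u" unfolding runmax_def eq by (intro cSup_eq_maximum) auto
  then show "\<exists>u\<le>y. runmax X y = X u" "u \<le> y \<Longrightarrow> X u \<le> runmax X y" for u using u by auto
qed

lemma runmax_least: "continuous_on UNIV X \<Longrightarrow> (\<And>u. u \<le> y \<Longrightarrow> X u \<le> v) \<Longrightarrow> runmax X y \<le> v"
  using runmax_attained by metis

lemma runmax_mono:
  assumes X: "continuous_on UNIV X"
  shows "mono (runmax X)"
  by (rule monoI, rule runmax_least[OF X]) (meson X order_trans runmax_upper)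

lemma runmax_bot:
  assumes X: "continuous_on UNIV X"
  shows "runmax X bot = X bot"
  using runmax_attained[OF X, of bot] by (metis bot.extremum_uniqueI)

lemma runmax_continuous:
  assumes X: "continuous_on UNIV X"
  shows "continuous_on UNIV (runmax X)"
proof (rule continuous_of_oscillation[OF X runmax_mono[OF X]])
  fix x y :: 'a assume "x < y"
  obtain u where u: "u \<le> y" "runmax X y = X u" using runmax_attained[OF X] by blast
  show "runmax X x = runmax X y \<or> (\<exists>u\<in>{x..y}. \<exists>v\<in>{x..y}. runmax X y - runmax X x \<le> X u - X v)"
  proof (cases "u \<le> x")
    case True
    then have "runmax X y \<le> runmax X x" using u runmax_upper[OF X] by metis
    moreover have "runmax X x \<le> runmax X y" using runmax_mono[OF X] \<open>x < y\<close> by (simp add: mono_def)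
    ultimately show ?thesis by simp
  next
    case False
    then show ?thesis using u runmax_upper[OF X, of x x] \<open>x < y\<close>
      by (intro disjI2 bexI[of _ u] bexI[of _ x]) auto
  qed
qed

text \<open>Together: the maximum of \<open>X\<close> over \<open>[a,b]\<close> exceeds that of \<open>X - 2S\<close> by exactly \<open>S(a) + S(b)\<close>.
  This identity is behind the isometry property of the two-line operation.\<close>

lemma
  fixes X :: "'a::timeline \<Rightarrow> real"
  defines "S \<equiv> runmax X"
  assumes X: "continuous_on UNIV X" and t: "a \<le> t" "t \<le> b"
  shows runmax_reflect_ge: "\<exists>t'\<in>{a..b}. X t - S a - S b \<le> X t' - 2 * S t'"
    and runmax_reflect_le: "\<exists>t'\<in>{a..b}. X t - 2 * S t + S a + S b \<le> X t'"
proof -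
  have mono: "S x \<le> S y" if "x \<le> y" for x y
    using runmax_mono[OF X] that unfolding S_def by (simp add: mono_def)
  have up: "X u \<le> S y" if "u \<le> y" for u y using runmax_upper[OF X that] by (simp add: S_def)
  have S: "S a \<le> S t" "S t \<le> S b" "X t \<le> S t" using mono up t by auto
  have *: "(\<exists>t'\<in>{a..b}. X t - S a - S b \<le> X t' - 2 * S t') \<and> (\<exists>t'\<in>{a..b}. X t - 2 * S t + S a + S b \<le> X t')"
  proof (cases "S a = S b")
    case True
    then show ?thesis using S t by (intro conjI bexI[of _ t]) auto
  next
    case False
    then have less: "S a < S b" using S by simp
    \<comment> \<open>Two witnesses: \<open>X v\<close> is the new maximum \<open>S b\<close>, while
      the \<open>u\<close> found below is the first time after \<open>a\<close> at which
      \<open>X\<close> reaches the old maximum. There \<open>X u = S u = S a\<close>, so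
      \<open>X u - 2 * S u = - S a\<close>.\<close>
    obtain v where v: "v \<le> b" "S b = X v" using runmax_attained[OF X] unfolding S_def by blast
    have "a \<le> v" using up[of v a] less v by (cases "v \<le> a") auto
    have "X a \<le> S a" by (rule up) simp
    then obtain u where u: "u \<in> {a..v}" "X u = S a" "\<And>z. z \<in> {a..<u} \<Longrightarrow> X z < S a"
      using first_passage[OF X \<open>a \<le> v\<close>, of "S a"] less v by auto
    have "S u \<le> S a" unfolding S_def
    proof (rule runmax_least[OF X])
      fix z assume "z \<le> u"
      then show "X z \<le> runmax X a"
        using u(2) u(3)[of z] up[of z a] by (cases "z \<le> a"; cases "z = u") (auto simp: S_def less_imp_le)
    qed
    then have "S u = S a" using mono[of a u] u by auto
    then have "X t - S a - S b \<le> X u - 2 * S u" using S u by simp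
    moreover have "X t - 2 * S t + S a + S b \<le> X v" using S v by simp
    ultimately show ?thesis using u v \<open>a \<le> v\<close> by (intro conjI) (auto intro: bexI[of _ u] bexI[of _ v])
  qed
  show "\<exists>t'\<in>{a..b}. X t - S a - S b \<le> X t' - 2 * S t'" "\<exists>t'\<in>{a..b}. X t - 2 * S t + S a + S b \<le> X t'"
    using * by auto
qed

section \<open>Last passage values of continuous tuples\<close>

text \<open>A family of \<open>k\<close> disjoint paths in lines \<open>p+1..n\<close> from time \<open>a\<close> to time \<open>b\<close>, ordered from left to
  right, is stored as the array of its turning times: path \<open>j\<close> is in line \<open>i+1\<close> during
  \<open>[T j (i+1), T j i]\<close>. For continuous functions overlaps at end points carry no weight.\<close>

definition arrays :: "nat \<Rightarrow> nat \<Rightarrow> nat \<Rightarrow> 'a::linorder \<Rightarrow> 'a \<Rightarrow> (nat \<Rightarrow> nat \<Rightarrow> 'a) set" where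
  "arrays n p k a b =
     {T. (\<forall>j<k. T j n = a \<and> T j p = b \<and> (\<forall>i\<in>{p..<n}. T j (Suc i) \<le> T j i)) \<and>
         (\<forall>j. Suc j < k \<longrightarrow> (\<forall>i\<in>{p..<n}. T j i \<le> T (Suc j) (Suc i)))}"

definition weight :: "(nat \<Rightarrow> 'a \<Rightarrow> real) \<Rightarrow> nat \<Rightarrow> nat \<Rightarrow> nat \<Rightarrow> (nat \<Rightarrow> nat \<Rightarrow> 'a) \<Rightarrow> real" where
  "weight F n p k T = (\<Sum>j<k. \<Sum>i\<in>{p..<n}. F (Suc i) (T j i) - F (Suc i) (T j (Suc i)))"

definition lpp :: "(nat \<Rightarrow> 'a::linorder \<Rightarrow> real) \<Rightarrow> nat \<Rightarrow> nat \<Rightarrow> nat \<Rightarrow> 'a \<Rightarrow> 'a \<Rightarrow> real" where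
  "lpp F n p k a b = Sup (weight F n p k ` arrays n p k a b)"

abbreviation cont_tuple :: "(nat \<Rightarrow> 'a::topological_space \<Rightarrow> real) \<Rightarrow> bool" where
  "cont_tuple F \<equiv> \<forall>i. continuous_on UNIV (F i)"

lemma arraysD:
  assumes "T \<in> arrays n p k a b" "j < k"
  shows "T j n = a" "T j p = b"
    and "p \<le> i \<Longrightarrow> i < n \<Longrightarrow> T j (Suc i) \<le> T j i"
    and "p \<le> i \<Longrightarrow> i < n \<Longrightarrow> Suc j < k \<Longrightarrow> T j i \<le> T (Suc j) (Suc i)"
  using assms unfolding arrays_def by auto

lemma arrays_antimono:
  assumes T: "T \<in> arrays n p k a b" "j < k" and "p \<le> i" "i \<le> l" "l \<le> n"
  shows "T j l \<le> T j i"
  using assms(4,5)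
proof (induction l rule: dec_induct)
  case (step m)
  then show ?case using arraysD(3)[OF T, of m] \<open>p \<le> i\<close> by force
qed simp

lemma arrays_range:
  assumes T: "T \<in> arrays n p k a b" "j < k" and "p \<le> i" "i \<le> n"
  shows "a \<le> T j i" "T j i \<le> b"
  using arrays_antimono[OF T, of i n] arrays_antimono[OF T, of p i] arraysD(1,2)[OF T] assms by auto

text \<open>Interlacing passes the common end time on by one level per path: with \<open>j\<close>
  paths ahead of it, path \<open>j\<close> can enter the lines up to \<open>p + j\<close> only at
  time \<open>b\<close>.\<close>

lemma arrays_end:
  assumes T: "T \<in> arrays n p k a b" and "j < k" "p \<le> i" "i \<le> n" "i \<le> p + j"
  shows "T j i = b"
  using assms(2-)
proof (induction j arbitrary: i)
  case 0 then show ?case using arraysD(2)[OF T] by force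
next
  case (Suc j)
  show ?case
  proof (cases "i = p")
    case True then show ?thesis using arraysD(2)[OF T] Suc by force
  next
    case False
    then obtain i' where i': "i = Suc i'" using Suc.prems by (cases i) auto
    then have "T j i' = b" using Suc False by auto
    moreover have "T j i' \<le> T (Suc j) i"
      using arraysD(4)[OF T, of j i'] Suc.prems False i' by auto
    ultimately show ?thesis using arrays_range(2)[OF T, of "Suc j" i] Suc.prems by auto
  qed
qed

text \<open>Mirror image of \<open>arrays_end\<close>: the \<open>k - 1 - j\<close> paths to the
  right of path \<open>j\<close> force it to be in line \<open>n - k + j + 1\<close> or a smaller
  one from time \<open>a\<close> on.\<close>

lemma arrays_start:
  assumes T: "T \<in> arrays n p k a b" and "i \<le> n" "p \<le> i" "j < k" "j + n < i + k"
  shows "T j i = a"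
  using assms(2-)
proof (induction i arbitrary: j rule: inc_induct)
  case base then show ?case using arraysD(1)[OF T] by force
next
  case (step i)
  then have "T j i \<le> T (Suc j) (Suc i)" "T (Suc j) (Suc i) = a"
    using arraysD(4)[OF T, of j i] by auto
  then show ?case using arrays_range(1)[OF T, of j i] step.prems step.hyps by auto
qed

lemma weight_bounded:
  fixes F :: "nat \<Rightarrow> 'a::linear_continuum_topology \<Rightarrow> real"
  assumes F: "cont_tuple F"
  shows "bdd_above (weight F n p k ` arrays n p k a b)"
proof -
  have "\<exists>M. \<forall>i z. z \<in> {a..b} \<longrightarrow> \<bar>F i z\<bar> \<le> M i"
  proof (rule exI, intro allI impI)
    fix i z assume "z \<in> {a..b}"
    then show "\<bar>F i z\<bar> \<le> (SOME M. \<forall>z\<in>{a..b}. \<bar>F i z\<bar> \<le> M)"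
      using someI_ex[OF continuous_bounded_interval[of "F i" a b]] F by blast
  qed
  then obtain M where M: "\<And>i z. z \<in> {a..b} \<Longrightarrow> \<bar>F i z\<bar> \<le> M i" by blast
  show ?thesis
  proof (rule bdd_aboveI2)
    fix T assume T: "T \<in> arrays n p k a b"
    show "weight F n p k T \<le> (\<Sum>j<k. \<Sum>i\<in>{p..<n}. M (Suc i) + M (Suc i))"
      unfolding weight_def
    proof (intro sum_mono)
      fix j i assume ji: "j \<in> {..<k}" "i \<in> {p..<n}"
      then have "T j i \<in> {a..b}" "T j (Suc i) \<in> {a..b}" using arrays_range[OF T, of j] by auto
      from M[OF this(1), of "Suc i"] M[OF this(2), of "Suc i"]
      show "F (Suc i) (T j i) - F (Suc i) (T j (Suc i)) \<le> M (Suc i) + M (Suc i)" by linarith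
    qed
  qed
qed

lemma lpp_upper:
  fixes F :: "nat \<Rightarrow> 'a::linear_continuum_topology \<Rightarrow> real"
  assumes "cont_tuple F" "T \<in> arrays n p k a b"
  shows "weight F n p k T \<le> lpp F n p k a b"
  unfolding lpp_def using assms by (intro cSup_upper weight_bounded) auto

text \<open>Path \<open>j\<close> spends the whole interval in line \<open>q + j + 1\<close>, all
  turns taking place at the two end points. These families show that \<open>arrays\<close> is
  nonempty and supply the lower bounds.\<close>

definition straight :: "nat \<Rightarrow> 'a \<Rightarrow> 'a \<Rightarrow> nat \<Rightarrow> nat \<Rightarrow> 'a" where
  "straight q a b j i = (if i \<le> q + j then b else a)"

lemma straight_arrays: "a \<le> b \<Longrightarrow> p \<le> q \<Longrightarrow> q + k \<le> n \<Longrightarrow> straight q a b \<in> arrays n p k a b"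
  by (auto simp: arrays_def straight_def)

lemma weight_straight:
  assumes "p \<le> q" "q + k \<le> n"
  shows "weight F n p k (straight q a b) = (\<Sum>j<k. F (Suc (q + j)) b - F (Suc (q + j)) a)"
  unfolding weight_def
proof (rule sum.cong)
  fix j assume j: "j \<in> {..<k}"
  have "(\<Sum>i\<in>{p..<n}. F (Suc i) (straight q a b j i) - F (Suc i) (straight q a b j (Suc i))) =
     (\<Sum>i\<in>{q + j}. F (Suc i) (straight q a b j i) - F (Suc i) (straight q a b j (Suc i)))"
    using assms j by (intro sum.mono_neutral_right) (auto simp: straight_def)
  then show "(\<Sum>i\<in>{p..<n}. F (Suc i) (straight q a b j i) - F (Suc i) (straight q a b j (Suc i))) =
     F (Suc (q + j)) b - F (Suc (q + j)) a" by (simp add: straight_def)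
qed simp

lemma lpp_least:
  assumes "a \<le> b" "p + k \<le> n" "\<And>T. T \<in> arrays n p k a b \<Longrightarrow> weight F n p k T \<le> c"
  shows "lpp F n p k a b \<le> c"
  unfolding lpp_def using assms straight_arrays[of a b p p k n] by (intro cSup_least) auto

lemma lpp_straight:
  fixes F :: "nat \<Rightarrow> 'a::linear_continuum_topology \<Rightarrow> real"
  assumes "cont_tuple F" "a \<le> b" "p \<le> q" "q + k \<le> n"
  shows "(\<Sum>j<k. F (Suc (q + j)) b - F (Suc (q + j)) a) \<le> lpp F n p k a b"
  using lpp_upper[OF assms(1) straight_arrays[of a b p q k n]] weight_straight[of p q k n F a b] assms
  by simp

subsection \<open>The two-line operation and its isometry property\<close>

text \<open>The new line \<open>i\<close> at \<open>z\<close> is the maximum over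
  \<open>u \<le> z\<close> of \<open>F (Suc i) u + F i z - F i u\<close>: for a tuple starting at 0,
  the two-line last passage value. Line \<open>i + 1\<close> keeps the rest, so the sum of the two
  lines is preserved.\<close>

definition pitman :: "nat \<Rightarrow> (nat \<Rightarrow> 'a::timeline \<Rightarrow> real) \<Rightarrow> nat \<Rightarrow> 'a \<Rightarrow> real" where
  "pitman i F = (let S = runmax (\<lambda>z. F (Suc i) z - F i z)
     in F(i := \<lambda>z. F i z + S z, Suc i := \<lambda>z. F (Suc i) z - S z))"

lemma pitman_cont: "cont_tuple F \<Longrightarrow> cont_tuple (pitman i F)"
  unfolding pitman_def Let_def
  by (auto intro!: continuous_on_add continuous_on_diff runmax_continuous)

text \<open>The maximum and minimum of two times are the same two times again. So the end points of
  the \<open>k\<close> windows used in \<open>arrays_change_level\<close> are, taken together, a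
  rearrangement of the turning times at the two neighbouring levels.\<close>

lemma sum_min_max:
  fixes a b :: "nat \<Rightarrow> 'a::linorder" and S :: "'a \<Rightarrow> real" and k :: nat
  defines "L \<equiv> \<lambda>j. if j = 0 then a 0 else max (a j) (b (j - 1))"
  defines "U \<equiv> \<lambda>j. if Suc j < k then min (b j) (a (Suc j)) else b j"
  shows "(\<Sum>j<k. S (L j) + S (U j)) = (\<Sum>j<k. S (b j) + S (a j))"
proof (cases k)
  case (Suc m)
  have 1: "(\<Sum>j<Suc m. S (L j)) + (\<Sum>j<m. S (min (b j) (a (Suc j)))) + S (b m) = (\<Sum>j<Suc m. S (b j) + S (a j))" for m
  proof (induction m)
    case (Suc m)
    have "S (max (a (Suc m)) (b m)) + S (min (b m) (a (Suc m))) = S (a (Suc m)) + S (b m)"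
      by (auto simp: max_def min_def)
    then show ?case using Suc by (simp add: L_def)
  qed (simp add: L_def)
  have 2: "(\<Sum>j<k. S (U j)) = (\<Sum>j<m. S (min (b j) (a (Suc j)))) + S (b m)"
    unfolding Suc by (simp add: U_def Suc)
  show ?thesis using 1[of m] 2 Suc by (simp add: sum.distrib)
qed simp

text \<open>Given the turning times at all other levels, the turning times at one level can be chosen
  independently of each other, in intervals whose end points are paired with the neighbouring turning
  times by \<open>sum_min_max\<close>.\<close>

lemma arrays_change_level:
  assumes T: "T \<in> arrays n p k a b" and q: "p \<le> q" "Suc q < n"
  defines "L \<equiv> \<lambda>j. if j = 0 then T 0 (Suc (Suc q)) else max (T j (Suc (Suc q))) (T (j - 1) q)"
  defines "U \<equiv> \<lambda>j. if Suc j < k then min (T j q) (T (Suc j) (Suc (Suc q))) else T j q"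
  shows "j < k \<Longrightarrow> L j \<le> T j (Suc q) \<and> T j (Suc q) \<le> U j"
    and "(\<And>j. j < k \<Longrightarrow> L j \<le> c j \<and> c j \<le> U j) \<Longrightarrow>
      (\<lambda>j l. if l = Suc q then c j else T j l) \<in> arrays n p k a b"
proof -
  show "j < k \<Longrightarrow> L j \<le> T j (Suc q) \<and> T j (Suc q) \<le> U j"
    using arraysD(3)[OF T, of j q] arraysD(3)[OF T, of j "Suc q"] q
      arraysD(4)[OF T, of "j - 1" q] arraysD(4)[OF T, of j "Suc q"]
    by (auto simp: L_def U_def)
  assume c: "\<And>j. j < k \<Longrightarrow> L j \<le> c j \<and> c j \<le> U j"
  have c1: "T j (Suc (Suc q)) \<le> c j" "c j \<le> T j q" if "j < k" for j
    using c[OF that] by (auto simp: L_def U_def split: if_splits)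
  have c2: "T j q \<le> c (Suc j)" "c j \<le> T (Suc j) (Suc (Suc q))" if "Suc j < k" for j
    using c[OF that] c[of j] that by (auto simp: L_def U_def split: if_splits)
  show "(\<lambda>j l. if l = Suc q then c j else T j l) \<in> arrays n p k a b"
    unfolding arrays_def
    using arraysD[OF T] c1 c2 q by auto
qed

text \<open>Only lines \<open>q + 1\<close> and \<open>q + 2\<close> change. The \<open>S\<close>
  added to one and subtracted from the other leaves, for each path, \<open>S\<close> at its turns at
  the two neighbouring levels, and replaces the contribution \<open>X\<close> of the turn in between
  by \<open>X - 2 * S\<close>.\<close>

lemma weight_pitman:
  fixes F :: "nat \<Rightarrow> 'a::timeline \<Rightarrow> real"
  assumes q: "p \<le> q" "Suc q < n"
    and T': "\<And>j l. l \<noteq> Suc q \<Longrightarrow> T' j l = T j l"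
  defines "X \<equiv> \<lambda>z. F (Suc (Suc q)) z - F (Suc q) z"
  defines "S \<equiv> runmax X"
  shows "weight (pitman (Suc q) F) n p k T' - weight F n p k T =
    (\<Sum>j<k. S (T j q) + S (T j (Suc (Suc q))) + (X (T' j (Suc q)) - 2 * S (T' j (Suc q))) - X (T j (Suc q)))"
proof -
  let ?G = "pitman (Suc q) F"
  have G: "?G (Suc q) z = F (Suc q) z + S z" "?G (Suc (Suc q)) z = F (Suc (Suc q)) z - S z"
    "l \<noteq> Suc q \<Longrightarrow> l \<noteq> Suc (Suc q) \<Longrightarrow> ?G l = F l" for z l
    by (auto simp: pitman_def Let_def S_def X_def)
  have "(\<Sum>i\<in>{p..<n}. ?G (Suc i) (T' j i) - ?G (Suc i) (T' j (Suc i))) -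
        (\<Sum>i\<in>{p..<n}. F (Suc i) (T j i) - F (Suc i) (T j (Suc i))) =
     S (T j q) + S (T j (Suc (Suc q))) + (X (T' j (Suc q)) - 2 * S (T' j (Suc q))) - X (T j (Suc q))" for j
  proof -
    define h where "h i = (?G (Suc i) (T' j i) - ?G (Suc i) (T' j (Suc i))) -
       (F (Suc i) (T j i) - F (Suc i) (T j (Suc i)))" for i
    have "sum h {p..<n} = sum h {q, Suc q}"
      using q by (intro sum.mono_neutral_right) (auto simp: h_def G T')
    also have "\<dots> = S (T j q) + S (T j (Suc (Suc q))) + (X (T' j (Suc q)) - 2 * S (T' j (Suc q))) - X (T j (Suc q))"
      by (simp add: h_def G T' X_def)
    finally show ?thesis by (simp add: h_def sum_subtractf)
  qed
  then show ?thesis by (simp add: weight_def sum_subtractf[symmetric])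
qed

theorem lpp_pitman:
  assumes F: "cont_tuple F" and i: "p < i" "i < n" and ab: "a \<le> b" "p + k \<le> n"
  shows "lpp (pitman i F) n p k a b = lpp F n p k a b"
proof -
  obtain q where q: "i = Suc q" "p \<le> q" "Suc q < n" using i by (cases i) auto
  define X where "X = (\<lambda>z. F (Suc (Suc q)) z - F (Suc q) z)"
  define S where "S = runmax X"
  have X: "continuous_on UNIV X" unfolding X_def using F by (intro continuous_on_diff) auto
  have wp: "weight (pitman (Suc q) F) n p k T' - weight F n p k T =
    (\<Sum>j<k. S (T j q) + S (T j (Suc (Suc q))) + (X (T' j (Suc q)) - 2 * S (T' j (Suc q))) - X (T j (Suc q)))"
    if "\<And>j l. l \<noteq> Suc q \<Longrightarrow> T' j l = T j l" for T T'
    unfolding S_def X_def by (rule weight_pitman[OF q(2,3) that])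
  show ?thesis unfolding q(1)
  proof (rule antisym; rule lpp_least[OF ab])
    fix T assume T: "T \<in> arrays n p k a b"
    define L where "L j = (if j = 0 then T 0 (Suc (Suc q)) else max (T j (Suc (Suc q))) (T (j - 1) q))" for j
    define U where "U j = (if Suc j < k then min (T j q) (T (Suc j) (Suc (Suc q))) else T j q)" for j
    note ch = arrays_change_level[OF T q(2,3), folded L_def U_def]
    have pair: "(\<Sum>j<k. S (L j) + S (U j)) = (\<Sum>j<k. S (T j q) + S (T j (Suc (Suc q))))"
      using sum_min_max[of S "\<lambda>j. T j (Suc (Suc q))" "\<lambda>j. T j q" k] by (simp add: L_def U_def)
    {
      have "\<exists>t'\<in>{L j..U j}. X (T j (Suc q)) - S (L j) - S (U j) \<le> X t' - 2 * S t'" if "j < k" for j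
        unfolding S_def using ch(1)[OF that] by (intro runmax_reflect_ge[OF X]) auto
      then obtain c where c: "\<And>j. j < k \<Longrightarrow> c j \<in> {L j..U j}"
         "\<And>j. j < k \<Longrightarrow> X (T j (Suc q)) - S (L j) - S (U j) \<le> X (c j) - 2 * S (c j)"
        by metis
      define T' where "T' = (\<lambda>j l. if l = Suc q then c j else T j l)"
      have T': "T' \<in> arrays n p k a b" unfolding T'_def using c(1) by (intro ch(2)) auto
      have "weight (pitman (Suc q) F) n p k T' - weight F n p k T =
        (\<Sum>j<k. S (T j q) + S (T j (Suc (Suc q))) + (X (c j) - 2 * S (c j)) - X (T j (Suc q)))"
        by (subst wp) (auto simp: T'_def)
      \<comment> \<open>Trading the neighbouring turns for the window end points is valid only in
        the sum over all paths; after it, the estimate splits into one inequality per path.\<close>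
      also have "\<dots> = (\<Sum>j<k. (S (L j) + S (U j)) + (X (c j) - 2 * S (c j)) - X (T j (Suc q)))"
        using pair by (simp add: sum.distrib sum_subtractf)
      also have "\<dots> \<ge> 0"
      proof (rule sum_nonneg)
        fix j assume "j \<in> {..<k}"
        then show "0 \<le> (S (L j) + S (U j)) + (X (c j) - 2 * S (c j)) - X (T j (Suc q))" using c(2)[of j] by simp
      qed
      finally show "weight F n p k T \<le> lpp (pitman (Suc q) F) n p k a b"
        using lpp_upper[OF pitman_cont[OF F, of "Suc q"] T'] by linarith
    }
    {
      have "\<exists>t'\<in>{L j..U j}. X (T j (Suc q)) - 2 * S (T j (Suc q)) + S (L j) + S (U j) \<le> X t'" if "j < k" for j
        unfolding S_def using ch(1)[OF that] by (intro runmax_reflect_le[OF X]) auto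
      then obtain c where c: "\<And>j. j < k \<Longrightarrow> c j \<in> {L j..U j}"
         "\<And>j. j < k \<Longrightarrow> X (T j (Suc q)) - 2 * S (T j (Suc q)) + S (L j) + S (U j) \<le> X (c j)"
        by metis
      define T' where "T' = (\<lambda>j l. if l = Suc q then c j else T j l)"
      have T': "T' \<in> arrays n p k a b" unfolding T'_def using c(1) by (intro ch(2)) auto
      have "weight (pitman (Suc q) F) n p k T - weight F n p k T' =
        (\<Sum>j<k. S (T' j q) + S (T' j (Suc (Suc q))) + (X (T j (Suc q)) - 2 * S (T j (Suc q))) - X (T' j (Suc q)))"
        by (subst wp) (auto simp: T'_def)
      also have "\<dots> = (\<Sum>j<k. S (T j q) + S (T j (Suc (Suc q))) + (X (T j (Suc q)) - 2 * S (T j (Suc q))) - X (c j))"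
        by (simp add: T'_def)
      also have "\<dots> = (\<Sum>j<k. (S (L j) + S (U j)) + (X (T j (Suc q)) - 2 * S (T j (Suc q))) - X (c j))"
        using pair by (simp add: sum.distrib sum_subtractf)
      also have "\<dots> \<le> 0"
      proof (rule sum_nonpos)
        fix j assume "j \<in> {..<k}"
        then show "(S (L j) + S (U j)) + (X (T j (Suc q)) - 2 * S (T j (Suc q))) - X (c j) \<le> 0" using c(2)[of j] by simp
      qed
      finally show "weight (pitman (Suc q) F) n p k T \<le> lpp F n p k a b"
        using lpp_upper[OF F T'] by linarith
    }
  qed
qed

subsection \<open>Ordered tuples\<close>

text \<open>Summation by parts: the weight of one path, regrouped by turning times instead of
  lines.\<close>

lemma sum_telescope_level:
  fixes h :: "nat \<Rightarrow> nat \<Rightarrow> real"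
  assumes "p < n"
  shows "(\<Sum>i\<in>{p..<n}. h (Suc i) i - h (Suc i) (Suc i)) =
    h (Suc p) p - h n n + (\<Sum>i\<in>{Suc p..<n}. h (Suc i) i - h i i)"
  using assms
proof (induction n)
  case (Suc n)
  show ?case
  proof (cases "p = n")
    case False
    then have "(\<Sum>i\<in>{p..<n}. h (Suc i) i - h (Suc i) (Suc i)) =
      h (Suc p) p - h n n + (\<Sum>i\<in>{Suc p..<n}. h (Suc i) i - h i i)" using Suc by simp
    then show ?thesis using Suc.prems False by simp
  qed simp
qed simp

text \<open>Grouped by turning times, a move from line \<open>i + 1\<close> to line \<open>i\<close>
  contributes \<open>F (Suc i) - F i\<close>, which is at most 0. For path \<open>j\<close> these
  terms are discarded except at the \<open>j\<close> levels where \<open>arrays_end\<close> puts the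
  turn at time \<open>b\<close>; there they telescope to
  \<open>F (Suc (p + j)) b - F (Suc p) b\<close>.\<close>

lemma lpp_ordered:
  fixes F :: "nat \<Rightarrow> 'a::timeline \<Rightarrow> real"
  assumes F: "cont_tuple F" "\<And>i. F i bot = 0" and k: "p + k \<le> n"
    and ord: "\<And>i z. p < i \<Longrightarrow> i < n \<Longrightarrow> F (Suc i) z \<le> F i z"
  shows "lpp F n p k bot b = (\<Sum>j<k. F (Suc (p + j)) b)"
proof (rule antisym)
  show "(\<Sum>j<k. F (Suc (p + j)) b) \<le> lpp F n p k bot b"
    using lpp_straight[of F bot b p p k n] F k by simp
  show "lpp F n p k bot b \<le> (\<Sum>j<k. F (Suc (p + j)) b)"
  proof (rule lpp_least)
    fix T assume T: "T \<in> arrays n p k bot b"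
    show "weight F n p k T \<le> (\<Sum>j<k. F (Suc (p + j)) b)"
      unfolding weight_def
    proof (rule sum_mono)
      fix j assume "j \<in> {..<k}"
      then have j: "j < k" by simp
      then have "p < n" using k by simp
      have "(\<Sum>i\<in>{p..<n}. F (Suc i) (T j i) - F (Suc i) (T j (Suc i))) =
         F (Suc p) (T j p) - F n (T j n) + (\<Sum>i\<in>{Suc p..<n}. F (Suc i) (T j i) - F i (T j i))"
        using sum_telescope_level[OF \<open>p < n\<close>, of "\<lambda>i l. F i (T j l)"] .
      also have "\<dots> = F (Suc p) b + (\<Sum>i\<in>{Suc p..<n}. F (Suc i) (T j i) - F i (T j i))"
        using arraysD(1,2)[OF T j] F(2) by simp
      also have "(\<Sum>i\<in>{Suc p..<n}. F (Suc i) (T j i) - F i (T j i)) \<le>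
         (\<Sum>i\<in>{Suc p..<Suc (p + j)}. F (Suc i) (T j i) - F i (T j i))"
      proof -
        have "(\<Sum>i\<in>{Suc (p + j)..<n}. F (Suc i) (T j i) - F i (T j i)) \<le> 0"
          using ord by (intro sum_nonpos) auto
        moreover have "(\<Sum>i\<in>{Suc p..<Suc (p + j)}. F (Suc i) (T j i) - F i (T j i)) +
           (\<Sum>i\<in>{Suc (p + j)..<n}. F (Suc i) (T j i) - F i (T j i)) =
           (\<Sum>i\<in>{Suc p..<n}. F (Suc i) (T j i) - F i (T j i))"
          using j k by (intro sum.atLeastLessThan_concat) auto
        ultimately show ?thesis by simp
      qed
      also have "\<dots> = (\<Sum>i\<in>{Suc p..<Suc (p + j)}. F (Suc i) b - F i b)"
        using j k by (intro sum.cong arg_cong2[where f="(-)"] arg_cong[where f="F _"] arrays_end[OF T]) auto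
      also have "\<dots> = F (Suc (p + j)) b - F (Suc p) b"
        by (subst sum_Suc_diff') auto
      finally show "(\<Sum>i\<in>{p..<n}. F (Suc i) (T j i) - F (Suc i) (T j (Suc i))) \<le> F (Suc (p + j)) b"
        by simp
    qed
  qed (use k in auto)
qed

subsection \<open>Extending and restricting path families\<close>

text \<open>By \<open>arrays_end\<close>, path \<open>j\<close> has not entered a line below index
  \<open>p + j + 1\<close> before time \<open>b\<close>. It is continued in line
  \<open>p + j + 1\<close> up to \<open>c\<close> and passes all smaller lines at time
  \<open>c\<close>.\<close>

lemma lpp_extend_end:
  fixes F :: "nat \<Rightarrow> 'a::linear_continuum_topology \<Rightarrow> real"
  assumes F: "cont_tuple F" and "a \<le> b" "b \<le> c" "p + k \<le> n" "p' \<le> p"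
  shows "lpp F n p k a b + (\<Sum>j<k. F (Suc (p + j)) c - F (Suc (p + j)) b) \<le> lpp F n p' k a c"
proof -
  have "lpp F n p k a b \<le> lpp F n p' k a c - (\<Sum>j<k. F (Suc (p + j)) c - F (Suc (p + j)) b)"
  proof (rule lpp_least)
    fix T assume T: "T \<in> arrays n p k a b"
    define T' where "T' = (\<lambda>j i. if i \<le> p + j then c else T j i)"
    have T': "T' \<in> arrays n p' k a c"
      unfolding arrays_def
    proof (intro CollectI conjI allI impI ballI)
      fix j assume j: "j < k"
      show "T' j n = a" "T' j p' = c"
        using arraysD(1)[OF T j] assms j by (auto simp: T'_def)
      fix i assume i: "i \<in> {p'..<n}"
      show "T' j (Suc i) \<le> T' j i"
        using arraysD(3)[OF T j, of i] arrays_range(2)[OF T j, of "Suc i"] i assms by (auto simp: T'_def)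
    next
      fix j i assume j: "Suc j < k" and i: "i \<in> {p'..<n}"
      then show "T' j i \<le> T' (Suc j) (Suc i)"
        using arraysD(4)[OF T _ _ _ j, of i] by (auto simp: T'_def)
    qed
    have "weight F n p' k T' = weight F n p k T + (\<Sum>j<k. F (Suc (p + j)) c - F (Suc (p + j)) b)"
      unfolding weight_def sum.distrib[symmetric]
    proof (rule sum.cong)
      fix j assume "j \<in> {..<k}"
      then have j: "j < k" by simp
      define h where "h i = F (Suc i) (T' j i) - F (Suc i) (T' j (Suc i)) - (F (Suc i) (T j i) - F (Suc i) (T j (Suc i)))" for i
      have "sum h {p..<n} = sum h {p + j}"
        using j assms arrays_end[OF T j] by (intro sum.mono_neutral_right) (auto simp: h_def T'_def)
      also have "\<dots> = F (Suc (p + j)) c - F (Suc (p + j)) b"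
        using j assms arrays_end[OF T j] by (simp add: h_def T'_def)
      finally have "(\<Sum>i\<in>{p..<n}. F (Suc i) (T' j i) - F (Suc i) (T' j (Suc i))) =
         (\<Sum>i\<in>{p..<n}. F (Suc i) (T j i) - F (Suc i) (T j (Suc i))) + (F (Suc (p + j)) c - F (Suc (p + j)) b)"
        by (simp add: h_def sum_subtractf)
      moreover have "(\<Sum>i\<in>{p'..<n}. F (Suc i) (T' j i) - F (Suc i) (T' j (Suc i))) =
        (\<Sum>i\<in>{p..<n}. F (Suc i) (T' j i) - F (Suc i) (T' j (Suc i)))"
        using assms by (intro sum.mono_neutral_right) (auto simp: T'_def)
      ultimately show "(\<Sum>i\<in>{p'..<n}. F (Suc i) (T' j i) - F (Suc i) (T' j (Suc i))) =
         (\<Sum>i\<in>{p..<n}. F (Suc i) (T j i) - F (Suc i) (T j (Suc i))) + (F (Suc (p + j)) c - F (Suc (p + j)) b)"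
        by simp
    qed simp
    then show "weight F n p k T \<le> lpp F n p' k a c - (\<Sum>j<k. F (Suc (p + j)) c - F (Suc (p + j)) b)"
      using lpp_upper[OF F T'] by simp
  qed (use assms in auto)
  then show ?thesis by simp
qed

text \<open>Mirror image of \<open>lpp_extend_end\<close>: on \<open>[a,b]\<close> path
  \<open>j\<close> is placed in line \<open>n - k + j + 1\<close>, where by
  \<open>arrays_start\<close> it can be taken up at time \<open>b\<close>.\<close>

lemma lpp_extend_start:
  fixes F :: "nat \<Rightarrow> 'a::linear_continuum_topology \<Rightarrow> real"
  assumes F: "cont_tuple F" and "a \<le> b" "b \<le> c" "p + k \<le> n"
  shows "(\<Sum>j<k. F (Suc (n - k + j)) b - F (Suc (n - k + j)) a) + lpp F n p k b c \<le> lpp F n p k a c"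
proof -
  have "lpp F n p k b c \<le> lpp F n p k a c - (\<Sum>j<k. F (Suc (n - k + j)) b - F (Suc (n - k + j)) a)"
  proof (rule lpp_least)
    fix T assume T: "T \<in> arrays n p k b c"
    define T' where "T' = (\<lambda>j i. if j + n < i + k then a else T j i)"
    have T': "T' \<in> arrays n p k a c"
      unfolding arrays_def
    proof (intro CollectI conjI allI impI ballI)
      fix j assume j: "j < k"
      show "T' j n = a" "T' j p = c"
        using arraysD(2)[OF T j] assms j by (auto simp: T'_def)
      fix i assume i: "i \<in> {p..<n}"
      show "T' j (Suc i) \<le> T' j i"
        using arraysD(3)[OF T j, of i] arrays_range(1)[OF T j, of i] i assms by (auto simp: T'_def)
    next
      fix j i assume j: "Suc j < k" and i: "i \<in> {p..<n}"
      then show "T' j i \<le> T' (Suc j) (Suc i)"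
        using arraysD(4)[OF T _ _ _ j, of i] by (auto simp: T'_def)
    qed
    have "weight F n p k T' = weight F n p k T + (\<Sum>j<k. F (Suc (n - k + j)) b - F (Suc (n - k + j)) a)"
      unfolding weight_def sum.distrib[symmetric]
    proof (rule sum.cong)
      fix j assume "j \<in> {..<k}"
      then have j: "j < k" by simp
      define h where "h i = F (Suc i) (T' j i) - F (Suc i) (T' j (Suc i)) - (F (Suc i) (T j i) - F (Suc i) (T j (Suc i)))" for i
      have "sum h {p..<n} = sum h {n - k + j}"
        using j assms arrays_start[OF T _ _ j] by (intro sum.mono_neutral_right) (auto simp: h_def T'_def)
      also have "\<dots> = F (Suc (n - k + j)) b - F (Suc (n - k + j)) a"
        using j assms arrays_start[OF T _ _ j] by (simp add: h_def T'_def)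
      finally show "(\<Sum>i\<in>{p..<n}. F (Suc i) (T' j i) - F (Suc i) (T' j (Suc i))) =
         (\<Sum>i\<in>{p..<n}. F (Suc i) (T j i) - F (Suc i) (T j (Suc i))) + (F (Suc (n - k + j)) b - F (Suc (n - k + j)) a)"
        by (simp add: h_def sum_subtractf)
    qed simp
    then show "weight F n p k T \<le> lpp F n p k a c - (\<Sum>j<k. F (Suc (n - k + j)) b - F (Suc (n - k + j)) a)"
      using lpp_upper[OF F T'] by simp
  qed (use assms in auto)
  then show ?thesis by simp
qed

text \<open>With as many paths as lines, \<open>arrays_end\<close> and \<open>arrays_start\<close>
  together determine every turning time, so only the straight family remains.\<close>

lemma lpp_full:
  fixes F :: "nat \<Rightarrow> 'a::linear_continuum_topology \<Rightarrow> real"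
  assumes F: "cont_tuple F" and "a \<le> b" "p + k = n"
  shows "lpp F n p k a b = (\<Sum>j<k. F (Suc (p + j)) b - F (Suc (p + j)) a)"
proof (rule antisym)
  show "(\<Sum>j<k. F (Suc (p + j)) b - F (Suc (p + j)) a) \<le> lpp F n p k a b"
    using assms by (intro lpp_straight) auto
  show "lpp F n p k a b \<le> (\<Sum>j<k. F (Suc (p + j)) b - F (Suc (p + j)) a)"
  proof (rule lpp_least)
    fix T assume T: "T \<in> arrays n p k a b"
    have eq: "T j i = straight p a b j i" if "j < k" "p \<le> i" "i \<le> n" for j i
      using arrays_end[OF T that] arrays_start[OF T that(3,2,1)] assms(3) by (auto simp: straight_def)
    have "weight F n p k T = weight F n p k (straight p a b)"
      unfolding weight_def using eq by (intro sum.cong) auto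
    then show "weight F n p k T \<le> (\<Sum>j<k. F (Suc (p + j)) b - F (Suc (p + j)) a)"
      using weight_straight[of p p k n F a b] assms by simp
  qed (use assms in auto)
qed

section \<open>The melon of a continuous tuple\<close>

definition null_tuple :: "(nat \<Rightarrow> 'a::timeline \<Rightarrow> real) \<Rightarrow> bool" where
  "null_tuple F \<longleftrightarrow> cont_tuple F \<and> (\<forall>i. F i bot = 0)"

text \<open>Row insertion: the operations run through \<open>p\<close>, \<open>p + 1\<close>, ...,
  \<open>p + d - 1\<close>. Line \<open>p\<close> is inserted into the ordered lines
  \<open>p + 1\<close> to \<open>p + d\<close>, and what each line gives up is passed on to the
  next.\<close>

primrec sweep :: "nat \<Rightarrow> nat \<Rightarrow> (nat \<Rightarrow> 'a::timeline \<Rightarrow> real) \<Rightarrow> nat \<Rightarrow> 'a \<Rightarrow> real" where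
  "sweep p 0 F = F"
| "sweep p (Suc d) F = pitman (p + d) (sweep p d F)"

text \<open>Lines are inserted from \<open>n\<close> downwards. After \<open>d\<close> insertions
  the lines \<open>n - d\<close> to \<open>n\<close> are ordered and the others untouched, so each
  stage is meaningful on its own.\<close>

primrec melon :: "nat \<Rightarrow> nat \<Rightarrow> (nat \<Rightarrow> 'a::timeline \<Rightarrow> real) \<Rightarrow> nat \<Rightarrow> 'a \<Rightarrow> real" where
  "melon n 0 F = F"
| "melon n (Suc d) F = sweep (n - Suc d) (Suc d) (melon n d F)"

lemma pitman_null: "null_tuple F \<Longrightarrow> null_tuple (pitman i F)"
  unfolding null_tuple_def
proof (intro conjI)
  assume F: "cont_tuple F \<and> (\<forall>i. F i bot = 0)"
  then show "cont_tuple (pitman i F)" using pitman_cont by blast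
  have "continuous_on UNIV (\<lambda>z. F (Suc i) z - F i z)" using F by (intro continuous_on_diff) auto
  then have "runmax (\<lambda>z. F (Suc i) z - F i z) bot = 0" using F by (simp add: runmax_bot)
  then show "\<forall>l. pitman i F l bot = 0" using F by (auto simp: pitman_def Let_def)
qed

lemma sweep_null: "null_tuple F \<Longrightarrow> null_tuple (sweep p d F)"
  by (induction d) (auto intro: pitman_null)

lemma melon_null: "null_tuple F \<Longrightarrow> null_tuple (melon n d F)"
  by (induction d) (auto intro: sweep_null pitman_null simp del: sweep.simps)

lemma lpp_sweep:
  assumes "cont_tuple F" "p < q" "q + d \<le> n" "a \<le> b" "p + k \<le> n"
  shows "lpp (sweep q d F) n p k a b = lpp F n p k a b"
proof -
  have "cont_tuple (sweep q d F) \<and> lpp (sweep q d F) n p k a b = lpp F n p k a b"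
    using assms(3)
  proof (induction d)
    case (Suc d)
    then have IH: "cont_tuple (sweep q d F)" "lpp (sweep q d F) n p k a b = lpp F n p k a b" by auto
    show ?case
      using pitman_cont[OF IH(1), of "q + d"] lpp_pitman[OF IH(1), of p "q + d" n a b k] IH(2) assms Suc.prems
      by simp
  qed (use assms in simp)
  then show ?thesis ..
qed

lemma lpp_melon:
  assumes "null_tuple F" "p + d < n" "a \<le> b" "p + k \<le> n"
  shows "lpp (melon n d F) n p k a b = lpp F n p k a b"
  using assms(2)
proof (induction d)
  case (Suc d)
  have "cont_tuple (melon n d F)" using melon_null[OF assms(1)] by (simp add: null_tuple_def)
  then have "lpp (sweep (n - Suc d) (Suc d) (melon n d F)) n p k a b = lpp (melon n d F) n p k a b"
    using Suc.prems assms by (intro lpp_sweep) auto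
  then show ?case using Suc by (simp del: sweep.simps)
qed simp

text \<open>The third conjunct remembers the last operation, which the induction needs: line
  \<open>m\<close> has just lost \<open>S\<close>, and since \<open>G (Suc m) \<le> G m\<close> the
  next difference satisfies \<open>X \<le> S\<close>. Hence the next running maximum
  \<open>S'\<close> is at most \<open>S\<close>, and line \<open>m\<close> regains no more than it
  lost.\<close>

lemma sweep_facts:
  assumes G: "null_tuple G" and ord: "\<And>i z. p < i \<Longrightarrow> i < p + d \<Longrightarrow> G (Suc i) z \<le> G i z"
  shows "(\<forall>i z. p \<le> i \<and> i < p + d \<longrightarrow> sweep p d G (Suc i) z \<le> sweep p d G i z \<and>
           G (Suc i) z \<le> sweep p d G i z \<and> sweep p d G (Suc i) z \<le> G (Suc i) z) \<and>
         (\<forall>i. i < p \<or> p + d < i \<longrightarrow> sweep p d G i = G i) \<and>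
         (d > 0 \<longrightarrow> (\<exists>S r. mono S \<and> (\<forall>z. sweep p d G (p + d) z = G (p + d) z - S z \<and>
            sweep p d G (p + d - 1) z = r z + S z \<and> sweep p d G (p + d) z \<le> r z)))"
  using ord
proof (induction d)
  case (Suc d)
  define m K where "m = p + d" and "K = sweep p d G"
  define X where "X = (\<lambda>z. K (Suc m) z - K m z)"
  define S' where "S' = runmax X"
  have IH1: "K (Suc i) z \<le> K i z" "G (Suc i) z \<le> K i z" "K (Suc i) z \<le> G (Suc i) z" if "p \<le> i" "i < m" for i z
    using Suc that unfolding m_def K_def by auto
  have IH2: "K i = G i" if "i < p \<or> m < i" for i
    using Suc that unfolding m_def K_def by auto
  have IH3: "d > 0 \<Longrightarrow> \<exists>S r. mono S \<and> (\<forall>z. K m z = G m z - S z \<and> K (m - 1) z = r z + S z \<and> K m z \<le> r z)"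
    using Suc unfolding m_def K_def by auto
  have K: "null_tuple K" unfolding K_def using G by (rule sweep_null)
  then have X: "continuous_on UNIV X" unfolding X_def null_tuple_def by (intro continuous_on_diff) auto
  have S': "X z \<le> S' z" "0 \<le> S' z" for z
    using runmax_upper[OF X, of z z] runmax_upper[OF X, of bot z] K unfolding S'_def
    by (auto simp: X_def null_tuple_def)
  define L where "L = sweep p (Suc d) G"
  have L: "L = K(m := \<lambda>z. K m z + S' z, Suc m := \<lambda>z. K (Suc m) z - S' z)"
    by (simp add: L_def pitman_def Let_def S'_def X_def K_def m_def)
  have KG: "K (Suc m) = G (Suc m)" by (rule IH2) simp
  have before: "K m z + S' z \<le> K (m - 1) z \<and> K m z + S' z \<le> G m z" if dp: "d > 0" for z
  proof -
    obtain S r where S: "mono S" "\<And>z. K m z = G m z - S z" "\<And>z. K (m - 1) z = r z + S z" "\<And>z. K m z \<le> r z"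
      using IH3[OF dp] by blast
    have "S' z \<le> S z" unfolding S'_def
    proof (rule runmax_least[OF X])
      fix u assume "u \<le> z"
      have "G (Suc m) u \<le> G m u" using Suc.prems[of m u] dp by (simp add: m_def)
      then have "X u \<le> S u" using S(2)[of u] by (simp add: X_def KG)
      also have "\<dots> \<le> S z" using S(1) \<open>u \<le> z\<close> by (auto simp: mono_def)
      finally show "X u \<le> S z" .
    qed
    then show ?thesis using S(2)[of z] S(3)[of z] S(4)[of z] by simp
  qed
  have top: "K (Suc m) z - S' z \<le> K m z" for z using S'(1)[of z] by (simp add: X_def)
  show ?case unfolding L_def[symmetric]
  proof (intro conjI allI impI)
    fix i z assume i: "p \<le> i \<and> i < p + Suc d"
    consider "i = m" | "Suc i = m" "d > 0" | "Suc i < m" using i unfolding m_def by linarith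
    then have "L (Suc i) z \<le> L i z \<and> G (Suc i) z \<le> L i z \<and> L (Suc i) z \<le> G (Suc i) z"
    proof cases
      case 1
      then show ?thesis unfolding L using top[of z] S'[of z] KG by (auto simp: X_def)
    next
      case 2
      then have "m - 1 = i" by simp
      then show ?thesis unfolding L using before[of z] IH1[of i z] 2 i by auto
    next
      case 3
      then show ?thesis unfolding L using IH1[of i z] i by auto
    qed
    then show "L (Suc i) z \<le> L i z" "G (Suc i) z \<le> L i z" "L (Suc i) z \<le> G (Suc i) z" by auto
  next
    fix i assume "i < p \<or> p + Suc d < i"
    then show "L i = G i" unfolding L using IH2[of i] unfolding m_def by auto
  next
    have mono: "mono S'" unfolding S'_def by (rule runmax_mono[OF X])
    have idx: "p + Suc d = Suc m" "p + Suc d - 1 = m" unfolding m_def by auto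
    show "\<exists>S r. mono S \<and> (\<forall>z. L (p + Suc d) z = G (p + Suc d) z - S z \<and>
      L (p + Suc d - 1) z = r z + S z \<and> L (p + Suc d) z \<le> r z)"
      unfolding idx L using mono top KG by (intro exI[of _ S'] exI[of _ "K m"]) auto
  qed
qed simp

lemma melon_ordered:
  assumes F: "null_tuple F" and "d < n" "n - d \<le> i" "i < n"
  shows "melon n d F (Suc i) z \<le> melon n d F i z"
  using assms(2-)
proof (induction d arbitrary: i z)
  case (Suc d)
  have "melon n d F (Suc i) z \<le> melon n d F i z" if "n - Suc d < i" "i < n - Suc d + Suc d" for i z
    using Suc that by auto
  from sweep_facts[OF melon_null[OF F, of n d] this] Suc.prems
  show ?case by (auto simp del: sweep.simps)
qed simp

text \<open>Consecutive stages of the insertion interlace; at the final time these are the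
  Gelfand-Tsetlin inequalities.\<close>

lemma melon_interlacing:
  assumes F: "null_tuple F" and "Suc d < n" "n - Suc d \<le> i" "i < n"
  shows "melon n d F (Suc i) z \<le> melon n (Suc d) F i z" "melon n (Suc d) F (Suc i) z \<le> melon n d F (Suc i) z"
proof -
  have "melon n d F (Suc i) z \<le> melon n d F i z" if "n - Suc d < i" "i < n - Suc d + Suc d" for i z
    using that assms by (intro melon_ordered[OF F]) auto
  from sweep_facts[OF melon_null[OF F, of n d] this] assms
  show "melon n d F (Suc i) z \<le> melon n (Suc d) F i z" "melon n (Suc d) F (Suc i) z \<le> melon n d F (Suc i) z"
    by (auto simp del: sweep.simps)
qed

text \<open>At stage \<open>n - Suc p\<close> the lines \<open>p + 1\<close> to \<open>n\<close> are
  already ordered, while no operation has involved line \<open>p\<close> yet, so the isometry still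
  applies. Different end lines thus read off different stages: the final one gives \<open>W\<close>,
  all of them together the pattern.\<close>

lemma lpp_eq_melon_sum:
  assumes F: "null_tuple F" and "p < n" "p + k \<le> n"
  shows "lpp F n p k bot b = (\<Sum>j<k. melon n (n - Suc p) F (Suc (p + j)) b)"
proof -
  have "lpp F n p k bot b = lpp (melon n (n - Suc p) F) n p k bot b"
    using assms by (intro lpp_melon[symmetric]) auto
  also have "\<dots> = (\<Sum>j<k. melon n (n - Suc p) F (Suc (p + j)) b)"
    using melon_null[OF F, of n "n - Suc p"] melon_ordered[OF F, of "n - Suc p" n] assms
    by (intro lpp_ordered) (auto simp: null_tuple_def)
  finally show ?thesis .
qed

subsection \<open>Tuples that rise line by line\<close>

text \<open>A jump of a tuple at one time will be stretched to an interval \<open>[l,h]\<close> on which line \<open>n\<close> rises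
  first and line \<open>1\<close> last; \<open>\<theta> i\<close> separates the rise of line \<open>i+1\<close> from that of line \<open>i\<close>.\<close>

definition staged :: "nat \<Rightarrow> (nat \<Rightarrow> 'a::linorder \<Rightarrow> real) \<Rightarrow> 'a \<Rightarrow> 'a \<Rightarrow> bool" where
  "staged n H l h \<longleftrightarrow> (\<exists>\<theta>. (\<forall>i\<le>n. \<theta> i \<in> {l..h}) \<and>
     (\<forall>i<n. \<theta> (Suc i) \<le> \<theta> i \<and> (\<forall>z\<in>{l..\<theta> (Suc i)}. H (Suc i) z = H (Suc i) l) \<and>
        (\<forall>z\<in>{\<theta> i..h}. H (Suc i) z = H (Suc i) h) \<and> mono_on {l..h} (H (Suc i))))"

text \<open>Common bookkeeping for the two-line operation and its inverse: both alter two
  neighbouring lines, and only the threshold that separates the rises of these two has to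
  move.\<close>

lemma staged_change:
  fixes H :: "nat \<Rightarrow> 'a::linorder \<Rightarrow> real"
  assumes \<theta>: "\<forall>i\<le>n. \<theta> i \<in> {l..h}"
    "\<forall>i<n. \<theta> (Suc i) \<le> \<theta> i \<and> (\<forall>z\<in>{l..\<theta> (Suc i)}. H (Suc i) z = H (Suc i) l) \<and>
        (\<forall>z\<in>{\<theta> i..h}. H (Suc i) z = H (Suc i) h) \<and> mono_on {l..h} (H (Suc i))"
    and q: "Suc q < n"
    and \<theta>': "\<theta> (Suc (Suc q)) \<le> \<theta>'" "\<theta>' \<le> \<theta> q"
    and eq: "\<And>i. i \<noteq> Suc q \<Longrightarrow> i \<noteq> Suc (Suc q) \<Longrightarrow> K i = H i"
    and K: "\<And>z. l \<le> z \<Longrightarrow> z \<le> \<theta>' \<Longrightarrow> K (Suc q) z = K (Suc q) l"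
      "\<And>z. \<theta> q \<le> z \<Longrightarrow> z \<le> h \<Longrightarrow> K (Suc q) z = K (Suc q) h"
      "mono_on {\<theta>'..h} (K (Suc q))"
      "\<And>z. l \<le> z \<Longrightarrow> z \<le> \<theta> (Suc (Suc q)) \<Longrightarrow> K (Suc (Suc q)) z = K (Suc (Suc q)) l"
      "\<And>z. \<theta>' \<le> z \<Longrightarrow> z \<le> h \<Longrightarrow> K (Suc (Suc q)) z = K (Suc (Suc q)) h"
      "mono_on {l..\<theta>'} (K (Suc (Suc q)))"
  shows "staged n K l h"
  unfolding staged_def
proof (intro exI[of _ "\<theta>(Suc q := \<theta>')"] conjI allI impI)
  have lh: "l \<le> \<theta> (Suc (Suc q))" "\<theta> q \<le> h" using \<theta>(1) q by auto
  fix i assume "i \<le> n"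
  then show "(\<theta>(Suc q := \<theta>')) i \<in> {l..h}" using \<theta>(1) \<theta>' lh by auto
next
  have "l \<le> \<theta> (Suc (Suc q))" "\<theta> q \<le> h" using \<theta>(1) q by auto
  then have lh: "l \<le> \<theta>'" "\<theta>' \<le> h" using \<theta>' by auto
  have mono1: "mono_on {l..h} (K (Suc q))"
  proof (rule mono_onI)
    fix r s assume rs: "r \<in> {l..h}" "s \<in> {l..h}" "r \<le> s"
    consider "\<theta>' \<le> r" | "s \<le> \<theta>'" | "r \<le> \<theta>'" "\<theta>' \<le> s" by (meson linear)
    then show "K (Suc q) r \<le> K (Suc q) s"
    proof cases
      case 1 then show ?thesis using mono_onD[OF K(3), of r s] rs by auto
    next
      case 2 then show ?thesis using K(1)[of r] K(1)[of s] rs by auto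
    next
      case 3 then show ?thesis using K(1)[of r] K(1)[of \<theta>'] mono_onD[OF K(3), of \<theta>' s] rs lh by auto
    qed
  qed
  have mono2: "mono_on {l..h} (K (Suc (Suc q)))"
  proof (rule mono_onI)
    fix r s assume rs: "r \<in> {l..h}" "s \<in> {l..h}" "r \<le> s"
    consider "\<theta>' \<le> r" | "s \<le> \<theta>'" | "r \<le> \<theta>'" "\<theta>' \<le> s" by (meson linear)
    then show "K (Suc (Suc q)) r \<le> K (Suc (Suc q)) s"
    proof cases
      case 1 then show ?thesis using K(5)[of r] K(5)[of s] rs by auto
    next
      case 2 then show ?thesis using mono_onD[OF K(6), of r s] rs by auto
    next
      case 3 then show ?thesis using K(5)[of s] K(5)[of \<theta>'] mono_onD[OF K(6), of r \<theta>'] rs lh by auto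
    qed
  qed
  fix i assume i: "i < n"
  consider "i = q" | "i = Suc q" | "i \<noteq> q" "i \<noteq> Suc q" by blast
  then have "(\<theta>(Suc q := \<theta>')) (Suc i) \<le> (\<theta>(Suc q := \<theta>')) i \<and>
    (\<forall>z\<in>{l..(\<theta>(Suc q := \<theta>')) (Suc i)}. K (Suc i) z = K (Suc i) l) \<and>
    (\<forall>z\<in>{(\<theta>(Suc q := \<theta>')) i..h}. K (Suc i) z = K (Suc i) h) \<and> mono_on {l..h} (K (Suc i))"
  proof cases
    case 1 then show ?thesis using \<theta>' K mono1 by auto
  next
    case 2 then show ?thesis using \<theta>' K mono2 by auto
  next
    case 3 then show ?thesis using \<theta>(2) i eq by auto
  qed
  then show "(\<theta>(Suc q := \<theta>')) (Suc i) \<le> (\<theta>(Suc q := \<theta>')) i"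
    "\<forall>z\<in>{l..(\<theta>(Suc q := \<theta>')) (Suc i)}. K (Suc i) z = K (Suc i) l"
    "\<forall>z\<in>{(\<theta>(Suc q := \<theta>')) i..h}. K (Suc i) z = K (Suc i) h" "mono_on {l..h} (K (Suc i))"
    by auto
qed

lemma runmax_step:
  assumes X: "continuous_on UNIV X" and "x \<le> y"
  shows "runmax X y = runmax X x \<or> (\<exists>u\<in>{x..y}. runmax X y = X u)"
proof -
  obtain u where u: "u \<le> y" "runmax X y = X u" using runmax_attained[OF X] by blast
  show ?thesis
  proof (cases "u \<le> x")
    case True
    then have "runmax X y \<le> runmax X x" using u runmax_upper[OF X] by metis
    then show ?thesis using runmax_mono[OF X] \<open>x \<le> y\<close> by (simp add: mono_def order_antisym)
  qed (use u in auto)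
qed

lemma staged_two_lines:
  assumes "staged n H l h" and q: "Suc q < n"
  defines "a \<equiv> Suc q" and "b \<equiv> Suc (Suc q)"
  obtains \<theta> where "\<forall>i\<le>n. \<theta> i \<in> {l..h}"
    "\<forall>i<n. \<theta> (Suc i) \<le> \<theta> i \<and> (\<forall>z\<in>{l..\<theta> (Suc i)}. H (Suc i) z = H (Suc i) l) \<and>
        (\<forall>z\<in>{\<theta> i..h}. H (Suc i) z = H (Suc i) h) \<and> mono_on {l..h} (H (Suc i))"
    "l \<le> \<theta> a" "\<theta> a \<le> h" "\<theta> b \<le> \<theta> a" "\<theta> a \<le> \<theta> q" "l \<le> \<theta> b" "\<theta> q \<le> h"
    "\<And>z. l \<le> z \<Longrightarrow> z \<le> \<theta> a \<Longrightarrow> H a z = H a l" "\<And>z. \<theta> q \<le> z \<Longrightarrow> z \<le> h \<Longrightarrow> H a z = H a h"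
    "\<And>z. l \<le> z \<Longrightarrow> z \<le> \<theta> b \<Longrightarrow> H b z = H b l" "\<And>z. \<theta> a \<le> z \<Longrightarrow> z \<le> h \<Longrightarrow> H b z = H b h"
    "\<And>r s. l \<le> r \<Longrightarrow> r \<le> s \<Longrightarrow> s \<le> h \<Longrightarrow> H a r \<le> H a s"
    "\<And>r s. l \<le> r \<Longrightarrow> r \<le> s \<Longrightarrow> s \<le> h \<Longrightarrow> H b r \<le> H b s"
proof -
  obtain \<theta> where \<theta>: "\<forall>i\<le>n. \<theta> i \<in> {l..h}"
    "\<forall>i<n. \<theta> (Suc i) \<le> \<theta> i \<and> (\<forall>z\<in>{l..\<theta> (Suc i)}. H (Suc i) z = H (Suc i) l) \<and>
        (\<forall>z\<in>{\<theta> i..h}. H (Suc i) z = H (Suc i) h) \<and> mono_on {l..h} (H (Suc i))"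
    using assms(1) unfolding staged_def by blast
  let ?t = "\<theta> a"
  have qn: "q < n" "q \<le> n" "a \<le> n" "b \<le> n" using q by (auto simp: a_def b_def)
  have t1: "l \<le> ?t \<and> ?t \<le> h" "l \<le> \<theta> b \<and> \<theta> b \<le> h" "l \<le> \<theta> q \<and> \<theta> q \<le> h"
    using \<theta>(1)[rule_format, OF qn(3)] \<theta>(1)[rule_format, OF qn(4)] \<theta>(1)[rule_format, OF qn(2)] by simp_all
  note ta = \<theta>(2)[rule_format, OF qn(1), folded a_def] and tb = \<theta>(2)[rule_format, OF q, folded b_def a_def]
  have t: "l \<le> ?t" "?t \<le> h" "\<theta> b \<le> ?t" "?t \<le> \<theta> q" "l \<le> \<theta> b" "\<theta> q \<le> h"
    using t1 conjunct1[OF ta] conjunct1[OF tb] by simp_all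
  have a1: "H a z = H a l" if "l \<le> z" "z \<le> ?t" for z
    by (rule bspec[OF ta[THEN conjunct2, THEN conjunct1]]) (simp add: that)
  have a2: "H a z = H a h" if "\<theta> q \<le> z" "z \<le> h" for z
    by (rule bspec[OF ta[THEN conjunct2, THEN conjunct2, THEN conjunct1]]) (simp add: that)
  have b1: "H b z = H b l" if "l \<le> z" "z \<le> \<theta> b" for z
    by (rule bspec[OF tb[THEN conjunct2, THEN conjunct1]]) (simp add: that)
  have b2: "H b z = H b h" if "?t \<le> z" "z \<le> h" for z
    by (rule bspec[OF tb[THEN conjunct2, THEN conjunct2, THEN conjunct1]]) (simp add: that)
  have ma: "H a r \<le> H a s" if "l \<le> r" "r \<le> s" "s \<le> h" for r s
    by (rule mono_onD[OF ta[THEN conjunct2, THEN conjunct2, THEN conjunct2]]) (use that in auto)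
  have mb: "H b r \<le> H b s" if "l \<le> r" "r \<le> s" "s \<le> h" for r s
    by (rule mono_onD[OF tb[THEN conjunct2, THEN conjunct2, THEN conjunct2]]) (use that in auto)
  show thesis by (rule that[OF \<theta> t a1 a2 b1 b2 ma mb])
qed

text \<open>On \<open>[l,h]\<close> the difference \<open>X\<close> increases up to the old
  threshold \<open>?t\<close>, since only the larger line rises there, and decreases afterwards. So
  \<open>S\<close> is constant until \<open>X\<close> overtakes it, equals \<open>X\<close> up to
  \<open>?t\<close>, and is constant again. The overtaking time is the new threshold, or
  \<open>?t\<close> if there is none.\<close>

lemma staged_pitman:
  assumes H: "cont_tuple H" and st: "staged n H l h" and i: "0 < i" "i < n"
  shows "staged n (pitman i H) l h"
proof -
  obtain q where q: "i = Suc q" "Suc q < n" using i by (cases i) auto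
  let ?a = "Suc q" and ?b = "Suc (Suc q)"
  obtain \<theta> where \<theta>: "\<forall>i\<le>n. \<theta> i \<in> {l..h}"
    "\<forall>i<n. \<theta> (Suc i) \<le> \<theta> i \<and> (\<forall>z\<in>{l..\<theta> (Suc i)}. H (Suc i) z = H (Suc i) l) \<and>
        (\<forall>z\<in>{\<theta> i..h}. H (Suc i) z = H (Suc i) h) \<and> mono_on {l..h} (H (Suc i))"
    and t: "l \<le> \<theta> ?a" "\<theta> ?a \<le> h" "\<theta> ?b \<le> \<theta> ?a" "\<theta> ?a \<le> \<theta> q" "l \<le> \<theta> ?b" "\<theta> q \<le> h"
    and a: "\<And>z. l \<le> z \<Longrightarrow> z \<le> \<theta> ?a \<Longrightarrow> H ?a z = H ?a l" "\<And>z. \<theta> q \<le> z \<Longrightarrow> z \<le> h \<Longrightarrow> H ?a z = H ?a h"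
    and b: "\<And>z. l \<le> z \<Longrightarrow> z \<le> \<theta> ?b \<Longrightarrow> H ?b z = H ?b l" "\<And>z. \<theta> ?a \<le> z \<Longrightarrow> z \<le> h \<Longrightarrow> H ?b z = H ?b h"
    and ma: "\<And>r s. l \<le> r \<Longrightarrow> r \<le> s \<Longrightarrow> s \<le> h \<Longrightarrow> H ?a r \<le> H ?a s"
    and mb: "\<And>r s. l \<le> r \<Longrightarrow> r \<le> s \<Longrightarrow> s \<le> h \<Longrightarrow> H ?b r \<le> H ?b s"
    by (fact staged_two_lines[OF st q(2)])
  let ?t = "\<theta> ?a"
  define X where "X = (\<lambda>z. H ?b z - H ?a z)"
  define S where "S = runmax X"
  have X: "continuous_on UNIV X" unfolding X_def using H by (intro continuous_on_diff) auto
  have mS: "S r \<le> S s" if "r \<le> s" for r s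
    unfolding S_def using runmax_mono[OF X] that by (simp add: mono_def)
  have up: "X z \<le> S z" for z unfolding S_def using runmax_upper[OF X] by simp
  have Xup: "X r \<le> X s" if "l \<le> r" "r \<le> s" "s \<le> ?t" for r s
    using mb[of r s] a(1)[of r] a(1)[of s] that t by (simp add: X_def)
  have Xdown: "X s \<le> X r" if "?t \<le> r" "r \<le> s" "s \<le> h" for r s
    using ma[of r s] b(2)[of r] b(2)[of s] that t by (simp add: X_def)
  have S1: "S z = max (S l) (X z)" if "l \<le> z" "z \<le> ?t" for z
  proof -
    have "S z \<le> max (S l) (X z)"
      using runmax_step[OF X that(1)] Xup that unfolding S_def by fastforce
    then show ?thesis using up[of z] mS[OF that(1)] by simp
  qed
  have S2: "S z = S ?t" if "?t \<le> z" "z \<le> h" for z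
  proof -
    have "S z \<le> S ?t"
      using runmax_step[OF X that(1)] Xdown[of ?t] that up[of ?t] unfolding S_def by force
    then show ?thesis using mS[OF that(1)] by simp
  qed
  have "\<exists>\<theta>'. \<theta> ?b \<le> \<theta>' \<and> \<theta>' \<le> ?t \<and> (\<forall>z. l \<le> z \<and> z \<le> \<theta>' \<longrightarrow> S z = S l) \<and>
      (\<forall>z. \<theta>' \<le> z \<and> z \<le> ?t \<longrightarrow> \<theta>' = ?t \<or> S z = X z)"
  proof (cases "X ?t \<le> S l")
    case True
    then have "S z = S l" if "l \<le> z" "z \<le> ?t" for z using S1[OF that] Xup[of z ?t] that by simp
    then show ?thesis using t(3) by (intro exI[of _ ?t]) (blast intro: antisym)
  next
    case False
    have "X (\<theta> ?b) = X l" using a(1)[of "\<theta> ?b"] b(1)[of "\<theta> ?b"] t by (simp add: X_def)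
    then have "X (\<theta> ?b) \<le> S l" using up[of l] by simp
    then obtain u where u: "\<theta> ?b \<le> u" "u \<le> ?t" "X u = S l"
      using IVT'[of X "\<theta> ?b" "S l" ?t] False t X by (auto intro: continuous_on_subset)
    have "S z = S l" if "l \<le> z" "z \<le> u" for z using S1[of z] Xup[of z u] that u by auto
    moreover have "S z = X z" if "u \<le> z" "z \<le> ?t" for z using S1[of z] Xup[of u z] that u t by auto
    ultimately show ?thesis using u(1,2) by (intro exI[of _ u]) blast
  qed
  then obtain \<theta>' where \<theta>': "\<theta> ?b \<le> \<theta>'" "\<theta>' \<le> ?t" "\<And>z. l \<le> z \<Longrightarrow> z \<le> \<theta>' \<Longrightarrow> S z = S l"
      "\<And>z. \<theta>' \<le> z \<Longrightarrow> z \<le> ?t \<Longrightarrow> \<theta>' = ?t \<or> S z = X z" by metis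
  have P: "pitman i H ?a = (\<lambda>z. H ?a z + S z)" "pitman i H ?b = (\<lambda>z. H ?b z - S z)"
    "\<And>j. j \<noteq> ?a \<Longrightarrow> j \<noteq> ?b \<Longrightarrow> pitman i H j = H j"
    by (auto simp: pitman_def Let_def S_def X_def q)
  have bconst: "H ?b z - S z = H ?b ?t - S ?t" if tz: "\<theta>' \<le> z" "z \<le> h" for z
  proof (cases "z \<le> ?t")
    case True
    then consider "z = ?t" | "S z = X z" "S ?t = X ?t" using \<theta>'(4)[of z] \<theta>'(4)[of ?t] \<theta>'(2) tz by (metis antisym order_refl)
    then show ?thesis using a(1)[of z] a(1)[of ?t] tz True t \<theta>'(1,2) by cases (auto simp: X_def)
  next
    case False
    then show ?thesis using S2[of z] b(2)[of z] b(2)[of ?t] tz t by auto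
  qed
  show ?thesis
  proof (rule staged_change[OF \<theta> q(2) \<theta>'(1)])
    show "mono_on {\<theta>'..h} (pitman i H ?a)"
      unfolding P using \<theta>'(1,2) t by (intro mono_onI add_mono ma mS) auto
    show "mono_on {l..\<theta>'} (pitman i H ?b)"
      unfolding P
    proof (rule mono_onI)
      fix r s assume rs: "r \<in> {l..\<theta>'}" "s \<in> {l..\<theta>'}" "r \<le> s"
      then have "H ?b r \<le> H ?b s" using mb[of r s] \<theta>'(2) t by auto
      then show "H ?b r - S r \<le> H ?b s - S s" using \<theta>'(3)[of r] \<theta>'(3)[of s] rs by simp
    qed
    show "pitman i H ?b z = pitman i H ?b h" if "\<theta>' \<le> z" "z \<le> h" for z
      unfolding P using bconst[OF that] bconst[of h] \<theta>'(1,2) t by simp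
    show "pitman i H ?a z = pitman i H ?a h" if "\<theta> q \<le> z" "z \<le> h" for z
      unfolding P using a(2)[OF that] S2[of z] S2[of h] t that by auto
    show "pitman i H ?a z = pitman i H ?a l" if "l \<le> z" "z \<le> \<theta>'" for z
      unfolding P using \<theta>'(1,2) \<theta>'(3)[of z] a(1)[of z] that by auto
    show "pitman i H ?b z = pitman i H ?b l" if "l \<le> z" "z \<le> \<theta> ?b" for z
      unfolding P using \<theta>'(1,2) \<theta>'(3)[of z] b(1)[of z] that by auto
    show "\<theta>' \<le> \<theta> q" using \<theta>'(2) t by simp
  qed (rule P)
qed

lemma staged_melon:
  assumes H: "null_tuple H" and st: "staged n H l h" and "d < n"
  shows "staged n (melon n d H) l h"
  using assms(3)
proof (induction d)
  case (Suc d)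
  have "staged n (sweep p e G) l h" if "null_tuple G" "staged n G l h" "0 < p" "p + e \<le> n" for p e G
    using that(4)
  proof (induction e)
    case (Suc e)
    then show ?case using sweep_null[OF that(1), of p e] that by (auto intro!: staged_pitman simp: null_tuple_def)
  qed (use that in simp)
  then show ?case using Suc melon_null[OF H] by (simp del: sweep.simps)
qed (use st in simp)

subsection \<open>Inverting the melon\<close>

text \<open>If \<open>Y\<close> is the difference of the two lines produced by
  \<open>pitman\<close>, then \<open>Y = 2 * S - X\<close>, and \<open>S\<close> is to be recovered
  as the future infimum of \<open>Y\<close>. The final value of \<open>S\<close> is not determined
  by \<open>Y\<close>; the cap \<open>c\<close> prescribes it.\<close>

definition future_min :: "real \<Rightarrow> ('a::timeline \<Rightarrow> real) \<Rightarrow> 'a \<Rightarrow> real" where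
  "future_min c Y x = min c (Inf (Y ` {x..}))"

context
  fixes Y :: "'a::timeline \<Rightarrow> real" and b :: 'a and c :: real
  assumes Y: "continuous_on UNIV Y" and Yb: "\<And>z. b \<le> z \<Longrightarrow> Y z = Y b"
begin

lemma future_min_attained: "\<exists>u\<ge>x. Inf (Y ` {x..}) = Y u \<and> (\<forall>z\<ge>x. Y u \<le> Y z)"
proof -
  have "{x..max x b} \<noteq> {}" by simp
  then obtain u where u: "u \<in> {x..max x b}" "\<And>z. z \<in> {x..max x b} \<Longrightarrow> Y u \<le> Y z"
    using continuous_attains_inf[of "{x..max x b}" Y] compact_atLeastAtMost[of x "max x b"] Y
    by (metis continuous_on_subset subset_UNIV)
  have "Y u \<le> Y z" if "x \<le> z" for z
  proof (cases "z \<le> max x b")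
    case False
    then have "x < z \<and> b < z" by (simp only: not_le max_less_iff_conj)
    then have "b \<le> z" "b \<le> max x b" by (blast intro: less_imp_le, simp)
    then have "Y z = Y (max x b)" using Yb[of z] Yb[of "max x b"] by simp
    then show ?thesis using u(2)[of "max x b"] by simp
  qed (use that u in simp)
  moreover from this have "Inf (Y ` {x..}) = Y u" using u(1) by (intro cInf_eq_minimum) auto
  ultimately show ?thesis using u(1) by (intro exI[of _ u]) simp
qed

lemma future_min_le: "x \<le> u \<Longrightarrow> future_min c Y x \<le> Y u" "future_min c Y x \<le> c"
  using future_min_attained[of x] by (auto simp: future_min_def min_le_iff_disj)

lemma future_min_greatest: "v \<le> c \<Longrightarrow> (\<And>u. x \<le> u \<Longrightarrow> v \<le> Y u) \<Longrightarrow> v \<le> future_min c Y x"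
  using future_min_attained[of x] by (auto simp: future_min_def)

lemma future_min_mono: "mono (future_min c Y)"
  by (rule monoI, rule future_min_greatest) (auto intro: future_min_le)

lemma future_min_step:
  assumes "x \<le> y"
  shows "future_min c Y x = future_min c Y y \<or> (\<exists>u\<in>{x..y}. future_min c Y x = Y u)"
proof -
  obtain v where v: "x \<le> v" "Inf (Y ` {x..}) = Y v" using future_min_attained by blast
  have mono: "future_min c Y x \<le> future_min c Y y" using future_min_mono assms by (simp add: mono_def)
  have "future_min c Y x = min c (Y v)" using v(2) by (simp add: future_min_def)
  then consider "future_min c Y x = c" | "future_min c Y x = Y v" by (cases "c \<le> Y v") auto
  then show ?thesis
  proof cases
    case 1 then show ?thesis using mono future_min_le(2)[of y] by simp
  next
    case 2
    then show ?thesis using mono future_min_le(1)[of y v] v(1) by (cases "v \<le> y") auto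
  qed
qed

lemma future_min_continuous: "continuous_on UNIV (future_min c Y)"
proof (rule continuous_of_oscillation[OF Y future_min_mono])
  fix x y :: 'a assume "x < y"
  then show "future_min c Y x = future_min c Y y \<or> (\<exists>u\<in>{x..y}. \<exists>v\<in>{x..y}. future_min c Y y - future_min c Y x \<le> Y u - Y v)"
  proof (cases "future_min c Y x = future_min c Y y")
    case False
    then obtain u where u: "u \<in> {x..y}" "future_min c Y x = Y u"
      using future_min_step[OF less_imp_le[OF \<open>x < y\<close>]] by blast
    then have "future_min c Y y - future_min c Y x \<le> Y y - Y u" using future_min_le(1)[of y y] by simp
    then show ?thesis using u \<open>x < y\<close> by (intro disjI2 bexI[of _ y] bexI[of _ u]) auto
  qed simp
qed

lemma future_min_end:
  assumes "c \<le> Y b" "b \<le> x"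
  shows "future_min c Y x = c"
proof (rule antisym)
  show "future_min c Y x \<le> c" by (rule future_min_le)
  have "Y u = Y b" if "x \<le> u" for u using Yb[of u] assms that by simp
  then show "c \<le> future_min c Y x" using assms by (intro future_min_greatest) auto
qed

text \<open>The key point of the inversion: \<open>S\<close> is the running maximum of \<open>2S - Y\<close>, because \<open>Y = S\<close> at
  every point of left increase of \<open>S\<close>.\<close>

lemma runmax_future_min:
  assumes "Y bot = 0" "0 \<le> c" "\<And>z. 0 \<le> Y z"
  shows "runmax (\<lambda>z. 2 * future_min c Y z - Y z) = future_min c Y"
proof
  fix x
  let ?S = "future_min c Y"
  have X: "continuous_on UNIV (\<lambda>z. 2 * ?S z - Y z)"
    using Y future_min_continuous by (intro continuous_intros)
  show "runmax (\<lambda>z. 2 * ?S z - Y z) x = ?S x"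
  proof (rule antisym)
    show "runmax (\<lambda>z. 2 * ?S z - Y z) x \<le> ?S x"
    proof (rule runmax_least[OF X])
      fix u assume "u \<le> x"
      then show "2 * ?S u - Y u \<le> ?S x" using future_min_le(1)[of u u] future_min_mono by (fastforce simp: mono_def)
    qed
    have S0: "0 \<le> ?S z" for z by (rule future_min_greatest) (use assms in auto)
    have "?S bot = 0" using S0[of bot] future_min_le(1)[of bot bot] assms by simp
    \<comment> \<open>The first time at which \<open>?S\<close> takes the value \<open>?S x\<close>.
      If \<open>Y u > ?S u\<close>, then \<open>Y\<close> would stay above \<open>?S u\<close> on an
      interval to the left of \<open>u\<close>, which makes \<open>?S\<close> constant there and
      contradicts the choice of \<open>u\<close>.\<close>
    then obtain u where u: "u \<le> x" "?S u = ?S x" "\<And>z. z < u \<Longrightarrow> ?S z < ?S x"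
      using first_passage[OF future_min_continuous, of bot x "?S x"] S0[of x] by auto
    have "Y u = ?S u"
    proof (cases "u = bot")
      case True then show ?thesis using \<open>?S bot = 0\<close> assms(1) by simp
    next
      case False
      then have "bot < u" by (simp add: bot.not_eq_extremum)
      show ?thesis
      proof (rule ccontr)
        assume "Y u \<noteq> ?S u"
        then have "?S u < Y u" using future_min_le(1)[of u u] by simp
        moreover have "open (Y -` {?S u<..})" using Y by (intro open_vimage) auto
        ultimately obtain l where l: "l < u" "{l<..u} \<subseteq> Y -` {?S u<..}"
          using open_left[of "Y -` {?S u<..}" u bot] \<open>bot < u\<close> by auto
        obtain z where z: "l < z" "z < u" using dense l by blast
        consider "?S z = ?S u" | v where "v \<in> {z..u}" "?S z = Y v"
          using future_min_step[OF less_imp_le, of z u] z by blast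
        then show False
        proof cases
          case 1 then show ?thesis using u(3)[of z] z u by simp
        next
          case 2
          then have "v \<in> Y -` {?S u<..}" using l z by (intro subsetD[OF l(2)]) auto
          then show ?thesis using 2 u(3)[of z] z u by simp
        qed
      qed
    qed
    then show "?S x \<le> runmax (\<lambda>z. 2 * ?S z - Y z) x"
      using runmax_upper[OF X u(1)] u(2) by simp
  qed
qed

end

definition unpitman :: "nat \<Rightarrow> real \<Rightarrow> (nat \<Rightarrow> 'a::timeline \<Rightarrow> real) \<Rightarrow> nat \<Rightarrow> 'a \<Rightarrow> real" where
  "unpitman i c K = (let S = future_min c (\<lambda>z. K i z - K (Suc i) z)
     in K(i := \<lambda>z. K i z - S z, Suc i := \<lambda>z. K (Suc i) z + S z))"

definition const_after :: "'a::linorder \<Rightarrow> (nat \<Rightarrow> 'a \<Rightarrow> real) \<Rightarrow> bool" where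
  "const_after b K \<longleftrightarrow> (\<forall>i. \<forall>z\<ge>b. K i z = K i b)"

lemma const_afterD: "const_after b K \<Longrightarrow> b \<le> z \<Longrightarrow> K i z = K i b"
  unfolding const_after_def by blast

text \<open>The final value of the restored line \<open>i + 1\<close> is
  \<open>K (Suc i) b + c\<close>. The bounds on \<open>c\<close> say that it lies between the final
  values of the two given lines, which is the form in which interlacing enters.\<close>

lemma
  fixes K :: "nat \<Rightarrow> 'a::timeline \<Rightarrow> real"
  assumes K: "null_tuple K" and Kb: "const_after b K" and ord: "\<And>z. K (Suc i) z \<le> K i z"
    and c: "0 \<le> c" "c \<le> K i b - K (Suc i) b"
  shows unpitman_null: "null_tuple (unpitman i c K)"
    and unpitman_const: "const_after b (unpitman i c K)"
    and pitman_unpitman: "pitman i (unpitman i c K) = K"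
proof -
  define Y where "Y = (\<lambda>z. K i z - K (Suc i) z)"
  define S where "S = future_min c Y"
  have Y: "continuous_on UNIV Y" unfolding Y_def using K by (intro continuous_on_diff) (auto simp: null_tuple_def)
  have Yb: "Y z = Y b" if "b \<le> z" for z unfolding Y_def using Kb that by (metis const_after_def)
  have Y0: "Y bot = 0" "\<And>z. 0 \<le> Y z" using K ord by (auto simp: Y_def null_tuple_def)
  have cY: "c \<le> Y b" using c by (simp add: Y_def)
  have U: "unpitman i c K = K(i := \<lambda>z. K i z - S z, Suc i := \<lambda>z. K (Suc i) z + S z)"
    by (simp add: unpitman_def Let_def S_def Y_def)
  have Sc: "continuous_on UNIV S" unfolding S_def by (rule future_min_continuous[OF Y Yb])
  have "0 \<le> S bot" unfolding S_def using c Y0 by (intro future_min_greatest[OF Y Yb]) auto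
  then have S0: "S bot = 0" using future_min_le(1)[OF Y Yb, of bot bot c] Y0 by (simp add: S_def)
  show "null_tuple (unpitman i c K)"
    using K Sc S0 unfolding U null_tuple_def by (auto intro!: continuous_on_add continuous_on_diff)
  have Sb: "S z = S b" if "b \<le> z" for z
    unfolding S_def using future_min_end[OF Y Yb cY that] future_min_end[OF Y Yb cY order_refl] by simp
  have "unpitman i c K j z = unpitman i c K j b" if "b \<le> z" for j z
  proof -
    have "K j z = K j b" for j using Kb that unfolding const_after_def by blast
    from this[of i] this[of "Suc i"] this[of j] Sb[OF that] show ?thesis unfolding U by simp
  qed
  then show "const_after b (unpitman i c K)" unfolding const_after_def by blast
  have "(\<lambda>z. unpitman i c K (Suc i) z - unpitman i c K i z) = (\<lambda>z. 2 * future_min c Y z - Y z)"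
    by (auto simp: U Y_def S_def)
  then have "runmax (\<lambda>z. unpitman i c K (Suc i) z - unpitman i c K i z) = S"
    using runmax_future_min[OF Y Yb Y0(1) c(1) Y0(2)] by (simp add: S_def)
  then show "pitman i (unpitman i c K) = K"
    unfolding pitman_def Let_def by (auto simp: U fun_eq_iff)
qed

text \<open>Dual to \<open>staged_pitman\<close>: \<open>Y\<close> decreases up to \<open>?t\<close>
  and increases after it, so \<open>S\<close> is constant up to \<open>?t\<close>, equals
  \<open>Y\<close> for a while and is constant again. The new threshold lies to the right of the old
  one.\<close>

lemma staged_unpitman:
  assumes K: "cont_tuple K" and Kb: "const_after c0 K" and st: "staged n K l h" and i: "0 < i" "i < n"
  shows "staged n (unpitman i c K) l h"
proof -
  obtain q where q: "i = Suc q" "Suc q < n" using i by (cases i) auto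
  let ?a = "Suc q" and ?b = "Suc (Suc q)"
  obtain \<theta> where \<theta>: "\<forall>i\<le>n. \<theta> i \<in> {l..h}"
    "\<forall>i<n. \<theta> (Suc i) \<le> \<theta> i \<and> (\<forall>z\<in>{l..\<theta> (Suc i)}. K (Suc i) z = K (Suc i) l) \<and>
        (\<forall>z\<in>{\<theta> i..h}. K (Suc i) z = K (Suc i) h) \<and> mono_on {l..h} (K (Suc i))"
    and t: "l \<le> \<theta> ?a" "\<theta> ?a \<le> h" "\<theta> ?b \<le> \<theta> ?a" "\<theta> ?a \<le> \<theta> q" "l \<le> \<theta> ?b" "\<theta> q \<le> h"
    and a: "\<And>z. l \<le> z \<Longrightarrow> z \<le> \<theta> ?a \<Longrightarrow> K ?a z = K ?a l" "\<And>z. \<theta> q \<le> z \<Longrightarrow> z \<le> h \<Longrightarrow> K ?a z = K ?a h"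
    and b: "\<And>z. l \<le> z \<Longrightarrow> z \<le> \<theta> ?b \<Longrightarrow> K ?b z = K ?b l" "\<And>z. \<theta> ?a \<le> z \<Longrightarrow> z \<le> h \<Longrightarrow> K ?b z = K ?b h"
    and ma: "\<And>r s. l \<le> r \<Longrightarrow> r \<le> s \<Longrightarrow> s \<le> h \<Longrightarrow> K ?a r \<le> K ?a s"
    and mb: "\<And>r s. l \<le> r \<Longrightarrow> r \<le> s \<Longrightarrow> s \<le> h \<Longrightarrow> K ?b r \<le> K ?b s"
    by (fact staged_two_lines[OF st q(2)])
  let ?t = "\<theta> ?a"
  define Y where "Y = (\<lambda>z. K ?a z - K ?b z)"
  define S where "S = future_min c Y"
  have Y: "continuous_on UNIV Y" unfolding Y_def using K by (intro continuous_on_diff) auto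
  have Yb: "Y z = Y c0" if "c0 \<le> z" for z unfolding Y_def using Kb that by (metis const_after_def)
  have mS: "S r \<le> S s" if "r \<le> s" for r s
    unfolding S_def using future_min_mono[OF Y Yb] that by (simp add: mono_def)
  have up: "S z \<le> Y z" for z unfolding S_def using future_min_le(1)[OF Y Yb] by blast
  have Ydown: "Y s \<le> Y r" if "l \<le> r" "r \<le> s" "s \<le> ?t" for r s
    using mb[of r s] a(1)[of r] a(1)[of s] that t by (simp add: Y_def)
  have Yup: "Y r \<le> Y s" if "?t \<le> r" "r \<le> s" "s \<le> h" for r s
    using ma[of r s] b(2)[of r] b(2)[of s] that t by (simp add: Y_def)
  have S1: "S z = min (S h) (Y z)" if "?t \<le> z" "z \<le> h" for z
  proof -
    have "S z = S h \<or> (\<exists>u\<in>{z..h}. S z = Y u)"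
      unfolding S_def by (rule future_min_step[OF Y Yb that(2)])
    then have "min (S h) (Y z) \<le> S z" using Yup that by fastforce
    then show ?thesis using up[of z] mS[OF that(2)] by simp
  qed
  have S2: "S z = S ?t" if "l \<le> z" "z \<le> ?t" for z
  proof -
    have "S z = S ?t \<or> (\<exists>u\<in>{z..?t}. S z = Y u)"
      unfolding S_def by (rule future_min_step[OF Y Yb that(2)])
    moreover have "S ?t \<le> Y u" if "u \<in> {z..?t}" for u
      using Ydown[of u ?t] up[of ?t] order_trans[OF \<open>l \<le> z\<close>, of u] that by auto
    ultimately have "S ?t \<le> S z" by auto
    then show ?thesis using mS[OF that(2)] by simp
  qed
  have "\<exists>\<theta>'. ?t \<le> \<theta>' \<and> \<theta>' \<le> \<theta> q \<and> (\<forall>z. \<theta>' \<le> z \<and> z \<le> h \<longrightarrow> S z = S h) \<and>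
      (\<forall>z. ?t \<le> z \<and> z \<le> \<theta>' \<longrightarrow> \<theta>' = ?t \<or> S z = Y z)"
  proof (cases "S h \<le> Y ?t")
    case True
    then have "S z = S h" if "?t \<le> z" "z \<le> h" for z using S1[OF that] Yup[of ?t z] that by simp
    then show ?thesis using t(4) by (intro exI[of _ ?t]) blast
  next
    case False
    have "Y (\<theta> q) = Y h" using a(2)[of "\<theta> q"] b(2)[of "\<theta> q"] t by (simp add: Y_def)
    then have "S h \<le> Y (\<theta> q)" using up[of h] by simp
    then obtain u where u: "?t \<le> u" "u \<le> \<theta> q" "Y u = S h"
      using IVT'[of Y ?t "S h" "\<theta> q"] False t Y by (auto intro: continuous_on_subset)
    have "S z = S h" if "u \<le> z" "z \<le> h" for z using S1[of z] Yup[of u z] that u by auto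
    moreover have "S z = Y z" if "?t \<le> z" "z \<le> u" for z using S1[of z] Yup[of z u] that u t by auto
    ultimately show ?thesis using u(1,2) by (intro exI[of _ u]) blast
  qed
  then obtain \<theta>' where \<theta>': "?t \<le> \<theta>'" "\<theta>' \<le> \<theta> q" "\<And>z. \<theta>' \<le> z \<Longrightarrow> z \<le> h \<Longrightarrow> S z = S h"
      "\<And>z. ?t \<le> z \<Longrightarrow> z \<le> \<theta>' \<Longrightarrow> \<theta>' = ?t \<or> S z = Y z" by metis
  have P: "unpitman i c K ?a = (\<lambda>z. K ?a z - S z)" "unpitman i c K ?b = (\<lambda>z. K ?b z + S z)"
    "\<And>j. j \<noteq> ?a \<Longrightarrow> j \<noteq> ?b \<Longrightarrow> unpitman i c K j = K j"
    by (auto simp: unpitman_def Let_def S_def Y_def q)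
  have aconst: "K ?a z - S z = K ?a ?t - S ?t" if tz: "l \<le> z" "z \<le> \<theta>'" for z
  proof (cases "?t \<le> z")
    case True
    then consider "z = ?t" | "S z = Y z" "S ?t = Y ?t"
      using \<theta>'(4)[of z] \<theta>'(4)[of ?t] \<theta>'(1) tz by (metis antisym order_refl)
    then show ?thesis using b(2)[of z] b(2)[of ?t] tz True t \<theta>'(1,2) by cases (auto simp: Y_def)
  next
    case False
    then show ?thesis using S2[of z] a(1)[of z] a(1)[of ?t] tz t by auto
  qed
  show ?thesis
  proof (rule staged_change[OF \<theta> q(2) _ \<theta>'(2)])
    show "mono_on {\<theta>'..h} (unpitman i c K ?a)"
      unfolding P
    proof (rule mono_onI)
      fix r s assume rs: "r \<in> {\<theta>'..h}" "s \<in> {\<theta>'..h}" "r \<le> s"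
      then have "K ?a r \<le> K ?a s" using ma[of r s] \<theta>'(1) t by auto
      then show "K ?a r - S r \<le> K ?a s - S s" using \<theta>'(3)[of r] \<theta>'(3)[of s] rs by simp
    qed
    show "mono_on {l..\<theta>'} (unpitman i c K ?b)"
      unfolding P using \<theta>'(1,2) t by (intro mono_onI add_mono mb mS) auto
    show "unpitman i c K ?b z = unpitman i c K ?b h" if "\<theta>' \<le> z" "z \<le> h" for z
      unfolding P using \<theta>'(1,2) \<theta>'(3)[of z] b(2)[of z] that by auto
    show "unpitman i c K ?a z = unpitman i c K ?a h" if "\<theta> q \<le> z" "z \<le> h" for z
      unfolding P using \<theta>'(1,2) \<theta>'(3)[of z] a(2)[of z] that by auto
    show "unpitman i c K ?a z = unpitman i c K ?a l" if "l \<le> z" "z \<le> \<theta>'" for z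
      unfolding P using aconst[of z] aconst[of l] \<theta>'(1,2) t that by auto
    show "unpitman i c K ?b z = unpitman i c K ?b l" if "l \<le> z" "z \<le> \<theta> ?b" for z
      unfolding P using S2[of z] S2[of l] b(1)[of z] t that by auto
    show "\<theta> ?b \<le> \<theta>'" using \<theta>'(1) t by simp
  qed (rule P)
qed

text \<open>The value \<open>c i\<close> prescribes where line \<open>i + 1\<close> of the preimage
  ends. The last conjunct records the operation undone last in the chain, so that the next inductive
  step can compare its two lines; it plays the role of the third conjunct of
  \<open>sweep_facts\<close>.\<close>

definition sweep_preimage ::
  "nat \<Rightarrow> 'a::timeline \<Rightarrow> nat \<Rightarrow> nat \<Rightarrow> (nat \<Rightarrow> real) \<Rightarrow> (nat \<Rightarrow> 'a \<Rightarrow> real) \<Rightarrow> (nat \<Rightarrow> 'a \<Rightarrow> real) \<Rightarrow> bool"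
  where "sweep_preimage n b p d c K G \<longleftrightarrow> null_tuple G \<and> const_after b G \<and> sweep p d G = K \<and>
     (\<forall>i. p \<le> i \<and> i < p + d \<longrightarrow> G (Suc i) b = c i) \<and>
     (\<forall>i z. p < i \<and> i < p + d \<longrightarrow> G (Suc i) z \<le> G i z) \<and>
     (\<forall>i. i < p \<or> p + d < i \<longrightarrow> G i = K i) \<and>
     (\<forall>l h. staged n K l h \<longrightarrow> staged n G l h) \<and>
     (d > 0 \<longrightarrow> (\<forall>z. G (p + d) z = K (p + d) z +
        future_min (c (p + d - 1) - K (p + d) b) (\<lambda>z. K (p + d - 1) z - K (p + d) z) z))"

text \<open>The operations are undone from the largest index down. The point is that the restored
  lines \<open>m\<close> and \<open>m + 1\<close> are ordered: by monotonicity of \<open>S\<close>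
  and order of \<open>K\<close>, the amount \<open>S\<close> taken from line \<open>m\<close> is at
  most what the following step gives back to it, so
  \<open>G m \<ge> K m \<ge> K (Suc m) + S\<close>.\<close>

lemma sweep_inverse:
  fixes K :: "nat \<Rightarrow> 'a::timeline \<Rightarrow> real"
  assumes "null_tuple K" "const_after b K" "0 < p" "p + d \<le> n"
    and "\<And>i z. p \<le> i \<Longrightarrow> i < p + d \<Longrightarrow> K (Suc i) z \<le> K i z"
    and "\<And>i. p \<le> i \<Longrightarrow> i < p + d \<Longrightarrow> K (Suc i) b \<le> c i \<and> c i \<le> K i b"
  shows "\<exists>G. sweep_preimage n b p d c K G"
  using assms
proof (induction d arbitrary: K)
  case 0 then show ?case by (intro exI[of _ K]) (auto simp: sweep_preimage_def)
next
  case (Suc d)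
  define m where "m = p + d"
  \<comment> \<open>Final value of the increasing function to be added to line \<open>m + 1\<close>,
    chosen so that this line ends at \<open>c m\<close>.\<close>
  define e where "e = c m - K (Suc m) b"
  define Y where "Y = (\<lambda>z. K m z - K (Suc m) z)"
  define S where "S = future_min e Y"
  define K' where "K' = unpitman m e K"
  note K = Suc.prems(1,2)
  have ordm: "K (Suc m) z \<le> K m z" for z using Suc.prems(5) by (simp add: m_def)
  have e: "0 \<le> e" "e \<le> K m b - K (Suc m) b" using Suc.prems(6)[of m] by (auto simp: e_def m_def)
  have K'f: "K' m = (\<lambda>z. K m z - S z)" "K' (Suc m) = (\<lambda>z. K (Suc m) z + S z)"
    "i \<noteq> m \<Longrightarrow> i \<noteq> Suc m \<Longrightarrow> K' i = K i" for i
    by (auto simp: K'_def unpitman_def Let_def S_def Y_def)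
  have Y: "continuous_on UNIV Y" unfolding Y_def using K by (intro continuous_on_diff) (auto simp: null_tuple_def)
  have Yb: "Y z = Y b" if "b \<le> z" for z unfolding Y_def using K(2) that by (metis const_after_def)
  have S0: "0 \<le> S z" for z unfolding S_def using e ordm by (intro future_min_greatest[OF Y Yb]) (auto simp: Y_def)
  have Se: "S z \<le> e" for z unfolding S_def by (rule future_min_le[OF Y Yb])
  have Sb: "S b = e" unfolding S_def using e by (intro future_min_end[OF Y Yb]) (auto simp: Y_def)
  have SY: "S z \<le> Y z" for z unfolding S_def by (rule future_min_le[OF Y Yb]) auto
  have mS: "S r \<le> S s" if "r \<le> s" for r s
    unfolding S_def using future_min_mono[OF Y Yb] that by (simp add: mono_def)
  have K': "null_tuple K'" "const_after b K'" "pitman m K' = K"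
    unfolding K'_def using unpitman_null[OF K ordm e] unpitman_const[OF K ordm e] pitman_unpitman[OF K ordm e] by auto
  have ord': "K' (Suc i) z \<le> K' i z" if "p \<le> i" "i < p + d" for i z
    using Suc.prems(5)[of i z] that K'f(3)[of i] K'f(3)[of "Suc i"] K'f(1) S0[of z]
    by (cases "Suc i = m") (auto simp: m_def)
  have c': "K' (Suc i) b \<le> c i \<and> c i \<le> K' i b" if "p \<le> i" "i < p + d" for i
    using Suc.prems(6)[of i] that K'f(3)[of i] K'f(3)[of "Suc i"] K'f(1) S0[of b]
    by (cases "Suc i = m") (auto simp: m_def)
  have pd: "p + d \<le> n" using Suc.prems(4) by simp
  obtain G where pre: "sweep_preimage n b p d c K' G"
    using Suc.IH[OF K'(1,2) Suc.prems(3) pd ord' c'] by blast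
  have G: "null_tuple G" "const_after b G" "sweep p d G = K'"
    using pre unfolding sweep_preimage_def by blast+
  have G4: "G (Suc i) b = c i" if "p \<le> i" "i < p + d" for i
    using pre that unfolding sweep_preimage_def by blast
  have G5: "G (Suc i) z \<le> G i z" if "p < i" "i < p + d" for i z
    using pre that unfolding sweep_preimage_def by blast
  have G6: "G i = K' i" if "i < p \<or> p + d < i" for i
    using pre that unfolding sweep_preimage_def by blast
  have G7: "staged n G l h" if "staged n K' l h" for l h
    using pre that unfolding sweep_preimage_def by blast
  have G8: "G m z = K' m z + future_min (c (m - 1) - K' m b) (\<lambda>z. K' (m - 1) z - K' m z) z" if "d > 0" for z
    using pre that unfolding sweep_preimage_def m_def by blast
  have Gm: "G (Suc m) = (\<lambda>z. K (Suc m) z + S z)" using G6[of "Suc m"] K'f(2) by (simp add: m_def)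
  have ordG: "G (Suc m) z \<le> G m z" if "d > 0" for z
  proof -
    define Y' where "Y' = (\<lambda>z. K' (m - 1) z - K' m z)"
    have Y': "continuous_on UNIV Y'" unfolding Y'_def using K'(1) by (intro continuous_on_diff) (auto simp: null_tuple_def)
    have Y'b: "Y' z = Y' b" if "b \<le> z" for z unfolding Y'_def using K'(2) that by (metis const_after_def)
    have m1: "K' (m - 1) = K (m - 1)" using that by (intro K'f(3)) (auto simp: m_def)
    have "S z \<le> future_min (c (m - 1) - K' m b) Y' z"
    proof (rule future_min_greatest[OF Y' Y'b])
      show "S z \<le> c (m - 1) - K' m b"
      proof -
        have "p \<le> m - 1" "m - 1 < p + Suc d" "Suc (m - 1) = m" using that by (auto simp: m_def)
        then have "K m b \<le> c (m - 1)" using Suc.prems(6)[of "m - 1"] by simp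
        then show ?thesis using K'f(1) Sb Se[of z] by simp
      qed
      fix u assume "z \<le> u"
      have "K m u \<le> K (m - 1) u" using Suc.prems(5)[of "m - 1" u] that by (simp add: m_def)
      then show "S z \<le> Y' u" using mS[OF \<open>z \<le> u\<close>] unfolding Y'_def m1 K'f(1) by simp
    qed
    moreover have "G m z = K m z - S z + future_min (c (m - 1) - K' m b) Y' z"
      using G8[OF that, of z] unfolding Y'_def by (simp only: K'f(1))
    moreover have "K (Suc m) z + S z \<le> K m z" using SY[of z] by (simp add: Y_def)
    ultimately show ?thesis unfolding Gm by linarith
  qed
  have "sweep p (Suc d) G = K" using G(3) K'(3) by (simp add: m_def)
  moreover have "G (Suc i) b = c i" if "p \<le> i" "i < p + Suc d" for i
    using G4[of i] that Gm Sb by (cases "i = m") (auto simp: m_def e_def)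
  moreover have "G (Suc i) z \<le> G i z" if "p < i" "i < p + Suc d" for i z
    using G5[of i z] that ordG by (cases "i = m") (auto simp: m_def)
  moreover have "G i = K i" if "i < p \<or> p + Suc d < i" for i
    using G6[of i] K'f(3)[of i] that by (auto simp: m_def)
  moreover have "staged n G l h" if "staged n K l h" for l h
    using G7 staged_unpitman[of K b n l h m e] K that Suc.prems(3,4) unfolding K'_def null_tuple_def
    by (auto simp: m_def)
  moreover have "G (p + Suc d) z = K (p + Suc d) z +
        future_min (c (p + Suc d - 1) - K (p + Suc d) b) (\<lambda>z. K (p + Suc d - 1) z - K (p + Suc d) z) z" for z
    using Gm by (simp add: m_def S_def e_def Y_def)
  ultimately have "sweep_preimage n b p (Suc d) c K G"
    using G(1,2) unfolding sweep_preimage_def by blast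
  then show ?case by blast
qed

text \<open>\<open>\<gamma> e i\<close> is the intended final value of line \<open>i\<close> after
  \<open>e\<close> insertions. Each undone insertion uses one row of \<open>\<gamma>\<close>, and
  the interlacing of consecutive rows is exactly what \<open>sweep_inverse\<close> demands.\<close>

lemma melon_inverse:
  fixes K :: "nat \<Rightarrow> 'a::timeline \<Rightarrow> real"
  assumes "null_tuple K" "const_after b K" "d < n"
    and "\<And>i z. n - d \<le> i \<Longrightarrow> i < n \<Longrightarrow> K (Suc i) z \<le> K i z"
    and "\<And>i. n - d \<le> i \<Longrightarrow> i \<le> n \<Longrightarrow> K i b = \<gamma> d i"
    and "\<And>e i. e < d \<Longrightarrow> n - Suc e \<le> i \<Longrightarrow> i < n \<Longrightarrow> \<gamma> (Suc e) (Suc i) \<le> \<gamma> e (Suc i) \<and> \<gamma> e (Suc i) \<le> \<gamma> (Suc e) i"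
  shows "\<exists>F. null_tuple F \<and> const_after b F \<and> melon n d F = K \<and>
     (\<forall>e i. e \<le> d \<and> n - e \<le> i \<and> i \<le> n \<longrightarrow> melon n e F i b = \<gamma> e i) \<and>
     (\<forall>l h. staged n K l h \<longrightarrow> staged n F l h)"
  using assms
proof (induction d arbitrary: K)
  case 0
  then show ?case by (intro exI[of _ K]) auto
next
  case (Suc d)
  define p where "p = n - Suc d"
  have p: "0 < p" "p + Suc d = n" "n - d = Suc p" using Suc.prems(3) by (auto simp: p_def)
  have 1: "K (Suc i) z \<le> K i z" if "p \<le> i" "i < p + Suc d" for i z
    using Suc.prems(4)[of i z] that p by (simp add: p_def)
  have 2: "K (Suc i) b \<le> \<gamma> d (Suc i) \<and> \<gamma> d (Suc i) \<le> K i b" if "p \<le> i" "i < p + Suc d" for i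
    using Suc.prems(5)[of i] Suc.prems(5)[of "Suc i"] Suc.prems(6)[of d i] that p by (auto simp: p_def)
  obtain G where pre: "sweep_preimage n b p (Suc d) (\<lambda>i. \<gamma> d (Suc i)) K G"
    using sweep_inverse[OF Suc.prems(1,2) p(1) eq_refl[OF p(2)] 1 2] by blast
  have G: "null_tuple G" "const_after b G" "sweep p (Suc d) G = K"
    using pre unfolding sweep_preimage_def by blast+
  have G4: "G (Suc i) b = \<gamma> d (Suc i)" if "p \<le> i" "i < n" for i
    using pre that unfolding sweep_preimage_def p(2) by blast
  have G5: "G (Suc i) z \<le> G i z" if "p < i" "i < n" for i z
    using pre that unfolding sweep_preimage_def p(2) by blast
  have G6: "staged n G l h" if "staged n K l h" for l h
    using pre that unfolding sweep_preimage_def by blast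
  have 3: "G (Suc i) z \<le> G i z" if "n - d \<le> i" "i < n" for i z using G5 that p by simp
  have 4: "G i b = \<gamma> d i" if "n - d \<le> i" "i \<le> n" for i using G4[of "i - 1"] that p by simp
  have dn: "d < n" using Suc.prems(3) by simp
  have 5: "\<gamma> (Suc e) (Suc i) \<le> \<gamma> e (Suc i) \<and> \<gamma> e (Suc i) \<le> \<gamma> (Suc e) i" if "e < d" "n - Suc e \<le> i" "i < n" for e i
    using Suc.prems(6)[of e i] that by simp
  obtain F where F: "null_tuple F" "const_after b F" "melon n d F = G"
    and F45: "(\<forall>e i. e \<le> d \<and> n - e \<le> i \<and> i \<le> n \<longrightarrow> melon n e F i b = \<gamma> e i) \<and>
      (\<forall>l h. staged n G l h \<longrightarrow> staged n F l h)"
    using Suc.IH[OF G(1,2) dn 3 4 5] by blast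
  have mK: "melon n (Suc d) F = K" using F(3) G(3) by (simp add: p_def del: sweep.simps)
  have "melon n e F i b = \<gamma> e i" if "e \<le> Suc d" "n - e \<le> i" "i \<le> n" for e i
    using F45 Suc.prems(5)[of i] mK that by (cases "e = Suc d") auto
  then show ?case using F(1,2) F45 G6 mK by (intro exI[of _ F]) blast
qed

section \<open>The line with every time stretched to an interval\<close>

text \<open>Time \<open>x\<close> becomes the block of all points with first coordinate
  \<open>x\<close>. A cadlag function has its left limit at \<open>lo x\<close> and its value at
  \<open>hi x\<close>.\<close>

typedef lexline = "{p :: real \<times> real. 0 \<le> fst p \<and> 0 \<le> snd p \<and> snd p \<le> 1}"
  by (rule exI[of _ "(0, 0)"]) simp

definition re :: "lexline \<Rightarrow> real" where "re z = fst (Rep_lexline z)"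
definition sub :: "lexline \<Rightarrow> real" where "sub z = snd (Rep_lexline z)"
definition pt :: "real \<Rightarrow> real \<Rightarrow> lexline" where "pt x c = Abs_lexline (x, c)"
abbreviation lo :: "real \<Rightarrow> lexline" where "lo x \<equiv> pt x 0"
abbreviation hi :: "real \<Rightarrow> lexline" where "hi x \<equiv> pt x 1"

lemma re_sub_bounds [simp]: "0 \<le> re z" "0 \<le> sub z" "sub z \<le> 1"
  using Rep_lexline[of z] by (auto simp: re_def sub_def)

lemma re_sub_bounds' [simp]: "\<not> re z < 0" "\<not> sub z < 0" "\<not> 1 < sub z"
  by (simp_all add: not_less)

lemma re_pt [simp]: "0 \<le> x \<Longrightarrow> 0 \<le> c \<Longrightarrow> c \<le> 1 \<Longrightarrow> re (pt x c) = x"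
  and sub_pt [simp]: "0 \<le> x \<Longrightarrow> 0 \<le> c \<Longrightarrow> c \<le> 1 \<Longrightarrow> sub (pt x c) = c"
  by (simp_all add: re_def sub_def pt_def Abs_lexline_inverse)

lemma pt_re_sub [simp]: "pt (re z) (sub z) = z"
  by (simp add: re_def sub_def pt_def Rep_lexline_inverse)

lemma lexline_eqI: "re z = re w \<Longrightarrow> sub z = sub w \<Longrightarrow> z = w"
  by (metis pt_re_sub)

instantiation lexline :: linorder
begin
definition less_eq_lexline :: "lexline \<Rightarrow> lexline \<Rightarrow> bool" where
  "z \<le> w \<longleftrightarrow> re z < re w \<or> re z = re w \<and> sub z \<le> sub w"
definition less_lexline :: "lexline \<Rightarrow> lexline \<Rightarrow> bool" where
  "z < w \<longleftrightarrow> re z < re w \<or> re z = re w \<and> sub z < sub w"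
instance
  by standard (auto simp: less_eq_lexline_def less_lexline_def intro: lexline_eqI)
end

instantiation lexline :: order_bot
begin
definition bot_lexline :: lexline where "bot_lexline = lo 0"
instance
  by standard (auto simp: bot_lexline_def less_eq_lexline_def less_le)
end

instance lexline :: no_top
proof
  fix z :: lexline
  have "z < pt (re z + 1) 0" using re_sub_bounds(1)[of z] by (auto simp: less_lexline_def)
  then show "\<exists>w. z < w" ..
qed

instance lexline :: dense_linorder
proof
  fix z w :: lexline assume "z < w"
  then consider "re z < re w" | "re z = re w" "sub z < sub w" by (auto simp: less_lexline_def)
  then show "\<exists>v. z < v \<and> v < w"
  proof cases
    case 1
    have "re z < (re z + re w) / 2" "(re z + re w) / 2 < re w" using 1 by (simp_all add: field_simps)
    then show ?thesis using re_sub_bounds(1)[of z] re_sub_bounds(1)[of w]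
      by (intro exI[of _ "pt ((re z + re w) / 2) 0"]) (auto simp: less_lexline_def)
  next
    case 2
    show ?thesis
    proof -
      have "sub z + sub w \<le> 2" using re_sub_bounds(3)[of z] re_sub_bounds(3)[of w] by linarith
      then have "0 \<le> (sub z + sub w) / 2" "(sub z + sub w) / 2 \<le> 1" by simp_all
      then show ?thesis using 2 by (intro exI[of _ "pt (re z) ((sub z + sub w) / 2)"]) (simp add: less_lexline_def)
    qed
  qed
qed

text \<open>Let \<open>r\<close> be the supremum of the times. If it is attained, the second
  coordinates at time \<open>r\<close> decide; if not, the supremum is the lower end of block
  \<open>r\<close>.\<close>

lemma lexline_lub:
  fixes X :: "lexline set"
  assumes "X \<noteq> {}" "\<And>x. x \<in> X \<Longrightarrow> x \<le> b"
  shows "\<exists>s. (\<forall>x\<in>X. x \<le> s) \<and> (\<forall>y. (\<forall>x\<in>X. x \<le> y) \<longrightarrow> s \<le> y)"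
proof -
  define r where "r = Sup (re ` X)"
  have bdd: "bdd_above (re ` X)"
    using assms(2) by (intro bdd_aboveI2[of _ _ "re b"]) (fastforce simp: less_eq_lexline_def)
  have up: "re x \<le> r" if "x \<in> X" for x unfolding r_def using that bdd by (intro cSup_upper) auto
  have least: "r \<le> re y" if "\<forall>x\<in>X. x \<le> y" for y
    unfolding r_def using that assms(1) by (intro cSup_least) (fastforce simp: less_eq_lexline_def)+
  obtain x0 where "x0 \<in> X" using assms(1) by blast
  then have r0: "0 \<le> r" using up re_sub_bounds(1) order_trans by blast
  show ?thesis
  proof (cases "\<exists>x\<in>X. re x = r")
    case True
    define Z where "Z = sub ` {x \<in> X. re x = r}"
    have Z: "Z \<noteq> {}" "bdd_above Z" "\<And>c. c \<in> Z \<Longrightarrow> 0 \<le> c \<and> c \<le> 1"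
      using True by (auto simp: Z_def intro!: bdd_aboveI2[of _ _ 1])
    then have sZ: "0 \<le> Sup Z" "Sup Z \<le> 1"
      using cSup_upper2[of _ Z 0] cSup_least[of Z 1] by auto
    show ?thesis
    proof (intro exI[of _ "pt r (Sup Z)"] conjI ballI allI impI)
      fix x assume x: "x \<in> X"
      have "sub x \<le> Sup Z" if "re x = r" using that x Z(2) by (intro cSup_upper) (auto simp: Z_def)
      then show "x \<le> pt r (Sup Z)" using up[OF x] r0 sZ by (auto simp: less_eq_lexline_def)
    next
      fix y assume y: "\<forall>x\<in>X. x \<le> y"
      have "Sup Z \<le> sub y" if "r = re y"
        using Z(1) y that by (intro cSup_least) (auto simp: Z_def less_eq_lexline_def)
      then show "pt r (Sup Z) \<le> y" using least[OF y] r0 sZ by (auto simp: less_eq_lexline_def)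
    qed
  next
    case False
    show ?thesis
    proof (intro exI[of _ "lo r"] conjI ballI allI impI)
      fix x assume x: "x \<in> X"
      then show "x \<le> lo r" using up[OF x] r0 False by (auto simp: less_eq_lexline_def)
    next
      fix y assume y: "\<forall>x\<in>X. x \<le> y"
      then show "lo r \<le> y" using least[OF y] r0 by (auto simp: less_eq_lexline_def)
    qed
  qed
qed

instantiation lexline :: conditionally_complete_linorder
begin
definition inf_lexline :: "lexline \<Rightarrow> lexline \<Rightarrow> lexline" where "inf_lexline = min"
definition sup_lexline :: "lexline \<Rightarrow> lexline \<Rightarrow> lexline" where "sup_lexline = max"
definition Sup_lexline :: "lexline set \<Rightarrow> lexline" where
  "Sup_lexline X = (SOME s. (\<forall>x\<in>X. x \<le> s) \<and> (\<forall>y. (\<forall>x\<in>X. x \<le> y) \<longrightarrow> s \<le> y))"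
definition Inf_lexline :: "lexline set \<Rightarrow> lexline" where
  "Inf_lexline X = Sup {y. \<forall>x\<in>X. y \<le> x}"
instance
proof
  fix x y z :: lexline and X :: "lexline set"
  have lub: "(\<forall>x\<in>A. x \<le> Sup A) \<and> (\<forall>y. (\<forall>x\<in>A. x \<le> y) \<longrightarrow> Sup A \<le> y)"
    if "A \<noteq> {}" "\<And>x. x \<in> A \<Longrightarrow> x \<le> b" for A :: "lexline set" and b
    unfolding Sup_lexline_def using lexline_lub[OF that] by (rule someI_ex)
  show "inf x y \<le> x" "inf x y \<le> y" "x \<le> sup x y" "y \<le> sup x y"
    by (simp_all add: inf_lexline_def sup_lexline_def)
  show "z \<le> x \<Longrightarrow> z \<le> y \<Longrightarrow> z \<le> inf x y" by (simp add: inf_lexline_def)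
  show "y \<le> x \<Longrightarrow> z \<le> x \<Longrightarrow> sup y z \<le> x" by (simp add: sup_lexline_def)
  show "x \<in> X \<Longrightarrow> bdd_above X \<Longrightarrow> x \<le> Sup X"
    using lub[of X] by (auto simp: bdd_above_def)
  show "X \<noteq> {} \<Longrightarrow> (\<And>x. x \<in> X \<Longrightarrow> x \<le> z) \<Longrightarrow> Sup X \<le> z"
    using lub[of X z] by auto
  have low: "{y. \<forall>x\<in>X. y \<le> x} \<noteq> {}" using bot.extremum by blast
  show "x \<in> X \<Longrightarrow> bdd_below X \<Longrightarrow> Inf X \<le> x"
    unfolding Inf_lexline_def using lub[OF low, of x] by auto
  show "X \<noteq> {} \<Longrightarrow> (\<And>x. x \<in> X \<Longrightarrow> z \<le> x) \<Longrightarrow> z \<le> Inf X"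
    unfolding Inf_lexline_def using lub[OF low] by blast
qed
end

instantiation lexline :: timeline
begin
definition open_lexline :: "lexline set \<Rightarrow> bool" where
  "open_lexline = generate_topology (range (\<lambda>a. {..<a}) \<union> range (\<lambda>a. {a<..}))"
instance
proof
  show "open = generate_topology (range (\<lambda>a::lexline. {..<a}) \<union> range (\<lambda>a. {a<..}))"
    by (rule open_lexline_def)
  have "lo 0 \<noteq> hi 0" using sub_pt[of 0 0] sub_pt[of 0 1] by force
  then show "\<exists>a b::lexline. a \<noteq> b" by blast
qed
end

lemma lexline_less [simp]:
  assumes "0 \<le> x"
  shows "z < lo x \<longleftrightarrow> re z < x" "lo x \<le> z \<longleftrightarrow> x \<le> re z"
    "hi x < z \<longleftrightarrow> x < re z" "z \<le> hi x \<longleftrightarrow> re z \<le> x"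
  using assms re_sub_bounds[of z] by (auto simp: less_eq_lexline_def less_lexline_def)

lemma re_mono: "z \<le> w \<Longrightarrow> re z \<le> re w"
  by (auto simp: less_eq_lexline_def)

lemma re_less: "re z < re w \<Longrightarrow> z < w"
  by (auto simp: less_lexline_def)

lemma lo_0: "lo 0 = bot" by (simp add: bot_lexline_def)

subsection \<open>Boundary values\<close>

text \<open>Every neighbourhood of \<open>hi x\<close> contains whole blocks to the right of
  \<open>x\<close>, so the point \<open>f y\<close> chosen in block \<open>y\<close> is immaterial.
  Upper ends give right continuity; lower ends are used after time reversal.\<close>

lemma tendsto_hi:
  fixes X :: "lexline \<Rightarrow> real"
  assumes X: "continuous_on UNIV X" and "0 \<le> x" and f: "\<And>y. x < y \<Longrightarrow> re (f y) = y"
  shows "((\<lambda>y. X (f y)) \<longlongrightarrow> X (hi x)) (at_right x)"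
proof -
  have "(f \<longlongrightarrow> hi x) (at_right x)"
  proof (rule order_tendstoI)
    fix a assume "a < hi x"
    have "a < f y" if "x < y" for y
    proof -
      have "hi x < f y" using that f \<open>0 \<le> x\<close> by simp
      then show ?thesis using \<open>a < hi x\<close> by (rule less_trans[rotated])
    qed
    then show "eventually (\<lambda>y. a < f y) (at_right x)"
      by (auto simp: eventually_at_filter)
  next
    fix a assume "hi x < a"
    then have "x < re a" using \<open>0 \<le> x\<close> by simp
    moreover have "f y < a" if "x < y" "y < re a" for y using that f by (intro re_less) simp
    ultimately show "eventually (\<lambda>y. f y < a) (at_right x)"
      unfolding eventually_at_right[OF \<open>x < re a\<close>] by blast
  qed
  moreover have "isCont X (hi x)" using X by (simp add: continuous_on_eq_continuous_at)
  ultimately show ?thesis by (simp add: isCont_tendsto_compose)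
qed

lemma tendsto_lo:
  fixes X :: "lexline \<Rightarrow> real"
  assumes X: "continuous_on UNIV X" and "0 < x" and f: "\<And>y. 0 \<le> y \<Longrightarrow> y < x \<Longrightarrow> re (f y) = y"
  shows "((\<lambda>y. X (f y)) \<longlongrightarrow> X (lo x)) (at_left x)"
proof -
  have ev: "eventually (\<lambda>y. 0 \<le> y \<and> y < x) (at_left x)"
    unfolding eventually_at_left[OF \<open>0 < x\<close>] using \<open>0 < x\<close> by (intro exI[of _ 0]) auto
  have "(f \<longlongrightarrow> lo x) (at_left x)"
  proof (rule order_tendstoI)
    fix a assume "lo x < a"
    have "f y < a" if "0 \<le> y \<and> y < x" for y
    proof -
      have "f y < lo x" using that f \<open>0 < x\<close> by simp
      then show ?thesis using \<open>lo x < a\<close> by (rule less_trans)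
    qed
    then show "eventually (\<lambda>y. f y < a) (at_left x)"
      using ev by (auto elim: eventually_mono)
  next
    fix a assume "a < lo x"
    then have "re a < x" using \<open>0 < x\<close> by simp
    moreover have "a < f y" if "re a < y" "y < x" for y
      using that f[of y] re_sub_bounds(1)[of a] by (intro re_less) simp
    ultimately show "eventually (\<lambda>y. a < f y) (at_left x)"
      unfolding eventually_at_left[OF \<open>re a < x\<close>] by blast
  qed
  moreover have "isCont X (lo x)" using X by (simp add: continuous_on_eq_continuous_at)
  ultimately show ?thesis by (simp add: isCont_tendsto_compose)
qed

lemma left_lim_tendsto: "0 < x \<Longrightarrow> (g \<longlongrightarrow> l) (at_left x) \<Longrightarrow> left_lim g x = l"
  by (simp add: left_lim_def tendsto_Lim)

text \<open>At \<open>x = 0\<close> the convention \<open>f(0-) = 0\<close> is matched by the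
  assumption that \<open>X\<close> vanishes at \<open>bot\<close>.\<close>

lemma left_lim_boundary:
  assumes X: "continuous_on UNIV X" "X bot = 0" and "0 \<le> x"
    and g: "\<And>y. 0 \<le> y \<Longrightarrow> y < x \<Longrightarrow> g y = X (hi y)"
  shows "left_lim g x = X (lo x)"
proof (cases "x = 0")
  case True then show ?thesis using X(2) by (simp add: left_lim_def lo_0)
next
  case False
  then have "0 < x" using \<open>0 \<le> x\<close> by simp
  have "((\<lambda>y. X (hi y)) \<longlongrightarrow> X (lo x)) (at_left x)"
    using \<open>0 < x\<close> by (intro tendsto_lo X) auto
  moreover have "eventually (\<lambda>y. X (hi y) = g y) (at_left x)"
    unfolding eventually_at_left[OF \<open>0 < x\<close>] using \<open>0 < x\<close> g by (intro exI[of _ 0]) auto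
  ultimately have "(g \<longlongrightarrow> X (lo x)) (at_left x)" by (rule Lim_transform_eventually)
  then show ?thesis by (rule left_lim_tendsto[OF \<open>0 < x\<close>])
qed

definition staged_tuple :: "nat \<Rightarrow> (nat \<Rightarrow> lexline \<Rightarrow> real) \<Rightarrow> bool" where
  "staged_tuple n H \<longleftrightarrow> null_tuple H \<and> (\<forall>x\<ge>0. staged n H (lo x) (hi x))"

lemma staged_tuple_mono:
  assumes "staged_tuple n H" "i \<in> {1..n}" "z \<le> w" "re z = re w"
  shows "H i z \<le> H i w"
proof -
  obtain i' where i: "i = Suc i'" "i' < n" using assms(2) by (cases i) auto
  have "staged n H (lo (re z)) (hi (re z))" using assms(1) by (simp add: staged_tuple_def)
  then have "mono_on {lo (re z)..hi (re z)} (H i)" unfolding staged_def using i by blast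
  then show ?thesis by (rule mono_onD) (use assms in auto)
qed

definition boundary :: "nat \<Rightarrow> real set \<Rightarrow> (nat \<Rightarrow> lexline \<Rightarrow> real) \<Rightarrow> tuple" where
  "boundary n T H = (\<lambda>i\<in>{1..n}. \<lambda>x\<in>T. H i (hi x))"

lemma boundary_left_lim:
  assumes "null_tuple H" "i \<in> {1..n}" "0 \<le> x" "{0..<x} \<subseteq> T"
  shows "left_lim (boundary n T H i) x = H i (lo x)"
  using assms by (intro left_lim_boundary) (auto simp: null_tuple_def boundary_def)

text \<open>Continuity at the two ends of a block gives right continuity and left limits;
  monotonicity within the block says that jumps are not negative. The set \<open>T\<close> is
  downward closed in order to cover both \<open>{0..t}\<close> and \<open>{0..}\<close>.\<close>

lemma boundary_Dtuples:
  assumes H: "staged_tuple n H" and T: "T \<subseteq> {0..}" "0 \<in> T" "\<And>x. x \<in> T \<Longrightarrow> {0..x} \<subseteq> T"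
  shows "boundary n T H \<in> Dtuples n T"
proof -
  have nt: "null_tuple H" using H by (simp add: staged_tuple_def)
  show ?thesis
    unfolding Dtuples_def
  proof (intro CollectI conjI ballI)
    show "boundary n T H \<in> {1..n} \<rightarrow>\<^sub>E (T \<rightarrow>\<^sub>E UNIV)" by (auto simp: boundary_def)
    fix i assume i: "i \<in> {1..n}"
    have c: "continuous_on UNIV (H i)" using nt by (simp add: null_tuple_def)
    have ll: "left_lim (boundary n T H i) x = H i (lo x)" if "x \<in> T" for x
      using T(1) T(3)[OF that] that by (intro boundary_left_lim nt i) auto
    have b: "boundary n T H i x = H i (hi x)" if "x \<in> T" for x using i that by (simp add: boundary_def)
    show "0 \<le> boundary n T H i 0"
    proof -
      have "H i (lo 0) \<le> H i (hi 0)" by (intro staged_tuple_mono[OF H i]) simp_all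
      then show ?thesis using nt T(2) by (simp add: b lo_0 null_tuple_def)
    qed
    show "left_lim (boundary n T H i) x \<le> boundary n T H i x" if "x \<in> T" for x
      using staged_tuple_mono[OF H i, of "lo x" "hi x"] T(1) that by (auto simp: b ll)
    show "cadlag_on T (boundary n T H i)"
      unfolding cadlag_on_def
    proof (intro ballI conjI impI)
      fix x assume x: "x \<in> T"
      then have x0: "0 \<le> x" using T(1) by auto
      have "((\<lambda>y. H i (hi y)) \<longlongrightarrow> H i (hi x)) (at_right x)"
        using x0 by (intro tendsto_hi c) auto
      then have "((\<lambda>y. H i (hi y)) \<longlongrightarrow> H i (hi x)) (at x within {x..})"
        by (simp add: at_within_Ici_at_right)
      then have "((\<lambda>y. H i (hi y)) \<longlongrightarrow> H i (hi x)) (at x within T \<inter> {x..})"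
        by (rule tendsto_within_subset) auto
      moreover have "eventually (\<lambda>y. H i (hi y) = boundary n T H i y) (at x within T \<inter> {x..})"
        using b by (auto simp: eventually_at_filter)
      ultimately have "(boundary n T H i \<longlongrightarrow> H i (hi x)) (at x within T \<inter> {x..})"
        by (rule Lim_transform_eventually)
      then show "continuous (at x within T \<inter> {x..}) (boundary n T H i)"
        by (simp add: continuous_within b[OF x])
      assume "0 < x"
      have "((\<lambda>y. H i (hi y)) \<longlongrightarrow> H i (lo x)) (at_left x)"
        using \<open>0 < x\<close> by (intro tendsto_lo c) auto
      moreover have "eventually (\<lambda>y. H i (hi y) = boundary n T H i y) (at_left x)"
        unfolding eventually_at_left[OF \<open>0 < x\<close>]
      proof (intro exI[of _ 0] conjI allI impI)
        fix y assume "0 < y" "y < x"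
        then have "y \<in> T" using T(3)[OF x] by auto
        then show "H i (hi y) = boundary n T H i y" by (simp add: b)
      qed (use \<open>0 < x\<close> in auto)
      ultimately have "(boundary n T H i \<longlongrightarrow> H i (lo x)) (at_left x)"
        by (rule Lim_transform_eventually)
      then show "\<exists>l. (boundary n T H i \<longlongrightarrow> l) (at_left x)" ..
    qed
  qed
qed

subsection \<open>Stretching a cadlag function\<close>

definition clamp01 :: "real \<Rightarrow> real" where "clamp01 r = max 0 (min 1 r)"

definition stretch :: "nat \<Rightarrow> nat \<Rightarrow> (real \<Rightarrow> real) \<Rightarrow> lexline \<Rightarrow> real" where
  "stretch n i g z = left_lim g (re z) +
     (g (re z) - left_lim g (re z)) * clamp01 (real n * sub z - real (n - i))"

definition regular :: "(real \<Rightarrow> real) \<Rightarrow> bool" where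
  "regular g \<longleftrightarrow> (\<forall>x\<ge>0. (g \<longlongrightarrow> g x) (at_right x)) \<and> (\<forall>x>0. \<exists>l. (g \<longlongrightarrow> l) (at_left x))
     \<and> (\<forall>x\<ge>0. left_lim g x \<le> g x)"

lemma regular_left: "regular g \<Longrightarrow> 0 < x \<Longrightarrow> (g \<longlongrightarrow> left_lim g x) (at_left x)"
  unfolding regular_def using left_lim_tendsto by blast

text \<open>The neighbourhoods of a point may be taken inside its block, except that an upper end
  also sees later times and a lower end also sees earlier times.\<close>

lemma continuous_lexlineI:
  fixes X :: "lexline \<Rightarrow> real"
  assumes "\<And>z e. 0 < e \<Longrightarrow> \<exists>d>0.
     (\<forall>w. re w = re z \<and> \<bar>sub w - sub z\<bar> < d \<longrightarrow> \<bar>X w - X z\<bar> < e) \<and>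
     (sub z = 1 \<longrightarrow> (\<forall>w. re z < re w \<and> re w < re z + d \<longrightarrow> \<bar>X w - X z\<bar> < e)) \<and>
     (sub z = 0 \<longrightarrow> (\<forall>w. re z - d < re w \<and> re w < re z \<longrightarrow> \<bar>X w - X z\<bar> < e))"
  shows "continuous_on UNIV X"
proof -
  have "(X \<longlongrightarrow> X z) (at z)" for z
  proof (subst at_eq_sup_left_right, rule filterlim_sup)
    show "(X \<longlongrightarrow> X z) (at_right z)"
    proof (rule tendstoI)
      fix e :: real assume "0 < e"
      then obtain d where d: "d > 0" "\<And>w. re w = re z \<Longrightarrow> \<bar>sub w - sub z\<bar> < d \<Longrightarrow> \<bar>X w - X z\<bar> < e"
         "\<And>w. sub z = 1 \<Longrightarrow> re z < re w \<Longrightarrow> re w < re z + d \<Longrightarrow> \<bar>X w - X z\<bar> < e"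
        using assms by metis
      define b where "b = (if sub z < 1 then pt (re z) (min 1 (sub z + d)) else lo (re z + d))"
      have zb: "z < b" using d(1) by (auto simp: b_def less_lexline_def)
      have "\<bar>X w - X z\<bar> < e" if "z < w" "w < b" for w
      proof (cases "sub z < 1")
        case True
        then have "re w = re z" "sub z < sub w" "sub w < sub z + d"
          using that d(1) by (auto simp: b_def less_lexline_def)
        then show ?thesis by (intro d(2)) auto
      next
        case False
        then have s1: "sub z = 1" using re_sub_bounds(3)[of z] by simp
        then have "re w < re z + d" using that d(1) by (simp add: b_def)
        moreover have "re z < re w" using that(1) s1 re_sub_bounds(3)[of w] by (auto simp: less_lexline_def)
        ultimately show ?thesis using s1 by (intro d(3))
      qed
      then show "eventually (\<lambda>w. dist (X w) (X z) < e) (at_right z)"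
        unfolding eventually_at_right[OF zb] dist_real_def using zb by blast
    qed
    show "(X \<longlongrightarrow> X z) (at_left z)"
    proof (cases "z = bot")
      case True
      then have "{..<z} = {}" by (auto simp: not_less_bot)
      then show ?thesis by simp
    next
      case False
      show ?thesis
      proof (rule tendstoI)
        fix e :: real assume "0 < e"
        then obtain d where d: "d > 0" "\<And>w. re w = re z \<Longrightarrow> \<bar>sub w - sub z\<bar> < d \<Longrightarrow> \<bar>X w - X z\<bar> < e"
           "\<And>w. sub z = 0 \<Longrightarrow> re z - d < re w \<Longrightarrow> re w < re z \<Longrightarrow> \<bar>X w - X z\<bar> < e"
          using assms by metis
        have pos: "0 < re z" if "sub z = 0"
        proof (rule ccontr)
          assume "\<not> 0 < re z"
          then have "re z = 0" using re_sub_bounds(1)[of z] by simp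
          then show False using False that pt_re_sub[of z] by (simp add: bot_lexline_def)
        qed
        define b where "b = (if 0 < sub z then pt (re z) (max 0 (sub z - d)) else hi (max 0 (re z - d)))"
        have m1: "max 0 (sub z - d) \<le> 1" using d(1) re_sub_bounds(3)[of z] by (simp add: max_def del: re_sub_bounds)
        have zb: "b < z"
          using d(1) pos re_sub_bounds[of z] m1 by (cases "0 < sub z") (auto simp: b_def less_lexline_def)
        have "\<bar>X w - X z\<bar> < e" if "b < w" "w < z" for w
        proof (cases "0 < sub z")
          case True
          have "re b = re z" "sub b = max 0 (sub z - d)" using True m1 by (auto simp: b_def)
          then have "re w = re z" "sub w < sub z" "max 0 (sub z - d) < sub w"
            using that by (auto simp: less_lexline_def)
          then show ?thesis by (intro d(2)) auto
        next
          case False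
          then have s0: "sub z = 0" using re_sub_bounds(2)[of z] by simp
          have "max 0 (re z - d) < re w" using that(1) False by (simp add: b_def)
          moreover have "re w < re z" using that(2) s0 re_sub_bounds(2)[of w] by (auto simp: less_lexline_def)
          ultimately show ?thesis using s0 by (intro d(3)) auto
        qed
        then show "eventually (\<lambda>w. dist (X w) (X z) < e) (at_left z)"
          unfolding eventually_at_left[OF zb] dist_real_def using zb by blast
      qed
    qed
  qed
  then show ?thesis by (simp add: continuous_on_def)
qed

lemma clamp01_bounds: "0 \<le> clamp01 r" "clamp01 r \<le> 1"
  and clamp01_lipschitz: "\<bar>clamp01 r - clamp01 s\<bar> \<le> \<bar>r - s\<bar>"
  and clamp01_mono: "r \<le> s \<Longrightarrow> clamp01 r \<le> clamp01 s"
  by (auto simp: clamp01_def)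

lemma convex_near:
  fixes a b v e c :: real
  assumes "\<bar>a - v\<bar> \<le> e" "\<bar>b - v\<bar> \<le> e" "0 \<le> c" "c \<le> 1"
  shows "\<bar>a + (b - a) * c - v\<bar> \<le> e"
proof -
  have "a + (b - a) * c - v = (1 - c) * (a - v) + c * (b - v)" by (simp add: algebra_simps)
  also have "\<bar>\<dots>\<bar> \<le> (1 - c) * \<bar>a - v\<bar> + c * \<bar>b - v\<bar>"
    using assms(3,4) abs_triangle_ineq[of "(1 - c) * (a - v)" "c * (b - v)"] by (simp add: abs_mult)
  also have "\<dots> \<le> (1 - c) * e + c * e" using assms by (intro add_mono mult_left_mono) auto
  finally show ?thesis by (simp add: algebra_simps)
qed

lemma stretch_lo: "i \<in> {1..n} \<Longrightarrow> 0 \<le> x \<Longrightarrow> stretch n i g (lo x) = left_lim g x"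
  by (simp add: stretch_def clamp01_def)

lemma stretch_hi: "i \<in> {1..n} \<Longrightarrow> 0 \<le> x \<Longrightarrow> stretch n i g (hi x) = g x"
  by (simp add: stretch_def clamp01_def of_nat_diff)

text \<open>Within a block the function is Lipschitz with constant \<open>n\<close> times the jump.
  In a neighbouring block every value is a convex combination of \<open>g\<close> and its left limit
  there, and both are close to the relevant one-sided limit at \<open>x\<close>.\<close>

lemma stretch_continuous:
  assumes g: "regular g" and i: "i \<in> {1..n}"
  shows "continuous_on UNIV (stretch n i g)"
proof (rule continuous_lexlineI)
  fix z :: lexline and e :: real assume e: "0 < e"
  define x where "x = re z"
  have x0: "0 \<le> x" by (simp add: x_def)
  define J where "J = g x - left_lim g x"
  define d1 where "d1 = e / (real n * \<bar>J\<bar> + 1)"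
  have den: "0 < real n * \<bar>J\<bar> + 1" by (intro add_nonneg_pos) auto
  have d1: "d1 > 0" using e den by (simp add: d1_def)
  have same: "\<bar>stretch n i g w - stretch n i g z\<bar> < e" if "re w = re z" "\<bar>sub w - sub z\<bar> < d1" for w
  proof -
    let ?c = "\<lambda>w. clamp01 (real n * sub w - real (n - i))"
    have "stretch n i g w - stretch n i g z = J * (?c w - ?c z)"
      using that by (simp add: stretch_def J_def x_def algebra_simps)
    then have "\<bar>stretch n i g w - stretch n i g z\<bar> = \<bar>J\<bar> * \<bar>?c w - ?c z\<bar>" by (simp add: abs_mult)
    also have "\<dots> \<le> \<bar>J\<bar> * \<bar>real n * sub w - real n * sub z\<bar>"
      using clamp01_lipschitz[of "real n * sub w - real (n - i)" "real n * sub z - real (n - i)"]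
      by (intro mult_left_mono) auto
    also have "\<dots> = \<bar>J\<bar> * real n * \<bar>sub w - sub z\<bar>" by (simp add: abs_mult flip: right_diff_distrib)
    also have "\<dots> \<le> \<bar>J\<bar> * real n * d1" using that by (intro mult_left_mono) auto
    also have "\<dots> < (real n * \<bar>J\<bar> + 1) * d1" using d1 by (simp add: algebra_simps)
    also have "\<dots> = e" using den by (simp add: d1_def)
    finally show ?thesis .
  qed
  have "\<exists>d2>0. \<forall>w. re z < re w \<and> re w < re z + d2 \<longrightarrow> \<bar>stretch n i g w - g x\<bar> < e"
  proof -
    have "eventually (\<lambda>y. dist (g y) (g x) < e / 2) (at_right x)"
      using g x0 e unfolding regular_def by (intro tendstoD) auto
    then obtain b where b: "b > x" "\<And>y. x < y \<Longrightarrow> y < b \<Longrightarrow> \<bar>g y - g x\<bar> < e / 2"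
      unfolding eventually_at_right[of x "x + 1", simplified] dist_real_def by blast
    have "\<bar>stretch n i g w - g x\<bar> < e" if "x < re w" "re w < b" for w
    proof -
      have "(g \<longlongrightarrow> left_lim g (re w)) (at_left (re w))"
        using g x0 that by (intro regular_left) auto
      then have "((\<lambda>y. \<bar>g y - g x\<bar>) \<longlongrightarrow> \<bar>left_lim g (re w) - g x\<bar>) (at_left (re w))"
        by (intro tendsto_intros)
      moreover have "eventually (\<lambda>y. \<bar>g y - g x\<bar> \<le> e / 2) (at_left (re w))"
        unfolding eventually_at_left[OF that(1)] using b(2) that by (intro exI[of _ x]) (auto simp: less_imp_le)
      ultimately have "\<bar>left_lim g (re w) - g x\<bar> \<le> e / 2"
        by (rule tendsto_upperbound) auto
      moreover have "\<bar>g (re w) - g x\<bar> \<le> e / 2" using b(2)[of "re w"] that by simp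
      ultimately have "\<bar>stretch n i g w - g x\<bar> \<le> e / 2"
        unfolding stretch_def by (intro convex_near clamp01_bounds)
      then show ?thesis using e by simp
    qed
    then show ?thesis using b(1) by (intro exI[of _ "b - x"]) (auto simp: x_def)
  qed
  then obtain d2 where d2: "d2 > 0" "\<And>w. re z < re w \<Longrightarrow> re w < re z + d2 \<Longrightarrow> \<bar>stretch n i g w - g x\<bar> < e"
    by blast
  have "\<exists>d3>0. \<forall>w. re z - d3 < re w \<and> re w < re z \<longrightarrow> \<bar>stretch n i g w - left_lim g x\<bar> < e"
  proof (cases "x = 0")
    case True
    then have "\<not> (re w < re z)" for w using re_sub_bounds(1)[of w] by (simp add: x_def)
    then show ?thesis by (intro exI[of _ 1]) auto
  next
    case False
    then have xp: "0 < x" using x0 by simp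
    have "eventually (\<lambda>y. dist (g y) (left_lim g x) < e / 2) (at_left x)"
      using regular_left[OF g xp] e by (intro tendstoD) auto
    then obtain b where b: "b < x" "\<And>y. b < y \<Longrightarrow> y < x \<Longrightarrow> \<bar>g y - left_lim g x\<bar> < e / 2"
      unfolding eventually_at_left[OF xp] dist_real_def by blast
    have "\<bar>stretch n i g w - left_lim g x\<bar> < e" if "max 0 b < re w" "re w < x" for w
    proof -
      have "(g \<longlongrightarrow> left_lim g (re w)) (at_left (re w))"
        using g that by (intro regular_left) auto
      then have "((\<lambda>y. \<bar>g y - left_lim g x\<bar>) \<longlongrightarrow> \<bar>left_lim g (re w) - left_lim g x\<bar>) (at_left (re w))"
        by (intro tendsto_intros)
      moreover have "eventually (\<lambda>y. \<bar>g y - left_lim g x\<bar> \<le> e / 2) (at_left (re w))"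
        unfolding eventually_at_left[OF that(1)] using b(2) that
        by (intro exI[of _ "max 0 b"]) (auto simp: less_imp_le)
      ultimately have "\<bar>left_lim g (re w) - left_lim g x\<bar> \<le> e / 2"
        by (rule tendsto_upperbound) auto
      moreover have "\<bar>g (re w) - left_lim g x\<bar> \<le> e / 2" using b(2)[of "re w"] that by simp
      ultimately have "\<bar>stretch n i g w - left_lim g x\<bar> \<le> e / 2"
        unfolding stretch_def by (intro convex_near clamp01_bounds)
      then show ?thesis using e by simp
    qed
    then show ?thesis using b(1) xp by (intro exI[of _ "x - max 0 b"]) (auto simp: x_def)
  qed
  then obtain d3 where d3: "d3 > 0" "\<And>w. re z - d3 < re w \<Longrightarrow> re w < re z \<Longrightarrow> \<bar>stretch n i g w - left_lim g x\<bar> < e"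
    by blast
  have "stretch n i g z = g x" if "sub z = 1"
    using stretch_hi[OF i x0, of g] that pt_re_sub[of z] by (simp add: x_def)
  moreover have "stretch n i g z = left_lim g x" if "sub z = 0"
    using stretch_lo[OF i x0, of g] that pt_re_sub[of z] by (simp add: x_def)
  ultimately show "\<exists>d>0. (\<forall>w. re w = re z \<and> \<bar>sub w - sub z\<bar> < d \<longrightarrow> \<bar>stretch n i g w - stretch n i g z\<bar> < e) \<and>
     (sub z = 1 \<longrightarrow> (\<forall>w. re z < re w \<and> re w < re z + d \<longrightarrow> \<bar>stretch n i g w - stretch n i g z\<bar> < e)) \<and>
     (sub z = 0 \<longrightarrow> (\<forall>w. re z - d < re w \<and> re w < re z \<longrightarrow> \<bar>stretch n i g w - stretch n i g z\<bar> < e))"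
    using same d1 d2 d3 by (intro exI[of _ "min d1 (min d2 d3)"]) auto
qed

text \<open>The standard thresholds: line \<open>i\<close> rises while the second coordinate passes through
  \<open>[(n-i)/n, (n-i+1)/n]\<close>.\<close>

definition standard :: "nat \<Rightarrow> (nat \<Rightarrow> lexline \<Rightarrow> real) \<Rightarrow> bool" where
  "standard n H \<longleftrightarrow> (\<forall>i<n. \<forall>z.
     (real n * sub z \<le> real (n - Suc i) \<longrightarrow> H (Suc i) z = H (Suc i) (lo (re z))) \<and>
     (real (n - i) \<le> real n * sub z \<longrightarrow> H (Suc i) z = H (Suc i) (hi (re z))) \<and>
     (\<forall>w. re w = re z \<and> sub z \<le> sub w \<longrightarrow> H (Suc i) z \<le> H (Suc i) w))"

lemma standard_staged:
  assumes H: "standard n H" and "0 \<le> x"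
  shows "staged n H (lo x) (hi x)"
  unfolding staged_def
proof (intro exI[of _ "\<lambda>i. pt x (real (n - i) / real n)"] conjI allI impI ballI)
  have q: "0 \<le> real (n - i) / real n" "real (n - i) / real n \<le> 1" for i
    by (auto simp: divide_le_eq)
  have rs: "re (pt x (real (n - i) / real n)) = x" "sub (pt x (real (n - i) / real n)) = real (n - i) / real n" for i
    using q[of i] \<open>0 \<le> x\<close> by auto
  show "pt x (real (n - i) / real n) \<in> {lo x..hi x}" for i using rs[of i] \<open>0 \<le> x\<close> by simp
  fix i assume i: "i < n"
  show "pt x (real (n - Suc i) / real n) \<le> pt x (real (n - i) / real n)"
    using rs[of i] rs[of "Suc i"] by (simp add: less_eq_lexline_def divide_right_mono)
  show "mono_on {lo x..hi x} (H (Suc i))"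
  proof (rule mono_onI)
    fix z w assume "z \<in> {lo x..hi x}" "w \<in> {lo x..hi x}" "z \<le> w"
    then have "re z = x" "re w = x" using \<open>0 \<le> x\<close> by simp_all
    then have "re w = re z \<and> sub z \<le> sub w" using \<open>z \<le> w\<close> by (simp add: less_eq_lexline_def)
    then show "H (Suc i) z \<le> H (Suc i) w" using H i unfolding standard_def by blast
  qed
  { fix z assume z: "z \<in> {lo x..pt x (real (n - Suc i) / real n)}"
    then have "re z = x" "sub z \<le> real (n - Suc i) / real n"
      using rs[of "Suc i"] \<open>0 \<le> x\<close> by (auto simp: less_eq_lexline_def)
    then have "real n * sub z \<le> real (n - Suc i)" using i by (simp add: pos_le_divide_eq mult.commute)
    then have "H (Suc i) z = H (Suc i) (lo (re z))" using H i unfolding standard_def by blast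
    then show "H (Suc i) z = H (Suc i) (lo x)" using \<open>re z = x\<close> by simp }
  { fix z assume z: "z \<in> {pt x (real (n - i) / real n)..hi x}"
    then have "re z = x" "real (n - i) / real n \<le> sub z"
      using rs[of i] \<open>0 \<le> x\<close> by (auto simp: less_eq_lexline_def)
    then have "real (n - i) \<le> real n * sub z" using i by (simp add: pos_divide_le_eq mult.commute)
    then have "H (Suc i) z = H (Suc i) (hi (re z))" using H i unfolding standard_def by blast
    then show "H (Suc i) z = H (Suc i) (hi x)" using \<open>re z = x\<close> by simp }
qed

definition stretch_tuple :: "nat \<Rightarrow> (nat \<Rightarrow> real \<Rightarrow> real) \<Rightarrow> nat \<Rightarrow> lexline \<Rightarrow> real" where
  "stretch_tuple n g i = (if i \<in> {1..n} then stretch n i (g i) else (\<lambda>_. 0))"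

lemma stretch_tuple_standard:
  assumes "\<And>i. i \<in> {1..n} \<Longrightarrow> regular (g i)"
  shows "standard n (stretch_tuple n g)"
  unfolding standard_def
proof (intro allI impI conjI)
  fix i z assume i: "i < n"
  have n: "n > 0" using i by simp
  show "stretch_tuple n g (Suc i) z = stretch_tuple n g (Suc i) (lo (re z))"
    if "real n * sub z \<le> real (n - Suc i)"
    using that i by (simp add: stretch_tuple_def stretch_def clamp01_def)
  show "stretch_tuple n g (Suc i) z = stretch_tuple n g (Suc i) (hi (re z))"
    if "real (n - i) \<le> real n * sub z"
    using that i by (simp add: stretch_tuple_def stretch_def clamp01_def of_nat_diff)
  fix w assume w: "re w = re z \<and> sub z \<le> sub w"
  have "left_lim (g (Suc i)) (re z) \<le> g (Suc i) (re z)"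
    using assms[of "Suc i"] i by (simp add: regular_def)
  moreover have "clamp01 (real n * sub z - real (n - Suc i)) \<le> clamp01 (real n * sub w - real (n - Suc i))"
    using w by (intro clamp01_mono diff_right_mono mult_left_mono) auto
  ultimately show "stretch_tuple n g (Suc i) z \<le> stretch_tuple n g (Suc i) w"
    using i w by (auto simp: stretch_tuple_def stretch_def intro!: mult_left_mono)
qed

lemma stretch_tuple_null:
  assumes "\<And>i. i \<in> {1..n} \<Longrightarrow> regular (g i)"
  shows "null_tuple (stretch_tuple n g)"
  using assms stretch_continuous stretch_lo[of _ n 0]
  by (auto simp: null_tuple_def stretch_tuple_def lo_0 left_lim_def simp flip: lo_0)

text \<open>Freezing a function at time \<open>t\<close> puts it on the whole half-line and makes
  its stretched version constant after \<open>hi t\<close>, as the inversion of the melon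
  requires.\<close>

lemma regular_restrict:
  assumes f: "f \<in> Dtuples n {0..t}" and i: "i \<in> {1..n}" and "0 < t"
  shows "regular (\<lambda>x. f i (min x t))"
    and "0 \<le> x \<Longrightarrow> x \<le> t \<Longrightarrow> left_lim (\<lambda>x. f i (min x t)) x = left_lim (f i) x"
    and "t < x \<Longrightarrow> left_lim (\<lambda>x. f i (min x t)) x = f i t"
proof -
  let ?g = "\<lambda>x. f i (min x t)"
  have f': "cadlag_on {0..t} (f i)" "\<And>x. 0 \<le> x \<Longrightarrow> x \<le> t \<Longrightarrow> left_lim (f i) x \<le> f i x"
    using f i unfolding Dtuples_def by auto
  have lim: "(?g \<longlongrightarrow> l) (at_left x)" if "(f i \<longlongrightarrow> l) (at_left x)" "0 < x" "x \<le> t" for l x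
    using that(1)
  proof (rule Lim_transform_eventually)
    show "\<forall>\<^sub>F y in at_left x. f i y = ?g y"
      unfolding eventually_at_left[OF \<open>0 < x\<close>] using that by (intro exI[of _ 0]) auto
  qed
  have lim2: "(?g \<longlongrightarrow> f i t) (at_left x)" if "t < x" for x
  proof (rule Lim_transform_eventually[OF tendsto_const])
    show "\<forall>\<^sub>F y in at_left x. f i t = ?g y"
      unfolding eventually_at_left[OF \<open>t < x\<close>] using that by (intro exI[of _ t]) auto
  qed
  have ex: "\<exists>l. (f i \<longlongrightarrow> l) (at_left x)" if "0 < x" "x \<le> t" for x
    using f'(1) that unfolding cadlag_on_def by auto
  show 1: "left_lim ?g x = left_lim (f i) x" if xt: "0 \<le> x" "x \<le> t" for x
  proof (cases "x = 0")
    case False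
    then have xp: "0 < x" using xt by simp
    obtain l where l: "(f i \<longlongrightarrow> l) (at_left x)" using ex[OF xp xt(2)] by blast
    show ?thesis using left_lim_tendsto[OF xp l] left_lim_tendsto[OF xp lim[OF l xp xt(2)]] by simp
  qed (simp add: left_lim_def)
  show 2: "left_lim ?g x = f i t" if "t < x" for x
    using lim2[OF that] that \<open>0 < t\<close> by (intro left_lim_tendsto) auto
  show "regular ?g"
    unfolding regular_def
  proof (intro conjI allI impI)
    fix x :: real assume x: "0 \<le> x"
    show "left_lim ?g x \<le> ?g x" using 1[OF x] 2[of x] f'(2)[OF x] by (cases "x \<le> t") auto
    show "(?g \<longlongrightarrow> ?g x) (at_right x)"
    proof (cases "x < t")
      case True
      have "(f i \<longlongrightarrow> f i x) (at x within {0..t} \<inter> {x..})"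
        using f'(1) x True unfolding cadlag_on_def continuous_within by auto
      moreover have "{0..t} \<inter> {x..} = {x..t}" using x by auto
      ultimately have "(f i \<longlongrightarrow> f i x) (at_right x)"
        by (simp only: at_within_Icc_at_right[OF True])
      then have "(?g \<longlongrightarrow> f i x) (at_right x)"
      proof (rule Lim_transform_eventually)
        show "\<forall>\<^sub>F y in at_right x. f i y = ?g y"
          unfolding eventually_at_right[OF True] using True by (intro exI[of _ t]) auto
      qed
      then show ?thesis using True by simp
    next
      case False
      have "(?g \<longlongrightarrow> f i t) (at_right x)"
      proof (rule Lim_transform_eventually[OF tendsto_const])
        show "\<forall>\<^sub>F y in at_right x. f i t = ?g y"
          using False by (auto simp: eventually_at_filter)
      qed
      then show ?thesis using False by (simp add: min_absorb2)
    qed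
  next
    fix x :: real assume x: "0 < x"
    show "\<exists>l. (?g \<longlongrightarrow> l) (at_left x)"
      using ex[OF x] lim[OF _ x] lim2[of x] by (cases "x \<le> t") auto
  qed
qed

section \<open>From cadlag paths to arrays\<close>

subsection \<open>The measure of a chain of intervals\<close>

definition increments :: "(real \<Rightarrow> real) \<Rightarrow> real set \<Rightarrow> real" where
  "increments g A = (\<Sum>C\<in>components A. g (Sup C) - left_lim g (Inf C))"

lemma increments_Un:
  assumes U: "closed U" "finite (components U)" "U \<subseteq> {..<c}" and "c \<le> b"
  shows "increments g (U \<union> {c..b}) = increments g U + (g b - left_lim g c)"
    and "finite (components (U \<union> {c..b}))"
proof -
  have d: "U \<inter> {c..b} = {}" using U(3) by auto
  have comp: "components {c..b} = {{c..b}}" using \<open>c \<le> b\<close> by (simp add: components_eq_sing_iff)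
  have eq: "components (U \<union> {c..b}) = components U \<union> {{c..b}}"
    using components_Un_disjoint_closed[OF U(1) _ d] comp by simp
  have "{c..b} \<notin> components U" using in_components_subset[of "{c..b}" U] d \<open>c \<le> b\<close> by fastforce
  then show "increments g (U \<union> {c..b}) = increments g U + (g b - left_lim g c)"
    using U(2) \<open>c \<le> b\<close> by (simp add: increments_def eq)
  show "finite (components (U \<union> {c..b}))" using U(2) by (simp add: eq)
qed

text \<open>Intervals that touch belong to one component, so a jump at the common point is counted
  once: for a touching interval the value \<open>g (a j)\<close> is subtracted instead of the left
  limit.\<close>

lemma increments_chain:
  fixes a b :: "nat \<Rightarrow> real"
  assumes "s \<le> q" "\<And>j. s \<le> j \<Longrightarrow> j \<le> q \<Longrightarrow> a j \<le> b j" "\<And>j. s \<le> j \<Longrightarrow> j < q \<Longrightarrow> b j \<le> a (Suc j)"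
  shows "increments g (\<Union>j\<in>{s..q}. {a j..b j}) =
    (\<Sum>j=s..q. g (b j) - (if s < j \<and> a j = b (j - 1) then g (a j) else left_lim g (a j)))"
proof -
  let ?e = "\<lambda>j. g (b j) - (if s < j \<and> a j = b (j - 1) then g (a j) else left_lim g (a j))"
  \<comment> \<open>\<open>U\<close> is the union of the completed components, and
    \<open>{c..b q}\<close> the last component, which the next interval may still prolong.\<close>
  have "\<exists>U c. closed U \<and> finite (components U) \<and> U \<subseteq> {..<c} \<and> c \<le> b q \<and>
     (\<Union>j\<in>{s..q}. {a j..b j}) = U \<union> {c..b q} \<and> sum ?e {s..q} = increments g U + (g (b q) - left_lim g c)"
    using assms
  proof (induction q rule: dec_induct)
    case base
    then show ?case by (intro exI[of _ "{}"] exI[of _ "a s"]) (auto simp: increments_def)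
  next
    case (step q)
    then obtain U c where U: "closed U" "finite (components U)" "U \<subseteq> {..<c}" "c \<le> b q"
      "(\<Union>j\<in>{s..q}. {a j..b j}) = U \<union> {c..b q}" "sum ?e {s..q} = increments g U + (g (b q) - left_lim g c)"
      by auto
    have le: "b q \<le> a (Suc q)" "a (Suc q) \<le> b (Suc q)" using step.prems step.hyps by auto
    have ins: "{s..Suc q} = insert (Suc q) {s..q}" using step.hyps by auto
    have un: "(\<Union>j\<in>{s..Suc q}. {a j..b j}) = (U \<union> {c..b q}) \<union> {a (Suc q)..b (Suc q)}"
      unfolding ins using U(5) by auto
    have sm: "sum ?e {s..Suc q} = increments g U + (g (b q) - left_lim g c) + ?e (Suc q)"
      unfolding ins using U(6) by simp
    show ?case
    proof (cases "a (Suc q) = b q")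
      case True
      have "{c..b q} \<union> {a (Suc q)..b (Suc q)} = {c..b (Suc q)}" using True U(4) le by auto
      then have "(\<Union>j\<in>{s..Suc q}. {a j..b j}) = U \<union> {c..b (Suc q)}" using un by (simp add: Un_assoc)
      moreover have "c \<le> b (Suc q)" using U(4) le True by simp
      moreover have "sum ?e {s..Suc q} = increments g U + (g (b (Suc q)) - left_lim g c)"
        unfolding sm using True step.hyps by simp
      ultimately show ?thesis using U(1-3) by blast
    next
      case False
      then have "U \<union> {c..b q} \<subseteq> {..<a (Suc q)}" using le U(3,4) by fastforce
      moreover have "closed (U \<union> {c..b q})" using U(1) by (intro closed_Un closed_real_atLeastAtMost)
      moreover have "sum ?e {s..Suc q} = increments g (U \<union> {c..b q}) + (g (b (Suc q)) - left_lim g (a (Suc q)))"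
        unfolding sm increments_Un(1)[OF U(1-4)] using False by simp
      ultimately show ?thesis using un le(2) increments_Un(2)[OF U(1-4)] by blast
    qed
  qed
  then show ?thesis using increments_Un(1) by metis
qed

subsection \<open>Sorting a family of essentially disjoint paths\<close>

definition region :: "nat \<Rightarrow> nat \<Rightarrow> nat \<Rightarrow> (nat \<Rightarrow> nat \<Rightarrow> real) \<Rightarrow> (real \<times> nat) set" where
  "region n p k t = (\<Union>j<k. \<Union>i\<in>{Suc p..n}. {t j i..t j (i - 1)} \<times> {i})"

lemma df_region:
  assumes t: "t \<in> arrays n p k x y" and k: "0 < k"
  shows "df f (region n p k t) = (\<Sum>i\<in>{p..<n}. increments (f (Suc i)) (\<Union>j<k. {t j (Suc i)..t j i}))"
proof -
  have sl: "slice (region n p k t) i = (\<Union>j<k. {t j i..t j (i - 1)})" if "i \<in> {Suc p..n}" for i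
    using that by (auto simp: slice_def region_def)
  have "t 0 i \<in> {t 0 i..t 0 (i - 1)}" if "i \<in> {Suc p..n}" for i
    using arraysD(3)[OF t k, of "i - 1"] that by auto
  then have "i \<in> snd ` region n p k t" if "i \<in> {Suc p..n}" for i
    unfolding region_def using that k by force
  then have "snd ` region n p k t = {Suc p..n}" by (auto simp: region_def)
  then have "df f (region n p k t) = (\<Sum>i\<in>{Suc p..n}. increments (f i) (\<Union>j<k. {t j i..t j (i - 1)}))"
    by (simp add: df_def increments_def sl)
  also have "{Suc p..n} = Suc ` {p..<n}" by (metis image_Suc_atLeastLessThan atLeastLessThanSuc_atLeastAtMost)
  also have "(\<Sum>i\<in>Suc ` {p..<n}. increments (f i) (\<Union>j<k. {t j i..t j (i - 1)})) =
     (\<Sum>i\<in>{p..<n}. increments (f (Suc i)) (\<Union>j<k. {t j (Suc i)..t j i}))"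
    by (subst sum.reindex) auto
  finally show ?thesis .
qed

lemma arrays_mono:
  assumes T: "T \<in> arrays n p k a b" and "j \<le> j'" "j' < k" "p \<le> i" "i \<le> n"
  shows "T j i \<le> T j' i"
  using assms(2,3)
proof (induction j' rule: dec_induct)
  case (step m)
  have "T m i \<le> T (Suc m) i"
  proof (cases "i = p")
    case True then show ?thesis using arraysD(2)[OF T, of m] arraysD(2)[OF T, of "Suc m"] step by simp
  next
    case False
    then obtain i' where i': "i = Suc i'" "p \<le> i'" using assms(4) by (cases i) auto
    have "T m i \<le> T m i'" "T m i' \<le> T (Suc m) i"
      using arraysD(3)[OF T, of m i'] arraysD(4)[OF T, of m i'] i' step assms(5) by auto
    then show ?thesis by simp
  qed
  then show ?case using step by simp
qed simp

text \<open>In each line two of these paths can meet only at the time where the left one turns out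
  of that line, so they share at most one point per line.\<close>

lemma arrays_disjoint_path_tuples:
  assumes t: "t \<in> arrays n p k x y"
  defines "\<pi> \<equiv> \<lambda>j. \<Union>i\<in>{Suc p..n}. {t (j - 1) i..t (j - 1) (i - 1)} \<times> {i}"
  shows "\<pi> \<in> disjoint_path_tuples k (x, n) (y, Suc p)" "(\<Union>j\<in>{1..k}. \<pi> j) = region n p k t"
proof -
  have ord: "t j (i - 1) \<le> t j' i" if jj: "j < j'" "j' < k" "i \<in> {Suc p..n}" for j j' i
  proof -
    obtain i' where i': "i = Suc i'" "p \<le> i'" "i' < n" using jj(3) by (cases i) auto
    have "t j i' \<le> t (Suc j) i" using arraysD(4)[OF t, of j i'] jj i' by auto
    also have "\<dots> \<le> t j' i" using jj i' by (intro arrays_mono[OF t]) auto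
    finally show ?thesis using i' by simp
  qed
  have fin: "finite (\<pi> (Suc j) \<inter> \<pi> (Suc j'))" if "j < j'" "j' < k" for j j'
  proof -
    have "\<pi> (Suc j) \<inter> \<pi> (Suc j') \<subseteq> (\<lambda>i. (t j (i - 1), i)) ` {Suc p..n}"
    proof
      fix z assume "z \<in> \<pi> (Suc j) \<inter> \<pi> (Suc j')"
      then obtain w i where "z = (w, i)" "i \<in> {Suc p..n}" "w \<le> t j (i - 1)" "t j' i \<le> w"
        by (auto simp: \<pi>_def)
      moreover from this have "w = t j (i - 1)" using ord[OF that, of i] by simp
      ultimately show "z \<in> (\<lambda>i. (t j (i - 1), i)) ` {Suc p..n}" by blast
    qed
    then show ?thesis by (rule finite_subset) simp
  qed
  show "\<pi> \<in> disjoint_path_tuples k (x, n) (y, Suc p)"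
    unfolding disjoint_path_tuples_def
  proof (intro CollectI conjI ballI impI)
    fix j assume "j \<in> {1..k}"
    then have j: "j - 1 < k" by auto
    show "\<pi> j \<in> paths (x, n) (y, Suc p)"
      unfolding paths_def
    proof (intro CollectI exI[of _ "t (j - 1)"] conjI ballI)
      fix i assume "i \<in> {snd (y, Suc p)..snd (x, n)}"
      then show "t (j - 1) i \<le> t (j - 1) (i - 1)" using arraysD(3)[OF t j, of "i - 1"] by auto
    qed (use arraysD(1,2)[OF t j] in \<open>simp_all add: \<pi>_def\<close>)
  next
    fix j j' assume "j \<in> {1..k}" "j' \<in> {1..k}" "j \<noteq> j'"
    then consider "j - 1 < j' - 1" "j' - 1 < k" | "j' - 1 < j - 1" "j - 1 < k" by force
    then show "finite (\<pi> j \<inter> \<pi> j')"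
      using fin[of "j - 1" "j' - 1"] fin[of "j' - 1" "j - 1"] \<open>j \<in> {1..k}\<close> \<open>j' \<in> {1..k}\<close>
      by cases (simp_all add: Int_commute)
  qed
  have "{1..k} = Suc ` {..<k}" by (simp add: image_Suc_lessThan)
  then show "(\<Union>j\<in>{1..k}. \<pi> j) = region n p k t" by (simp add: \<pi>_def region_def)
qed

text \<open>The \<open>j\<close>-th smallest of \<open>v 0\<close>, ..., \<open>v (k - 1)\<close>,
  counted from 0 and with multiplicity. Only its description by counting, given next, is
  used.\<close>

definition order_stat :: "nat \<Rightarrow> (nat \<Rightarrow> real) \<Rightarrow> nat \<Rightarrow> real" where
  "order_stat k v j = Min (v ` {j'. j' < k \<and> j < card {l. l < k \<and> v l \<le> v j'}})"

lemma
  assumes j: "j < k"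
  shows order_stat_le: "order_stat k v j \<le> x \<longleftrightarrow> j < card {l. l < k \<and> v l \<le> x}"
    and order_stat_less: "order_stat k v j < x \<longleftrightarrow> j < card {l. l < k \<and> v l < x}"
proof -
  define Q where "Q = {j'. j' < k \<and> j < card {l. l < k \<and> v l \<le> v j'}}"
  have fin: "finite Q" by (simp add: Q_def)
  have "Max (v ` {..<k}) \<in> v ` {..<k}" using j by (intro Max_in) auto
  then obtain m where m: "m < k" "v m = Max (v ` {..<k})" by auto
  then have "{l. l < k \<and> v l \<le> v m} = {..<k}" by auto
  then have "m \<in> Q" using m j by (simp add: Q_def)
  then have "Min (v ` Q) \<in> v ` Q" using fin by (intro Min_in) auto
  then obtain q where q: "q \<in> Q" "order_stat k v j = v q" by (auto simp: order_stat_def Q_def)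
  have low: "order_stat k v j \<le> v j'" if "j' \<in> Q" for j'
    using that fin by (auto simp: order_stat_def Q_def[symmetric])
  have cq: "j < card {l. l < k \<and> v l \<le> v q}" using q(1) by (simp add: Q_def)
  have find: "\<exists>j'\<in>Q. P (v j')" if "j < card {l. l < k \<and> P (v l)}" "\<And>r s. P r \<Longrightarrow> s \<le> r \<Longrightarrow> P s" for P
  proof -
    let ?A = "{l. l < k \<and> P (v l)}"
    have ne: "?A \<noteq> {}" using that by (metis card.empty not_less_zero)
    then have "Max (v ` ?A) \<in> v ` ?A" by (intro Max_in) auto
    then obtain j' where j': "j' < k" "P (v j')" "v j' = Max (v ` ?A)" by auto
    have "v l \<le> v j'" if "l \<in> ?A" for l unfolding j'(3) using that by (intro Max_ge) auto
    then have "{l. l < k \<and> v l \<le> v j'} = ?A" using that(2) j'(2) by auto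
    then have "j' \<in> Q" using that(1) j'(1) by (simp add: Q_def)
    then show ?thesis using j' by blast
  qed
  show "order_stat k v j \<le> x \<longleftrightarrow> j < card {l. l < k \<and> v l \<le> x}"
  proof
    assume "order_stat k v j \<le> x"
    then have "card {l. l < k \<and> v l \<le> v q} \<le> card {l. l < k \<and> v l \<le> x}"
      using q(2) by (intro card_mono) auto
    then show "j < card {l. l < k \<and> v l \<le> x}" using cq by simp
  next
    assume "j < card {l. l < k \<and> v l \<le> x}"
    then show "order_stat k v j \<le> x" using find[of "\<lambda>r. r \<le> x"] low by fastforce
  qed
  show "order_stat k v j < x \<longleftrightarrow> j < card {l. l < k \<and> v l < x}"
  proof
    assume "order_stat k v j < x"
    then have "card {l. l < k \<and> v l \<le> v q} \<le> card {l. l < k \<and> v l < x}"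
      using q(2) by (intro card_mono) auto
    then show "j < card {l. l < k \<and> v l < x}" using cq by simp
  next
    assume "j < card {l. l < k \<and> v l < x}"
    then show "order_stat k v j < x" using find[of "\<lambda>r. r < x"] low by fastforce
  qed
qed

text \<open>Essentially disjoint paths may cross vertically. Sorting the turning times level by level gives
  ordered paths that cover the same set.\<close>

lemma disjoint_path_tuples_sorted:
  assumes \<pi>: "\<pi> \<in> disjoint_path_tuples k (x, n) (y, Suc p)" and "x \<le> y" "p < n"
  shows "\<exists>t\<in>arrays n p k x y. (\<Union>j\<in>{1..k}. \<pi> j) = region n p k t"
proof -
  have "\<forall>j\<in>{1..k}. \<exists>\<tau>. \<tau> n = x \<and> \<tau> p = y \<and> (\<forall>i\<in>{Suc p..n}. \<tau> i \<le> \<tau> (i - 1)) \<and>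
      \<pi> j = (\<Union>i\<in>{Suc p..n}. {\<tau> i..\<tau> (i - 1)} \<times> {i})"
    using \<pi> unfolding disjoint_path_tuples_def paths_def by simp
  then obtain \<tau> where \<tau>': "\<forall>j\<in>{1..k}. \<tau> j n = x \<and> \<tau> j p = y \<and> (\<forall>i\<in>{Suc p..n}. \<tau> j i \<le> \<tau> j (i - 1)) \<and>
      \<pi> j = (\<Union>i\<in>{Suc p..n}. {\<tau> j i..\<tau> j (i - 1)} \<times> {i})"
    by (rule bchoice[THEN exE]) blast
  define v where "v i j = \<tau> (Suc j) i" for i j
  have v: "v n j = x" "v p j = y" "\<pi> (Suc j) = (\<Union>i\<in>{Suc p..n}. {v i j..v (i - 1) j} \<times> {i})"
    if "j < k" for i j
    using \<tau>'[rule_format, of "Suc j"] that by (auto simp: v_def)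
  have v_le: "v (Suc i) j \<le> v i j" if "j < k" "p \<le> i" "i < n" for i j
  proof -
    have "\<tau> (Suc j) (Suc i) \<le> \<tau> (Suc j) (Suc i - 1)"
      using \<tau>'[rule_format, of "Suc j"] that by (metis Suc_le_eq Suc_le_mono atLeastAtMost_iff le0 One_nat_def)
    then show ?thesis by (simp add: v_def)
  qed
  have disj: "finite ({v (Suc i) j..v i j} \<inter> {v (Suc i) j'..v i j'})"
    if "j < k" "j' < k" "j \<noteq> j'" "p \<le> i" "i < n" for i j j'
  proof -
    have "finite (\<pi> (Suc j) \<inter> \<pi> (Suc j'))" using \<pi> that unfolding disjoint_path_tuples_def by auto
    moreover have "({v (Suc i) j..v i j} \<inter> {v (Suc i) j'..v i j'}) \<times> {Suc i} \<subseteq> \<pi> (Suc j) \<inter> \<pi> (Suc j')"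
      using that by (force simp: v)
    ultimately have "finite (({v (Suc i) j..v i j} \<inter> {v (Suc i) j'..v i j'}) \<times> {Suc i})"
      by (rule rev_finite_subset)
    then show ?thesis using finite_cartesian_productD1 by blast
  qed
  define t where "t j i = order_stat k (v i) j" for j i
  have le: "t j i \<le> z \<longleftrightarrow> j < card {l. l < k \<and> v i l \<le> z}"
    and less: "t j i < z \<longleftrightarrow> j < card {l. l < k \<and> v i l < z}" if "j < k" for j i z
    unfolding t_def using order_stat_le[OF that] order_stat_less[OF that] by auto
  have ends: "t j i = c" if "j < k" "\<And>l. l < k \<Longrightarrow> v i l = c" for j i c
  proof -
    have "{l. l < k \<and> v i l \<le> z} = (if c \<le> z then {..<k} else {})" for z using that(2) by auto
    then have "t j i \<le> z \<longleftrightarrow> c \<le> z" for z using le[OF that(1), of i z] that(1) by simp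
    then show ?thesis by (metis antisym order_refl)
  qed
  have arr: "t \<in> arrays n p k x y"
    unfolding arrays_def
  proof (intro CollectI conjI allI impI ballI)
    fix j assume j: "j < k"
    show "t j n = x" "t j p = y" using ends[OF j] v by auto
    fix i assume i: "i \<in> {p..<n}"
    have "card {l. l < k \<and> v i l \<le> t j i} \<le> card {l. l < k \<and> v (Suc i) l \<le> t j i}"
      using v_le i by (intro card_mono) (auto intro: order_trans)
    then show "t j (Suc i) \<le> t j i" using le[OF j, of i "t j i"] le[OF j, of "Suc i" "t j i"] by simp
  next
    fix j i assume j: "Suc j < k" and i: "i \<in> {p..<n}"
    let ?z = "t (Suc j) (Suc i)"
    let ?A = "{l. l < k \<and> v (Suc i) l \<le> ?z}" and ?B = "{l. l < k \<and> v i l \<le> ?z}"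
    have BA: "?B \<subseteq> ?A" using v_le i by (auto intro: order_trans)
    \<comment> \<open>Two members of the difference would be two paths that both occupy line
      \<open>i + 1\<close> from \<open>?z\<close> up to a later time, and so have infinite
      intersection.\<close>
    have "card (?A - ?B) \<le> 1"
    proof (rule ccontr)
      assume "\<not> card (?A - ?B) \<le> 1"
      moreover have "finite (?A - ?B)" by simp
      ultimately have "\<not> (\<forall>l\<in>?A - ?B. \<forall>l'\<in>?A - ?B. l = l')"
        using card_le_Suc0_iff_eq[of "?A - ?B"] by simp
      then obtain l l' where l: "l \<in> ?A - ?B" "l' \<in> ?A - ?B" "l \<noteq> l'" by blast
      have "{?z..min (v i l) (v i l')} \<subseteq> {v (Suc i) l..v i l} \<inter> {v (Suc i) l'..v i l'}"
        using l by auto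
      moreover have "infinite {?z..min (v i l) (v i l')}" using l by (auto simp: infinite_Icc_iff)
      moreover have "finite ({v (Suc i) l..v i l} \<inter> {v (Suc i) l'..v i l'})" using disj[of l l' i] l i by simp
      ultimately show False using finite_subset by blast
    qed
    then have "card ?A \<le> card ?B + 1" using card_Diff_subset[OF _ BA] card_mono[OF _ BA] by simp
    moreover have "Suc j < card ?A" using le[OF j, of "Suc i" ?z] by simp
    ultimately show "t j i \<le> ?z" using le[of j i ?z] j by simp
  qed
  \<comment> \<open>A time \<open>z\<close> is covered in this line iff more intervals have begun by
    \<open>z\<close> than have ended before \<open>z\<close>. This comparison of two counts does not
    depend on how beginnings and ends are matched, hence it survives sorting.\<close>
  have cover: "(\<exists>j<k. v (Suc i) j \<le> z \<and> z \<le> v i j) \<longleftrightarrow> (\<exists>j<k. t j (Suc i) \<le> z \<and> z \<le> t j i)"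
    if "p \<le> i" "i < n" for i z
  proof -
    let ?A = "{l. l < k \<and> v (Suc i) l \<le> z}" and ?B = "{l. l < k \<and> v i l < z}"
    have BA: "?B \<subseteq> ?A" using v_le[OF _ that] by fastforce
    have finA: "finite ?A" by simp
    have "t j (Suc i) \<le> z \<and> z \<le> t j i \<longleftrightarrow> j < card ?A \<and> \<not> j < card ?B" if "j < k" for j
      using le[OF that, of "Suc i" z] less[OF that, of i z] by (simp only: not_less[symmetric])
    then have "(\<exists>j<k. t j (Suc i) \<le> z \<and> z \<le> t j i) \<longleftrightarrow> (\<exists>j<k. j < card ?A \<and> \<not> j < card ?B)"
      by blast
    also have "\<dots> \<longleftrightarrow> card ?B < card ?A"
    proof
      assume "card ?B < card ?A"
      moreover have "card ?A \<le> k" using card_mono[of "{..<k}" ?A] by auto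
      ultimately show "\<exists>j<k. j < card ?A \<and> \<not> j < card ?B" by (intro exI[of _ "card ?B"]) simp
    qed auto
    also have "\<dots> \<longleftrightarrow> ?B \<noteq> ?A"
    proof
      assume "?B \<noteq> ?A"
      then show "card ?B < card ?A" using BA by (intro psubset_card_mono[OF finA] psubsetI)
    next
      assume less: "card ?B < card ?A"
      show "?B \<noteq> ?A"
      proof
        assume "?B = ?A"
        then show False using less by (simp only: less_irrefl)
      qed
    qed
    also have "\<dots> \<longleftrightarrow> (\<exists>l. l \<in> ?A \<and> l \<notin> ?B)" using BA by blast
    also have "\<dots> \<longleftrightarrow> (\<exists>j<k. v (Suc i) j \<le> z \<and> z \<le> v i j)" by (auto simp: not_less)
    finally show ?thesis by simp
  qed
  have "(\<Union>j\<in>{1..k}. \<pi> j) = (\<Union>j<k. \<pi> (Suc j))"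
  proof -
    have "{1..k} = Suc ` {..<k}" by (simp add: image_Suc_lessThan)
    then show ?thesis by (simp only: image_image)
  qed
  also have "\<dots> = (\<Union>j<k. \<Union>i\<in>{Suc p..n}. {v i j..v (i - 1) j} \<times> {i})" by (intro SUP_cong) (auto simp: v(3))
  also have "\<dots> = region n p k t"
  proof -
    have "(z, i) \<in> (\<Union>j<k. \<Union>i\<in>{Suc p..n}. {v i j..v (i - 1) j} \<times> {i}) \<longleftrightarrow> (z, i) \<in> region n p k t" for z i
    proof (cases "i \<in> {Suc p..n}")
      case True
      then obtain i' where i': "i = Suc i'" "p \<le> i'" "i' < n" by (cases i) auto
      have 1: "(z, i) \<in> (\<Union>j<k. \<Union>i\<in>{Suc p..n}. {v i j..v (i - 1) j} \<times> {i}) \<longleftrightarrow> (\<exists>j<k. v (Suc i') j \<le> z \<and> z \<le> v i' j)"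
        using True i' by auto
      have 2: "(z, i) \<in> region n p k t \<longleftrightarrow> (\<exists>j<k. t j (Suc i') \<le> z \<and> z \<le> t j i')"
        using True i' by (auto simp: region_def)
      show ?thesis unfolding 1 2 by (rule cover[OF i'(2,3)])
    qed (auto simp: region_def)
    then show ?thesis by (intro set_eqI) (rule prod.induct)
  qed
  finally show ?thesis using arr by blast
qed

subsection \<open>Lifting and projecting arrays\<close>

lemma staged_thresholds:
  assumes "staged_tuple n H"
  obtains \<theta> where
    "\<And>x i. 0 \<le> x \<Longrightarrow> i \<le> n \<Longrightarrow> re (\<theta> x i) = x"
    "\<And>x i. 0 \<le> x \<Longrightarrow> i < n \<Longrightarrow> \<theta> x (Suc i) \<le> \<theta> x i"
    "\<And>x i z. 0 \<le> x \<Longrightarrow> i < n \<Longrightarrow> re z = x \<Longrightarrow> z \<le> \<theta> x (Suc i) \<Longrightarrow> H (Suc i) z = H (Suc i) (lo x)"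
    "\<And>x i z. 0 \<le> x \<Longrightarrow> i < n \<Longrightarrow> re z = x \<Longrightarrow> \<theta> x i \<le> z \<Longrightarrow> H (Suc i) z = H (Suc i) (hi x)"
proof -
  let ?P = "\<lambda>x \<theta>. (\<forall>i\<le>n. \<theta> i \<in> {lo x..hi x}) \<and>
     (\<forall>i<n. \<theta> (Suc i) \<le> \<theta> i \<and> (\<forall>z\<in>{lo x..\<theta> (Suc i)}. H (Suc i) z = H (Suc i) (lo x)) \<and>
        (\<forall>z\<in>{\<theta> i..hi x}. H (Suc i) z = H (Suc i) (hi x)) \<and> mono_on {lo x..hi x} (H (Suc i)))"
  have "\<forall>x. \<exists>\<theta>. 0 \<le> x \<longrightarrow> ?P x \<theta>"
    using assms unfolding staged_tuple_def staged_def by blast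
  then obtain \<theta> where \<theta>: "\<And>x. 0 \<le> x \<Longrightarrow> ?P x (\<theta> x)"
    using choice[of "\<lambda>x \<theta>. 0 \<le> x \<longrightarrow> ?P x \<theta>"] by blast
  show thesis
  proof (rule that[of \<theta>])
    fix x :: real and i assume x: "0 \<le> x"
    note P = \<theta>[OF x]
    show "re (\<theta> x i) = x" if "i \<le> n"
    proof -
      have "\<theta> x i \<in> {lo x..hi x}" using P that by blast
      then show ?thesis using x by simp
    qed
    show "\<theta> x (Suc i) \<le> \<theta> x i" if "i < n" using P that by blast
    fix z assume i: "i < n" and z: "re z = x"
    have lh: "lo x \<le> z" "z \<le> hi x" using x z by simp_all
    show "H (Suc i) z = H (Suc i) (lo x)" if "z \<le> \<theta> x (Suc i)"
      using P i lh that by (meson atLeastAtMost_iff)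
    show "H (Suc i) z = H (Suc i) (hi x)" if "\<theta> x i \<le> z"
      using P i lh that by (meson atLeastAtMost_iff)
  qed
qed

text \<open>Projection enlarges every interval to whole blocks. The only loss occurs where an
  interval starts in the block in which its predecessor ended; it is covered by the surplus gained
  at that end.\<close>

lemma increments_projected:
  fixes a b :: "nat \<Rightarrow> lexline"
  assumes H: "staged_tuple n H" and i: "i \<in> {1..n}"
    and g: "\<And>x. 0 \<le> x \<Longrightarrow> x \<le> re (b k) \<Longrightarrow> g x = H i (hi x) \<and> left_lim g x = H i (lo x)"
    and ab: "\<And>j. j \<le> k \<Longrightarrow> a j \<le> b j" "\<And>j. j < k \<Longrightarrow> b j \<le> a (Suc j)"
  shows "(\<Sum>j\<le>k. H i (b j) - H i (a j)) \<le> increments g (\<Union>j\<in>{0..k}. {re (a j)..re (b j)})"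
proof -
  let ?e = "\<lambda>j. if 0 < j \<and> re (a j) = re (b (j - 1)) then g (re (a j)) else left_lim g (re (a j))"
  have block: "H i (lo (re z)) \<le> H i z" "H i z \<le> H i (hi (re z))" for z
    using staged_tuple_mono[OF H i, of "lo (re z)" z] staged_tuple_mono[OF H i, of z "hi (re z)"] by simp_all
  have mono: "b j \<le> b k" if "j \<le> k" for j
    using that
  proof (induction rule: inc_induct)
    case (step m) then show ?case using ab(1)[of "Suc m"] ab(2)[of m] by simp
  qed simp
  have g': "g (re (b j)) = H i (hi (re (b j)))" "g (re (a j)) = H i (hi (re (a j)))"
    "left_lim g (re (a j)) = H i (lo (re (a j)))" if "j \<le> k" for j
    using g[of "re (b j)"] g[of "re (a j)"] re_mono[OF mono[OF that]] re_mono[OF ab(1)[OF that]] by auto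
  \<comment> \<open>The left side is the surplus at the end of interval \<open>m\<close>: the part
    of the rise in that block that the lifted interval leaves out. It has to be kept in the
    induction to pay for a touching successor.\<close>
  have "g (re (b m)) - H i (b m) \<le> (\<Sum>j\<le>m. g (re (b j)) - ?e j) - (\<Sum>j\<le>m. H i (b j) - H i (a j))" if "m \<le> k" for m
    using that
  proof (induction m)
    case 0
    then show ?case using block(1)[of "a 0"] g'(3)[of 0] by simp
  next
    case (Suc m)
    have IH: "g (re (b m)) - H i (b m) \<le> (\<Sum>j\<le>m. g (re (b j)) - ?e j) - (\<Sum>j\<le>m. H i (b j) - H i (a j))"
      using Suc by simp
    have "?e (Suc m) \<le> H i (a (Suc m)) + (g (re (b m)) - H i (b m))"
    proof (cases "re (a (Suc m)) = re (b m)")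
      case True
      then have "H i (b m) \<le> H i (a (Suc m))" using ab(2)[of m] Suc.prems by (intro staged_tuple_mono[OF H i]) auto
      then show ?thesis using True by simp
    next
      case False
      then show ?thesis using block(1)[of "a (Suc m)"] block(2)[of "b m"] g'(3)[of "Suc m"] g'(1)[of m] Suc.prems by simp
    qed
    then show ?case using IH by simp
  qed
  from this[of k] have "(\<Sum>j\<le>k. H i (b j) - H i (a j)) \<le> (\<Sum>j\<le>k. g (re (b j)) - ?e j)"
    using block(2)[of "b k"] g'(1)[of k] by simp
  also have "\<dots> = increments g (\<Union>j\<in>{0..k}. {re (a j)..re (b j)})"
    using increments_chain[of 0 k "\<lambda>j. re (a j)" "\<lambda>j. re (b j)" g] re_mono[OF ab(1)] re_mono[OF ab(2)]
    by (simp add: atMost_atLeast0)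
  finally show ?thesis .
qed

context
  fixes n p k :: nat and x y :: real and H :: "nat \<Rightarrow> lexline \<Rightarrow> real" and u :: tuple
  assumes H: "staged_tuple n H" and xy: "0 \<le> x" "x \<le> y" and p: "p < n" "p + k \<le> n" "0 < k"
    and u: "\<And>i z. i \<in> {1..n} \<Longrightarrow> 0 \<le> z \<Longrightarrow> z \<le> y \<Longrightarrow> u i z = H i (hi z) \<and> left_lim (u i) z = H i (lo z)"
begin

lemma arrays_project:
  assumes T: "T \<in> arrays n p k (lo x) (hi y)"
  shows "(\<lambda>j i. re (T j i)) \<in> arrays n p k x y"
    and "weight H n p k T \<le> df u (region n p k (\<lambda>j i. re (T j i)))"
proof -
  show arr: "(\<lambda>j i. re (T j i)) \<in> arrays n p k x y"
    unfolding arrays_def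
  proof (intro CollectI conjI allI impI ballI)
    fix j assume j: "j < k"
    show "re (T j n) = x" "re (T j p) = y" using arraysD(1,2)[OF T j] xy by simp_all
    fix i assume "i \<in> {p..<n}"
    then show "re (T j (Suc i)) \<le> re (T j i)" using arraysD(3)[OF T j, of i] by (auto intro: re_mono)
  next
    fix j i assume "Suc j < k" "i \<in> {p..<n}"
    then show "re (T j i) \<le> re (T (Suc j) (Suc i))" using arraysD(4)[OF T, of j i] by (auto intro: re_mono)
  qed
  obtain k' where k': "k = Suc k'" using p(3) by (cases k) auto
  have "(\<Sum>j<k. H (Suc i) (T j i) - H (Suc i) (T j (Suc i))) \<le>
      increments (u (Suc i)) (\<Union>j<k. {re (T j (Suc i))..re (T j i)})" if i: "i \<in> {p..<n}" for i
  proof -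
    have "(\<Sum>j\<le>k'. H (Suc i) (T j i) - H (Suc i) (T j (Suc i))) \<le>
      increments (u (Suc i)) (\<Union>j\<in>{0..k'}. {re (T j (Suc i))..re (T j i)})"
    proof (rule increments_projected[OF H, of "Suc i" "\<lambda>j. T j i" k' _ "\<lambda>j. T j (Suc i)"])
      fix z assume "0 \<le> z" "z \<le> re (T k' i)"
      moreover have "re (T k' i) \<le> y" using arrays_range(2)[OF T, of k' i] i k' xy by simp
      ultimately show "u (Suc i) z = H (Suc i) (hi z) \<and> left_lim (u (Suc i)) z = H (Suc i) (lo z)"
        using u[of "Suc i" z] i by simp
    qed (use arraysD(3,4)[OF T] i k' in auto)
    then show ?thesis by (simp add: k' lessThan_Suc_atMost atMost_atLeast0)
  qed
  then have "(\<Sum>i\<in>{p..<n}. \<Sum>j<k. H (Suc i) (T j i) - H (Suc i) (T j (Suc i))) \<le>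
    (\<Sum>i\<in>{p..<n}. increments (u (Suc i)) (\<Union>j<k. {re (T j (Suc i))..re (T j i)}))"
    by (rule sum_mono)
  also have "\<dots> = df u (region n p k (\<lambda>j i. re (T j i)))" using df_region[OF arr p(3), of u] by simp
  finally show "weight H n p k T \<le> df u (region n p k (\<lambda>j i. re (T j i)))"
    unfolding weight_def by (subst sum.swap)
qed

text \<open>A turn at level \<open>i\<close> is lifted to the threshold \<open>\<theta>\<close>,
  after line \<open>i + 1\<close> has risen and before line \<open>i\<close> does. It is delayed to
  the turn of the preceding path one level below if that one comes later, so that the order is
  respected; turns forced to the start or the end are put at \<open>lo x\<close> or
  \<open>hi y\<close>.\<close>

lemma arrays_lift:
  assumes t: "t \<in> arrays n p k x y"
  shows "\<exists>T\<in>arrays n p k (lo x) (hi y). df u (region n p k t) \<le> weight H n p k T"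
proof -
  obtain \<theta> where \<theta>:
    "\<And>x i. 0 \<le> x \<Longrightarrow> i \<le> n \<Longrightarrow> re (\<theta> x i) = x"
    "\<And>x i. 0 \<le> x \<Longrightarrow> i < n \<Longrightarrow> \<theta> x (Suc i) \<le> \<theta> x i"
    "\<And>x i z. 0 \<le> x \<Longrightarrow> i < n \<Longrightarrow> re z = x \<Longrightarrow> z \<le> \<theta> x (Suc i) \<Longrightarrow> H (Suc i) z = H (Suc i) (lo x)"
    "\<And>x i z. 0 \<le> x \<Longrightarrow> i < n \<Longrightarrow> re z = x \<Longrightarrow> \<theta> x i \<le> z \<Longrightarrow> H (Suc i) z = H (Suc i) (hi x)"
    using staged_thresholds[OF H] by blast
  define T where "T = rec_nat
     (\<lambda>i. if n < i + k then lo x else if i \<le> p then hi y else \<theta> (t 0 i) i)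
     (\<lambda>j L i. if Suc j + n < i + k then lo x else if i \<le> p + Suc j then hi y
         else max (\<theta> (t (Suc j) i) i) (L (i - 1)))"
  have T0: "T 0 i = (if n < i + k then lo x else if i \<le> p then hi y else \<theta> (t 0 i) i)"
    and TS: "T (Suc j) i = (if Suc j + n < i + k then lo x else if i \<le> p + Suc j then hi y
         else max (\<theta> (t (Suc j) i) i) (T j (i - 1)))" for j i
    by (simp_all add: T_def)
  have Tlo: "T j i = lo x" if "j + n < i + k" for j i using that by (cases j) (auto simp: T0 TS)
  have Thi: "T j i = hi y" if "i \<le> p + j" for j i using that p(2) by (cases j) (auto simp: T0 TS)
  have tr: "x \<le> t j i" "t j i \<le> y" if "j < k" "p \<le> i" "i \<le> n" for j i
    using arrays_range[OF t that] by auto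
  have t0: "0 \<le> t j i" if "j < k" "p \<le> i" "i \<le> n" for j i using tr(1)[OF that] xy by simp
  have reT: "re (T j i) = t j i" if "j < k" "p \<le> i" "i \<le> n" for j i
    using that
  proof (induction j arbitrary: i)
    case 0
    then show ?case
      using \<theta>(1)[OF t0[OF 0], of i] arrays_start[OF t _ _ 0(1), of i] arrays_end[OF t 0(1), of i] xy
      by (auto simp: T0)
  next
    case (Suc j)
    show ?case
    proof (cases "Suc j + n < i + k \<or> i \<le> p + Suc j")
      case True
      then show ?thesis
        using arrays_start[OF t _ _ Suc.prems(1), of i] arrays_end[OF t Suc.prems(1), of i] Suc.prems xy
        by (auto simp: TS)
    next
      case False
      then obtain i' where i': "i = Suc i'" "p \<le> i'" "i' < n" using Suc.prems by (cases i) auto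
      have "re (T j i') = t j i'" using Suc i' by auto
      also have "\<dots> \<le> t (Suc j) i" using arraysD(4)[OF t, of j i'] Suc.prems i' by auto
      finally have "re (T j (i - 1)) \<le> t (Suc j) i" using i' by simp
      moreover have "re (\<theta> (t (Suc j) i) i) = t (Suc j) i" using \<theta>(1)[OF t0[OF Suc.prems], of i] Suc.prems by simp
      moreover have "T (Suc j) i = max (\<theta> (t (Suc j) i) i) (T j (i - 1))" using False by (simp add: TS)
      ultimately show ?thesis by (auto simp: max_def less_eq_lexline_def split: if_splits)
    qed
  qed
  \<comment> \<open>The path leaves line \<open>i + 1\<close> only after that line has risen, so
    there \<open>H (Suc i)\<close> already has the value at the upper end of the block.\<close>
  have post: "\<theta> (t j i) i \<le> T j i" if "j < k" "p \<le> i" "i \<le> n" "\<not> j + n < i + k" for j i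
  proof (cases "i \<le> p + j")
    case True
    then have "t j i = y" using arrays_end[OF t that(1)] that by simp
    then show ?thesis using Thi[OF True] \<theta>(1)[of y i] xy that by simp
  next
    case False
    then show ?thesis using that by (cases j) (auto simp: T0 TS)
  qed
  have thr: "\<theta> (t j (Suc i)) (Suc i) \<le> \<theta> (t j i) i" if "j < k" "p \<le> i" "i < n" for j i
  proof (cases "t j (Suc i) = t j i")
    case True then show ?thesis using \<theta>(2)[of "t j i" i] t0[of j i] that by simp
  next
    case False
    then have "re (\<theta> (t j (Suc i)) (Suc i)) < re (\<theta> (t j i) i)"
      using arraysD(3)[OF t that(1), of i] t0[of j i] t0[of j "Suc i"] that \<theta>(1) by simp
    then show ?thesis by (intro less_imp_le re_less)
  qed
  have lo_le: "lo x \<le> T j i" and le_hi: "T j i \<le> hi y" if "j < k" "p \<le> i" "i \<le> n" for j i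
    using reT[OF that] tr[OF that] xy by simp_all
  have anti: "T j (Suc i) \<le> T j i" if "j < k" "p \<le> i" "i < n" for j i
    using that
  proof (induction j arbitrary: i)
    case 0
    show ?case
    proof (cases "n < Suc i + k \<or> i \<le> p")
      case True then show ?thesis using Tlo[of 0 "Suc i"] Thi[of i 0] lo_le[of 0 i] le_hi[of 0 "Suc i"] 0 by auto
    next
      case False then show ?thesis using thr[OF 0] by (simp add: T0)
    qed
  next
    case (Suc j)
    show ?case
    proof (cases "Suc j + n < Suc i + k \<or> i \<le> p + Suc j")
      case True
      then show ?thesis
        using Tlo[of "Suc j" "Suc i"] Thi[of i "Suc j"] lo_le[of "Suc j" i] le_hi[of "Suc j" "Suc i"] Suc.prems by auto
    next
      case False
      then obtain i' where i': "i = Suc i'" "p \<le> i'" "i' < n" using Suc.prems by (cases i) auto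
      have "T j i \<le> T j i'" using Suc.IH[of i'] Suc.prems i' by simp
      moreover have "T (Suc j) (Suc i) = max (\<theta> (t (Suc j) (Suc i)) (Suc i)) (T j i)"
        "T (Suc j) i = max (\<theta> (t (Suc j) i) i) (T j i')"
        using False i' by (simp_all add: TS)
      ultimately show ?thesis using thr[OF Suc.prems] by (simp add: max.coboundedI1 max.coboundedI2)
    qed
  qed
  have inter: "T j i \<le> T (Suc j) (Suc i)" if "Suc j < k" "p \<le> i" "i < n" for j i
  proof -
    consider "Suc j + n < Suc i + k" | "Suc i \<le> p + Suc j" | "\<not> Suc j + n < Suc i + k" "\<not> Suc i \<le> p + Suc j" by blast
    then show ?thesis
    proof cases
      case 1 then show ?thesis using Tlo[of "Suc j" "Suc i"] Tlo[of j i] by simp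
    next
      case 2 then show ?thesis using Thi[of "Suc i" "Suc j"] le_hi[of j i] that by simp
    next
      case 3 then show ?thesis by (simp add: TS)
    qed
  qed
  have arr: "T \<in> arrays n p k (lo x) (hi y)"
    unfolding arrays_def using Tlo Thi anti inter by auto
  have "increments (u (Suc i)) (\<Union>j<k. {t j (Suc i)..t j i}) \<le> (\<Sum>j<k. H (Suc i) (T j i) - H (Suc i) (T j (Suc i)))"
    if i: "p \<le> i" "i < n" for i
  proof -
    \<comment> \<open>The first \<open>s\<close> paths only touch line \<open>i + 1\<close> at time
      \<open>x\<close>, and their lifts carry no weight there. The chain of intervals has to begin
      with path \<open>s\<close>; otherwise the jump at \<open>x\<close> would be credited to a
      degenerate interval.\<close>
    define s where "s = i + k - n"
    have s: "s < k" using i p by (auto simp: s_def)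
    let ?a = "\<lambda>j. t j (Suc i)" and ?b = "\<lambda>j. t j i" and ?g = "u (Suc i)"
    let ?e = "\<lambda>j. if s < j \<and> ?a j = ?b (j - 1) then ?g (?a j) else left_lim ?g (?a j)"
    have early: "?b j = x" "?a j = x" "T j i = lo x" "T j (Suc i) = lo x" if "j < s" for j
    proof -
      have j: "j < k" "j + n < i + k" using that s by (auto simp: s_def)
      show "?b j = x" "?a j = x" using arrays_start[OF t _ _ j(1)] j i by auto
      show "T j i = lo x" "T j (Suc i) = lo x" using j by (auto intro: Tlo)
    qed
    have as: "?a s = x" if "0 < s" using that i by (intro arrays_start[OF t _ _ s]) (auto simp: s_def)
    have "(\<Union>j<k. {?a j..?b j}) = (\<Union>j\<in>{s..k - 1}. {?a j..?b j})"
    proof -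
      have "{?a j..?b j} \<subseteq> {?a s..?b s}" if "j < s" for j
        using early[OF that] as that arraysD(3)[OF t s, of i] i by auto
      moreover have "s \<in> {s..k - 1}" using s by simp
      ultimately have "{?a j..?b j} \<subseteq> (\<Union>j\<in>{s..k - 1}. {?a j..?b j})" if "j < k" for j
        using that by (cases "j < s") (blast, force)
      then show ?thesis using s by (intro antisym UN_least UN_mono) auto
    qed
    then have "increments ?g (\<Union>j<k. {?a j..?b j}) = (\<Sum>j=s..k - 1. ?g (?b j) - ?e j)"
      using s i arraysD(3,4)[OF t] increments_chain[of s "k - 1" ?a ?b ?g] by simp
    also have "\<dots> \<le> (\<Sum>j=s..k - 1. H (Suc i) (T j i) - H (Suc i) (T j (Suc i)))"
    proof (rule sum_mono)
      fix j assume "j \<in> {s..k - 1}"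
      then have j: "j < k" "s \<le> j" using s by auto
      have nj: "\<not> j + n < i + k" using j by (auto simp: s_def)
      have a0: "0 \<le> ?a j" "?a j \<le> y" using t0[OF j(1)] tr[OF j(1)] i by simp_all
      have b0: "0 \<le> ?b j" "?b j \<le> y" using t0[OF j(1)] tr[OF j(1)] i by simp_all
      have ua: "?g (?a j) = H (Suc i) (hi (?a j))" "left_lim ?g (?a j) = H (Suc i) (lo (?a j))"
        using u[of "Suc i" "?a j"] a0 i by auto
      have ub: "?g (?b j) = H (Suc i) (hi (?b j))" using u[of "Suc i" "?b j"] b0 i by auto
      have "H (Suc i) (T j i) = H (Suc i) (hi (?b j))"
        using \<theta>(4)[OF b0(1) i(2) reT] post[of j i] nj j i by simp
      moreover have "H (Suc i) (T j (Suc i)) \<le> ?e j"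
      proof (cases "s < j \<and> ?a j = ?b (j - 1)")
        case True
        have "H (Suc i) (T j (Suc i)) \<le> H (Suc i) (hi (?a j))"
          using reT[of j "Suc i"] j i a0 by (intro staged_tuple_mono[OF H]) auto
        then show ?thesis using True ua by simp
      next
        case False
        \<comment> \<open>Unless the previous path leaves the line at this very time, the lifted
          path enters before the line rises and collects the whole jump.\<close>
        have "T j (Suc i) \<le> \<theta> (?a j) (Suc i)"
        proof (cases "j + n < Suc i + k")
          case True
          then show ?thesis using Tlo[OF True] \<theta>(1)[OF a0(1), of "Suc i"] tr[of j "Suc i"] j i xy by simp
        next
          case nlo: False
          then have sj: "0 < j \<Longrightarrow> s < j" using j by (auto simp: s_def)
          have nhi: "\<not> Suc i \<le> p + j"
          proof
            assume h: "Suc i \<le> p + j"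
            then have "0 < j" using i by simp
            moreover have "?a j = y" using arrays_end[OF t j(1), of "Suc i"] h i by simp
            moreover have "?b (j - 1) = y" using arrays_end[OF t, of "j - 1" i] h i j \<open>0 < j\<close> by simp
            ultimately show False using False sj by simp
          qed
          show ?thesis
          proof (cases j)
            case 0
            then show ?thesis using nlo nhi by (simp add: T0)
          next
            case (Suc j')
            then have "?a j \<noteq> ?b j'" using False sj by simp
            moreover have "?b j' \<le> ?a j" using arraysD(4)[OF t, of j' i] Suc j i by simp
            ultimately have "re (T j' i) < re (\<theta> (?a j) (Suc i))"
              using reT[of j' i] \<theta>(1)[OF a0(1), of "Suc i"] Suc j i by simp
            then have "T j' i \<le> \<theta> (?a j) (Suc i)" by (intro less_imp_le re_less)
            then show ?thesis using nlo nhi Suc by (simp add: TS)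
          qed
        qed
        then have "H (Suc i) (T j (Suc i)) = H (Suc i) (lo (?a j))"
          using \<theta>(3)[OF a0(1) i(2) reT] j i by simp
        then show ?thesis using False ua by auto
      qed
      ultimately show "?g (?b j) - ?e j \<le> H (Suc i) (T j i) - H (Suc i) (T j (Suc i))"
        using ub by simp
    qed
    also have "\<dots> = (\<Sum>j<k. H (Suc i) (T j i) - H (Suc i) (T j (Suc i)))"
      using early s by (intro sum.mono_neutral_left) auto
    finally show ?thesis .
  qed
  then have "(\<Sum>i\<in>{p..<n}. increments (u (Suc i)) (\<Union>j<k. {t j (Suc i)..t j i})) \<le>
     (\<Sum>i\<in>{p..<n}. \<Sum>j<k. H (Suc i) (T j i) - H (Suc i) (T j (Suc i)))"
    by (intro sum_mono) auto
  also have "\<dots> = weight H n p k T" unfolding weight_def by (rule sum.swap)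
  finally have "df u (region n p k t) \<le> weight H n p k T" using df_region[OF t p(3), of u] by simp
  then show ?thesis using arr by blast
qed

text \<open>Both suprema are compared through sorted arrays of real times: lifting bounds the cadlag
  side, projection the continuous one.\<close>

lemma last_passage_pos_eq_lpp: "last_passage u k (x, n) (y, Suc p) = lpp H n p k (lo x) (hi y)"
proof -
  have c: "cont_tuple H" using H by (simp add: staged_tuple_def null_tuple_def)
  have lh: "lo x \<le> hi y" using xy by simp
  let ?D = "disjoint_path_tuples k (x, n) (y, Suc p)"
  have le: "df u (\<Union>j\<in>{1..k}. \<pi> j) \<le> lpp H n p k (lo x) (hi y)" if \<pi>: "\<pi> \<in> ?D" for \<pi>
  proof -
    obtain t where t: "t \<in> arrays n p k x y" "(\<Union>j\<in>{1..k}. \<pi> j) = region n p k t"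
      using disjoint_path_tuples_sorted[OF \<pi> xy(2) p(1)] by blast
    obtain T where "T \<in> arrays n p k (lo x) (hi y)" "df u (region n p k t) \<le> weight H n p k T"
      using arrays_lift[OF t(1)] by blast
    then show ?thesis using lpp_upper[OF c] t(2) by force
  qed
  have ge: "\<exists>\<pi>\<in>?D. weight H n p k T \<le> df u (\<Union>j\<in>{1..k}. \<pi> j)"
    if T: "T \<in> arrays n p k (lo x) (hi y)" for T
    by (rule bexI[OF _ arrays_disjoint_path_tuples(1)[OF arrays_project(1)[OF T]]])
      (unfold arrays_disjoint_path_tuples(2)[OF arrays_project(1)[OF T]], rule arrays_project(2)[OF T])
  have bdd: "bdd_above ((\<lambda>\<pi>. df u (\<Union>j\<in>{1..k}. \<pi> j)) ` ?D)" using le by (rule bdd_aboveI2)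
  have "lpp H n p k (lo x) (hi y) \<le> (SUP \<pi>\<in>?D. df u (\<Union>j\<in>{1..k}. \<pi> j))"
  proof (rule lpp_least[OF lh p(2)])
    fix T assume "T \<in> arrays n p k (lo x) (hi y)"
    then obtain \<pi> where "\<pi> \<in> ?D" "weight H n p k T \<le> df u (\<Union>j\<in>{1..k}. \<pi> j)" using ge by blast
    then show "weight H n p k T \<le> (SUP \<pi>\<in>?D. df u (\<Union>j\<in>{1..k}. \<pi> j))"
      using bdd by (intro cSUP_upper2)
  qed
  moreover have "(SUP \<pi>\<in>?D. df u (\<Union>j\<in>{1..k}. \<pi> j)) \<le> lpp H n p k (lo x) (hi y)"
  proof (rule cSUP_least)
    have "straight p (lo x) (hi y) \<in> arrays n p k (lo x) (hi y)" using p(2) by (intro straight_arrays[OF lh]) auto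
    then show "?D \<noteq> {}" using ge by blast
  qed (rule le)
  ultimately show ?thesis using p(3) by (simp add: last_passage_def)
qed

end

lemma lpp_0: "lpp H n p 0 a b = 0"
proof -
  have "arrays n p 0 a b = UNIV" by (simp add: arrays_def)
  then show ?thesis by (simp add: lpp_def weight_def)
qed

theorem last_passage_eq_lpp:
  assumes "staged_tuple n H" "0 \<le> x" "x \<le> y" "p < n" "p + k \<le> n"
    and "\<And>i z. i \<in> {1..n} \<Longrightarrow> 0 \<le> z \<Longrightarrow> z \<le> y \<Longrightarrow> u i z = H i (hi z) \<and> left_lim (u i) z = H i (lo z)"
  shows "last_passage u k (x, n) (y, Suc p) = lpp H n p k (lo x) (hi y)"
proof (cases "k = 0")
  case True then show ?thesis by (simp add: last_passage_def lpp_0)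
next
  case False then show ?thesis using assms by (intro last_passage_pos_eq_lpp) auto
qed

section \<open>The image of RSK\<close>

lemma staged_tuple_melon:
  assumes "staged_tuple n F" "d < n"
  shows "staged_tuple n (melon n d F)"
  using assms melon_null staged_melon unfolding staged_tuple_def by blast

section \<open>Tuples on \<open>{0..t}\<close> as continuous tuples on the stretched line\<close>

definition embed :: "nat \<Rightarrow> real \<Rightarrow> tuple \<Rightarrow> nat \<Rightarrow> lexline \<Rightarrow> real" where
  "embed n t f = stretch_tuple n (\<lambda>i x. f i (min x t))"

context
  fixes n :: nat and t :: real and f :: tuple
  assumes f: "f \<in> Dtuples n {0..t}" and t: "0 < t"
begin

lemma embed_null: "null_tuple (embed n t f)"
  unfolding embed_def using regular_restrict(1)[OF f _ t] by (intro stretch_tuple_null)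

lemma embed_standard: "standard n (embed n t f)"
  unfolding embed_def using regular_restrict(1)[OF f _ t] by (intro stretch_tuple_standard)

lemma embed_staged: "staged_tuple n (embed n t f)"
  using embed_null embed_standard standard_staged by (simp add: staged_tuple_def)

lemma embed_hi: "i \<in> {1..n} \<Longrightarrow> 0 \<le> x \<Longrightarrow> embed n t f i (hi x) = f i (min x t)"
  using stretch_hi[of i n x] by (simp add: embed_def stretch_tuple_def)

lemma embed_lo: "i \<in> {1..n} \<Longrightarrow> 0 \<le> x \<Longrightarrow> x \<le> t \<Longrightarrow> embed n t f i (lo x) = left_lim (f i) x"
  using stretch_lo[of i n x] regular_restrict(2)[OF f _ t, of i x] by (simp add: embed_def stretch_tuple_def)

lemma embed_lo_late: "i \<in> {1..n} \<Longrightarrow> t < x \<Longrightarrow> embed n t f i (lo x) = f i t"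
  using stretch_lo[of i n x] regular_restrict(3)[OF f _ t, of i x] t by (simp add: embed_def stretch_tuple_def)

lemma embed_boundary:
  "i \<in> {1..n} \<Longrightarrow> 0 \<le> z \<Longrightarrow> z \<le> t \<Longrightarrow> f i z = embed n t f i (hi z) \<and> left_lim (f i) z = embed n t f i (lo z)"
  using embed_hi[of i z] embed_lo[of i z] by simp

lemma embed_const: "const_after (hi t) (embed n t f)"
  unfolding const_after_def
proof (intro allI impI)
  fix i z assume z: "hi t \<le> z"
  show "embed n t f i z = embed n t f i (hi t)"
  proof (cases "i \<in> {1..n} \<and> hi t < z")
    case True
    then have "t < re z" using t by simp
    then have "stretch n i (\<lambda>x. f i (min x t)) z = f i t"
      using regular_restrict(3)[OF f _ t, of i "re z"] True by (simp add: stretch_def)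
    moreover have "embed n t f i z = stretch n i (\<lambda>x. f i (min x t)) z"
      using True by (simp add: embed_def stretch_tuple_def)
    ultimately show ?thesis using embed_hi[of i t] True t by simp
  next
    case False
    then show ?thesis using z by (cases "i \<in> {1..n}") (auto simp: embed_def stretch_tuple_def)
  qed
qed

end

section \<open>The constraints satisfied by \<open>W f\<close> and \<open>G f\<close>\<close>

context
  fixes n :: nat and t :: real and f :: tuple and F :: "nat \<Rightarrow> lexline \<Rightarrow> real"
  assumes F: "staged_tuple n F" and n: "1 \<le> n" and t: "0 < t"
    and fF: "\<And>i z. i \<in> {1..n} \<Longrightarrow> 0 \<le> z \<Longrightarrow> z \<le> t \<Longrightarrow> f i z = F i (hi z) \<and> left_lim (f i) z = F i (lo z)"
begin

lemma last_passage_eq_melon_sum: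
  assumes "p < n" "p + k \<le> n" "0 \<le> y" "y \<le> t"
  shows "last_passage f k (0, n) (y, Suc p) = (\<Sum>j<k. melon n (n - Suc p) F (Suc (p + j)) (hi y))"
proof -
  have "last_passage f k (0, n) (y, Suc p) = lpp F n p k (lo 0) (hi y)"
    using assms fF by (intro last_passage_eq_lpp F) auto
  also have "\<dots> = (\<Sum>j<k. melon n (n - Suc p) F (Suc (p + j)) (hi y))"
    unfolding lo_0 using F assms by (intro lpp_eq_melon_sum) (auto simp: staged_tuple_def)
  finally show ?thesis .
qed

lemma Wmap_eq_boundary: "Wmap n t f = boundary n {0..t} (melon n (n - 1) F)"
  unfolding Wmap_def boundary_def
proof (rule restrict_ext, rule restrict_ext)
  fix k y assume k: "k \<in> {1..n}" and y: "y \<in> {0..t}"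
  then obtain k' where k': "k = Suc k'" by (cases k) auto
  show "last_passage f k (0, n) (y, 1) - last_passage f (k - 1) (0, n) (y, 1) = melon n (n - 1) F k (hi y)"
    using last_passage_eq_melon_sum[of 0 k y] last_passage_eq_melon_sum[of 0 k' y] k y k' n by simp
qed

text \<open>The end line \<open>n - s + 1\<close> corresponds to \<open>p = n - s\<close>, hence to
  stage \<open>n - Suc p = s - 1\<close>; line \<open>i\<close> is counted from there.\<close>

lemma Gmap_eq_melon:
  assumes "1 \<le> i" "i \<le> s" "s \<le> n"
  shows "Gmap n t f i s = melon n (s - 1) F (n - s + i) (hi t)"
proof -
  obtain i' where i': "i = Suc i'" using assms by (cases i) auto
  have "n - Suc (n - s) = s - 1" using assms by simp
  then show ?thesis
    using last_passage_eq_melon_sum[of "n - s" i t] last_passage_eq_melon_sum[of "n - s" i' t] assms i' t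
    by (simp add: Gmap_def)
qed

text \<open>The order of the continuous melon alone does not compare a value with a left limit. It
  is evaluated at the threshold where line \<open>i + 1\<close> has finished its rise and line
  \<open>i\<close> has not begun; this is the reason for carrying \<open>staged\<close> through the
  insertion.\<close>

lemma Wmap_ordered: "Wmap n t f \<in> Dtuples_ordered n t"
proof -
  define K where "K = melon n (n - 1) F"
  have K: "staged_tuple n K" unfolding K_def using n by (intro staged_tuple_melon F) auto
  have W: "Wmap n t f = boundary n {0..t} K" by (simp add: Wmap_eq_boundary K_def)
  have "boundary n {0..t} K \<in> Dtuples n {0..t}" using t by (intro boundary_Dtuples K) auto
  moreover have "boundary n {0..t} K (i + 1) s \<le> left_lim (boundary n {0..t} K i) s"
    if s: "s \<in> {0..t}" and i: "1 \<le> i" "i \<le> n - 1" for s i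
  proof -
    obtain q where q: "i = Suc q" "Suc q < n" using i by (cases i) auto
    have s0: "0 \<le> s" using s by simp
    obtain \<theta> where \<theta>: "\<And>x i. 0 \<le> x \<Longrightarrow> i \<le> n \<Longrightarrow> re (\<theta> x i) = x"
      "\<And>x i. 0 \<le> x \<Longrightarrow> i < n \<Longrightarrow> \<theta> x (Suc i) \<le> \<theta> x i"
      "\<And>x i z. 0 \<le> x \<Longrightarrow> i < n \<Longrightarrow> re z = x \<Longrightarrow> z \<le> \<theta> x (Suc i) \<Longrightarrow> K (Suc i) z = K (Suc i) (lo x)"
      "\<And>x i z. 0 \<le> x \<Longrightarrow> i < n \<Longrightarrow> re z = x \<Longrightarrow> \<theta> x i \<le> z \<Longrightarrow> K (Suc i) z = K (Suc i) (hi x)"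
      using staged_thresholds[OF K] by blast
    have re_\<theta>: "re (\<theta> s i) = s" using \<theta>(1)[OF s0] q by simp
    have "K (Suc i) (hi s) = K (Suc i) (\<theta> s i)" using \<theta>(4)[OF s0 _ re_\<theta>, of i] q by simp
    also have "\<dots> \<le> K i (\<theta> s i)"
      unfolding K_def using F q n by (intro melon_ordered) (auto simp: staged_tuple_def)
    also have "\<dots> = K i (lo s)" using \<theta>(3)[OF s0 _ re_\<theta>, of q] q by simp
    also have "\<dots> = left_lim (boundary n {0..t} K i) s"
      using K s i by (intro boundary_left_lim[symmetric]) (auto simp: staged_tuple_def)
    finally have "K (Suc i) (hi s) \<le> left_lim (boundary n {0..t} K i) s" .
    then show ?thesis
    proof -
      have "boundary n {0..t} K (i + 1) s = K (Suc i) (hi s)" using s q by (simp add: boundary_def)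
      then show ?thesis using \<open>K (Suc i) (hi s) \<le> left_lim (boundary n {0..t} K i) s\<close> by simp
    qed
  qed
  ultimately show ?thesis unfolding Dtuples_ordered_def W by auto
qed

lemma Gmap_GTpatterns: "Gmap n t f \<in> GTpatterns n"
  unfolding GTpatterns_def
proof (intro CollectI conjI allI impI)
  show "Gmap n t f \<in> (\<Pi>\<^sub>E i\<in>{1..n}. {i..n} \<rightarrow>\<^sub>E UNIV)" by (auto simp: Gmap_def)
  fix i j assume "1 \<le> i \<and> i \<le> j - 1 \<and> j \<le> n"
  then have ij: "1 \<le> i" "i \<le> j - 1" "j \<le> n" "2 \<le> j" by auto
  obtain e where e: "j = Suc (Suc e)" using ij(4) by (metis add_2_eq_Suc le_Suc_ex)
  have null: "null_tuple F" using F by (simp add: staged_tuple_def)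
  define l where "l = n - j + i"
  have l: "n - (j - 1) + i = Suc l" "n - j + (i + 1) = Suc l" "n - Suc e \<le> l" "l < n" using ij e by (auto simp: l_def)
  have 1: "Gmap n t f i (j - 1) = melon n e F (Suc l) (hi t)"
    using Gmap_eq_melon[of i "j - 1"] ij e l by simp
  have 2: "Gmap n t f i j = melon n (Suc e) F l (hi t)"
    using Gmap_eq_melon[of i j] ij e by (simp add: l_def)
  have 3: "Gmap n t f (i + 1) j = melon n (Suc e) F (Suc l) (hi t)"
    using Gmap_eq_melon[of "i + 1" j] ij e l by simp
  show "Gmap n t f i (j - 1) \<le> Gmap n t f i j" "Gmap n t f (i + 1) j \<le> Gmap n t f i (j - 1)"
    unfolding 1 2 3 using melon_interlacing[OF null, of e n l "hi t"] l ij e by auto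
qed

lemma RSK_in_target: "RSK n t f \<in> RSKtarget n t"
proof -
  have "Wmap n t f i t = Gmap n t f i n" if "i \<in> {1..n}" for i
    using Gmap_eq_melon[of i n] that t unfolding Wmap_eq_boundary by (simp add: boundary_def)
  then show ?thesis using Wmap_ordered Gmap_GTpatterns by (simp add: RSKtarget_def RSK_def)
qed

end

text \<open>The target tuple \<open>w\<close> is embedded and the insertion undone, each row of
  \<open>g\<close> prescribing the final values of one stage. Since \<open>staged\<close> survives,
  the result can be read at block ends as a cadlag tuple.\<close>

lemma RSK_surj:
  assumes n: "1 \<le> n" and t: "0 < t" and "(w, g) \<in> RSKtarget n t"
  shows "\<exists>f\<in>Dtuples n {0..t}. RSK n t f = (w, g)"
proof -
  have w: "w \<in> Dtuples n {0..t}"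
    "\<And>s i. 0 \<le> s \<Longrightarrow> s \<le> t \<Longrightarrow> 1 \<le> i \<Longrightarrow> i < n \<Longrightarrow> w (Suc i) s \<le> left_lim (w i) s"
    using assms(3) unfolding RSKtarget_def Dtuples_ordered_def by auto
  have g: "g \<in> (\<Pi>\<^sub>E i\<in>{1..n}. {i..n} \<rightarrow>\<^sub>E (UNIV :: real set))"
    "\<And>i j. 1 \<le> i \<Longrightarrow> i \<le> j - 1 \<Longrightarrow> j \<le> n \<Longrightarrow> g i (j - 1) \<le> g i j \<and> g (i + 1) j \<le> g i (j - 1)"
    using assms(3) unfolding RSKtarget_def GTpatterns_def by auto
  have wg: "\<And>i. i \<in> {1..n} \<Longrightarrow> w i t = g i n" using assms(3) unfolding RSKtarget_def by auto
  define K where "K = embed n t w"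
  note Kf = embed_null[OF w(1) t] embed_const[OF w(1) t] embed_staged[OF w(1) t]
  \<comment> \<open>The comparison of \<open>w\<close> with left limits gives more than is claimed:
    in every block, line \<open>i + 1\<close> at the upper end is still below line \<open>i\<close>
    at the lower end.\<close>
  have ord: "K (Suc i) z \<le> K i z" if i: "1 \<le> i" "i < n" for i z
  proof -
    let ?x = "re z"
    have "K (Suc i) z \<le> K (Suc i) (hi ?x)"
      unfolding K_def using i by (intro staged_tuple_mono[OF Kf(3)]) auto
    also have "\<dots> = w (Suc i) (min ?x t)" unfolding K_def using i by (intro embed_hi[OF w(1) t]) auto
    also have "\<dots> \<le> K i (lo ?x)"
    proof (cases "?x \<le> t")
      case True
      then show ?thesis unfolding K_def
        using i w(2)[of ?x i] embed_lo[OF w(1) t, of i ?x] by simp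
    next
      case False
      have "left_lim (w i) t \<le> w i t" using w(1) i t unfolding Dtuples_def by auto
      then show ?thesis unfolding K_def
        using i w(2)[of t i] embed_lo_late[OF w(1) t, of i ?x] False t by simp
    qed
    also have "\<dots> \<le> K i z"
      unfolding K_def using i by (intro staged_tuple_mono[OF Kf(3)]) auto
    finally show ?thesis .
  qed
  \<comment> \<open>Row \<open>e + 1\<close> of the pattern, placed on the lines
    \<open>n - e\<close> to \<open>n\<close>; this inverts the index shift of
    \<open>Gmap_eq_melon\<close>.\<close>
  define \<gamma> where "\<gamma> e i = g (i + Suc e - n) (Suc e)" for e i
  have 1: "K i (hi t) = \<gamma> (n - 1) i" if "n - (n - 1) \<le> i" "i \<le> n" for i
    using embed_hi[OF w(1) t, of i t] wg[of i] that n t by (simp add: K_def \<gamma>_def)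
  have 2: "\<gamma> (Suc e) (Suc i) \<le> \<gamma> e (Suc i) \<and> \<gamma> e (Suc i) \<le> \<gamma> (Suc e) i"
    if "e < n - 1" "n - Suc e \<le> i" "i < n" for e i
  proof -
    define i' where "i' = i + Suc (Suc e) - n"
    have idx: "Suc i + Suc (Suc e) - n = i' + 1" "Suc i + Suc e - n = i'" "i + Suc (Suc e) - n = i'"
      "1 \<le> i'" "i' \<le> Suc (Suc e) - 1" "Suc (Suc e) \<le> n"
      using that by (auto simp: i'_def)
    show ?thesis using g(2)[OF idx(4,5,6)] unfolding \<gamma>_def idx by simp
  qed
  have "n - 1 < n" using n by simp
  moreover have "K (Suc i) z \<le> K i z" if "n - (n - 1) \<le> i" "i < n" for i z using ord that n by simp
  ultimately obtain F where F: "null_tuple F" "melon n (n - 1) F = K"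
    and F34: "(\<forall>e i. e \<le> n - 1 \<and> n - e \<le> i \<and> i \<le> n \<longrightarrow> melon n e F i (hi t) = \<gamma> e i) \<and>
      (\<forall>l h. staged n K l h \<longrightarrow> staged n F l h)"
    using melon_inverse[of K "hi t" "n - 1" n \<gamma>] Kf(1,2) 1 2 unfolding K_def by blast
  have Fs: "staged_tuple n F" using F(1) F34 Kf(3) unfolding staged_tuple_def K_def by blast
  define f where "f = boundary n {0..t} F"
  have f: "f \<in> Dtuples n {0..t}" unfolding f_def using t by (intro boundary_Dtuples Fs) auto
  have fF: "f i z = F i (hi z) \<and> left_lim (f i) z = F i (lo z)" if "i \<in> {1..n}" "0 \<le> z" "z \<le> t" for i z
  proof
    show "f i z = F i (hi z)" using that by (simp add: f_def boundary_def)
    have "{0..<z} \<subseteq> {0..t}" using that by auto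
    then show "left_lim (f i) z = F i (lo z)"
      unfolding f_def using that boundary_left_lim[OF F(1), of i n z "{0..t}"] by simp
  qed
  have W: "Wmap n t f = w"
  proof -
    have "Wmap n t f = boundary n {0..t} K" using Wmap_eq_boundary[OF Fs n t fF] F(2) by simp
    also have "\<dots> = w"
    proof (intro ext)
      fix i x
      have wE: "w \<in> {1..n} \<rightarrow>\<^sub>E ({0..t} \<rightarrow>\<^sub>E UNIV)" using w(1) by (simp add: Dtuples_def)
      show "boundary n {0..t} K i x = w i x"
      proof (cases "i \<in> {1..n}")
        case True
        have "w i \<in> {0..t} \<rightarrow>\<^sub>E UNIV" using wE True by (rule PiE_mem)
        then show ?thesis
          using True embed_hi[OF w(1) t True, of x] PiE_arb[of "w i" "{0..t}" _ x]
          by (cases "x \<in> {0..t}") (auto simp: boundary_def K_def)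
      next
        case False
        then show ?thesis using PiE_arb[OF wE False] by (auto simp: boundary_def)
      qed
    qed
    finally show ?thesis .
  qed
  have G: "Gmap n t f = g"
  proof (intro ext)
    fix i s
    show "Gmap n t f i s = g i s"
    proof (cases "i \<in> {1..n}")
      case True
      have gi: "g i \<in> {i..n} \<rightarrow>\<^sub>E UNIV" using PiE_mem[OF g(1) True] .
      show ?thesis
      proof (cases "s \<in> {i..n}")
        case s: True
        have "Gmap n t f i s = melon n (s - 1) F (n - s + i) (hi t)"
          using True s by (intro Gmap_eq_melon[OF Fs n t fF]) auto
        also have "\<dots> = \<gamma> (s - 1) (n - s + i)"
        proof -
          have "s - 1 \<le> n - 1 \<and> n - (s - 1) \<le> n - s + i \<and> n - s + i \<le> n" using True s by auto
          then show ?thesis using F34 by blast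
        qed
        also have "\<dots> = g i s"
        proof -
          have "n - s + i + Suc (s - 1) - n = i" "Suc (s - 1) = s" using True s by auto
          then show ?thesis by (simp only: \<gamma>_def)
        qed
        finally show ?thesis .
      next
        case False
        then show ?thesis using PiE_arb[OF gi False] True by (auto simp: Gmap_def)
      qed
    next
      case False
      then show ?thesis using PiE_arb[OF g(1) False] by (auto simp: Gmap_def)
    qed
  qed
  show ?thesis using f W G by (intro bexI[of _ f]) (simp_all add: RSK_def)
qed

section \<open>Forcing paths by jumps after the horizon\<close>

text \<open>Line \<open>i\<close> receives a jump of size \<open>\<alpha> i\<close> at time \<open>t + i\<close>. Since paths move to lines of smaller
  index, a path can collect at most one of these jumps, and \<open>\<alpha>\<close> is so large that it is optimal for
  \<open>k\<close> paths to collect the \<open>k\<close> latest of them. Lines are counted from \<open>0\<close> in sums: line \<open>i+1\<close>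
  carries the summand \<open>Suc i\<close>.\<close>

definition jump :: "real \<Rightarrow> nat \<Rightarrow> real \<Rightarrow> real" where
  "jump t i x = (if t + real i \<le> x then 1 else 0)"

definition jump_line :: "nat \<Rightarrow> real \<Rightarrow> nat \<Rightarrow> lexline \<Rightarrow> real" where
  "jump_line n t = stretch_tuple n (jump t)"

definition extend :: "nat \<Rightarrow> real \<Rightarrow> real \<Rightarrow> tuple \<Rightarrow> nat \<Rightarrow> lexline \<Rightarrow> real" where
  "extend n t \<alpha> f i z = embed n t f i z + \<alpha> * (real i * jump_line n t i z)"

lemma left_lim_eventually_const:
  assumes "0 < x" "b < x" "\<And>y. b < y \<Longrightarrow> y < x \<Longrightarrow> g y = c"
  shows "left_lim g x = c"
proof (rule left_lim_tendsto[OF assms(1)], rule Lim_transform_eventually[OF tendsto_const])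
  show "\<forall>\<^sub>F y in at_left x. c = g y"
    unfolding eventually_at_left[OF assms(2)] using assms by (intro exI[of _ b]) auto
qed

lemma left_lim_jump:
  assumes "0 < t" "0 \<le> x"
  shows "left_lim (jump t i) x = (if t + real i < x then 1 else 0)"
proof (cases "x = 0")
  case True then show ?thesis using assms by (simp add: left_lim_def)
next
  case False
  then have x: "0 < x" using assms by simp
  show ?thesis
  proof (cases "t + real i < x")
    case True
    have "left_lim (jump t i) x = 1"
      by (rule left_lim_eventually_const[OF x True]) (simp add: jump_def)
    then show ?thesis using True by simp
  next
    case False
    have "left_lim (jump t i) x = 0"
      by (rule left_lim_eventually_const[OF x x]) (use False in \<open>simp add: jump_def\<close>)
    then show ?thesis using False by simp
  qed
qed

lemma jump_regular:
  assumes "0 < t"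
  shows "regular (jump t i)"
  unfolding regular_def
proof (intro conjI allI impI)
  fix x :: real assume x: "0 \<le> x"
  show "left_lim (jump t i) x \<le> jump t i x" using assms x by (simp add: left_lim_jump jump_def)
  define b where "b = (if t + real i \<le> x then x + 1 else t + real i)"
  have b: "x < b" "\<And>y. x < y \<Longrightarrow> y < b \<Longrightarrow> jump t i x = jump t i y" by (auto simp: b_def jump_def)
  show "(jump t i \<longlongrightarrow> jump t i x) (at_right x)"
  proof (rule Lim_transform_eventually[OF tendsto_const])
    show "\<forall>\<^sub>F y in at_right x. jump t i x = jump t i y"
      unfolding eventually_at_right[OF b(1)] using b by blast
  qed
next
  fix x :: real assume x: "0 < x"
  define b where "b = (if t + real i < x then t + real i else 0)"
  have b: "b < x" "\<And>y. b < y \<Longrightarrow> y < x \<Longrightarrow> (if t + real i < x then 1 else 0) = jump t i y"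
    using x by (auto simp: b_def jump_def)
  have "(jump t i \<longlongrightarrow> (if t + real i < x then 1 else 0)) (at_left x)"
  proof (rule Lim_transform_eventually[OF tendsto_const])
    show "\<forall>\<^sub>F y in at_left x. (if t + real i < x then 1 else 0) = jump t i y"
      unfolding eventually_at_left[OF b(1)] using b by blast
  qed
  then show "\<exists>l. (jump t i \<longlongrightarrow> l) (at_left x)" ..
qed

text \<open>Exchange argument: members of \<open>I\<close> outside the top range weigh at most
  \<open>M\<close>, missing members of that range at least \<open>M + 1\<close>, and at least as
  many are missing as lie outside. The gap of one unit, multiplied by \<open>\<alpha>\<close>, makes
  any other choice of jumps unprofitable.\<close>

lemma sum_largest:
  fixes I :: "nat set"
  assumes "finite I" "I \<subseteq> {c..<d}" "card I \<le> k"
  defines "M \<equiv> max c (d - k)"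
  shows "sum Suc I \<le> sum Suc {M..<d}" "I \<noteq> {M..<d} \<Longrightarrow> sum Suc I + 1 \<le> sum Suc {M..<d}"
proof -
  let ?S = "{M..<d}"
  have sp: "sum Suc I = sum Suc (I \<inter> ?S) + sum Suc (I - ?S)" "sum Suc ?S = sum Suc (I \<inter> ?S) + sum Suc (?S - I)"
    using assms(1) sum.Int_Diff[of I Suc ?S] sum.Int_Diff[of ?S Suc I] by (auto simp: Int_commute)
  have card: "card (I - ?S) \<le> card (?S - I)"
  proof (cases "d - k \<le> c")
    case True
    then have "I - ?S = {}" using assms(2) by (auto simp: M_def)
    then show ?thesis by (simp only: card.empty le0)
  next
    case False
    then have "card ?S = k" by (auto simp: M_def)
    moreover have "card I = card (I \<inter> ?S) + card (I - ?S)" "card ?S = card (I \<inter> ?S) + card (?S - I)"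
      using assms(1) by (metis card_Int_Diff, metis card_Int_Diff finite_atLeastLessThan Int_commute)
    ultimately show ?thesis using assms(3) by simp
  qed
  have 1: "sum Suc (I - ?S) \<le> card (I - ?S) * M"
  proof -
    have "Suc i \<le> M" if "i \<in> I - ?S" for i using that assms(2) by fastforce
    then show ?thesis using sum_bounded_above[of "I - ?S" Suc M] by simp
  qed
  have 2: "card (?S - I) * M + card (?S - I) \<le> sum Suc (?S - I)"
    using sum_bounded_below[of "?S - I" "Suc M" Suc] by simp
  have 3: "card (I - ?S) * M \<le> card (?S - I) * M" using card by simp
  show "sum Suc I \<le> sum Suc ?S" using 1 2 3 sp by linarith
  assume ne: "I \<noteq> ?S"
  have "?S - I \<noteq> {}"
  proof
    assume SI: "?S - I = {}"
    then have "card (?S - I) = 0" by (simp only: card.empty)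
    then have "card (I - ?S) = 0" using card by linarith
    then have "I - ?S = {}" using card_0_eq[of "I - ?S"] assms(1) by blast
    then show False using ne SI by blast
  qed
  then have "0 < card (?S - I)" by (simp add: card_gt_0_iff)
  then show "sum Suc I + 1 \<le> sum Suc ?S" using 1 2 3 sp by linarith
qed

lemma sum_shift_lessThan: "(\<Sum>j<k. \<phi> (c + j)) = sum \<phi> {c..<c + k}" for \<phi> :: "nat \<Rightarrow> real"
  by (induction k) auto

lemma lpp_cong:
  assumes "\<And>i z. i \<in> {Suc p..n} \<Longrightarrow> a \<le> z \<Longrightarrow> z \<le> b \<Longrightarrow> F i z = G i z"
  shows "lpp F n p k a b = lpp G n p k a b"
proof -
  have "weight F n p k T = weight G n p k T" if T: "T \<in> arrays n p k a b" for T
    unfolding weight_def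
    using assms arrays_range[OF T] by (intro sum.cong arg_cong2[where f="(-)"] refl) auto
  then show ?thesis by (simp add: lpp_def cong: image_cong)
qed

text \<open>No path enters the lines up to \<open>p\<close> before \<open>B\<close>, and after
  \<open>B\<close> nothing changes. Cutting all turning times at \<open>B\<close> therefore keeps
  the weight and gives paths in the lines \<open>p + 1\<close> to \<open>n\<close>.\<close>

lemma arrays_truncate:
  fixes F :: "nat \<Rightarrow> 'a::linorder \<Rightarrow> real"
  assumes T: "T \<in> arrays n 0 k a b" and "a \<le> B" "p \<le> n" and far: "\<And>j. j < k \<Longrightarrow> B \<le> T j p"
    and F: "const_after B F"
  shows "(\<lambda>j i. min (T j i) B) \<in> arrays n p k a B"
    and "weight F n 0 k T = weight F n p k (\<lambda>j i. min (T j i) B)"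
proof -
  show "(\<lambda>j i. min (T j i) B) \<in> arrays n p k a B"
    unfolding arrays_def
  proof (intro CollectI conjI allI impI ballI)
    fix j assume j: "j < k"
    show "min (T j n) B = a" using arraysD(1)[OF T j] \<open>a \<le> B\<close> by simp
    show "min (T j p) B = B" using far[OF j] by simp
    fix i assume "i \<in> {p..<n}"
    then have "T j (Suc i) \<le> T j i" using arraysD(3)[OF T j, of i] by simp
    then show "min (T j (Suc i)) B \<le> min (T j i) B" by (rule min.mono) simp
  next
    fix j i assume "Suc j < k" "i \<in> {p..<n}"
    then have "T j i \<le> T (Suc j) (Suc i)" using arraysD(4)[OF T, of j i] by simp
    then show "min (T j i) B \<le> min (T (Suc j) (Suc i)) B" by (rule min.mono) simp
  qed
  have Fm: "F i (min z B) = F i z" for i z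
    using F unfolding const_after_def by (metis linear min.absorb1 min.absorb2)
  have "(\<Sum>i\<in>{0..<n}. F (Suc i) (T j i) - F (Suc i) (T j (Suc i))) =
     (\<Sum>i\<in>{p..<n}. F (Suc i) (T j i) - F (Suc i) (T j (Suc i)))" if j: "j < k" for j
  proof (rule sum.mono_neutral_right)
    show "\<forall>i\<in>{0..<n} - {p..<n}. F (Suc i) (T j i) - F (Suc i) (T j (Suc i)) = 0"
    proof
      fix i assume i: "i \<in> {0..<n} - {p..<n}"
      then have "B \<le> T j i" "B \<le> T j (Suc i)"
        using far[OF j] arrays_antimono[OF T j, of i p] arrays_antimono[OF T j, of "Suc i" p] \<open>p \<le> n\<close> by auto
      then have "F (Suc i) (T j i) = F (Suc i) B" "F (Suc i) (T j (Suc i)) = F (Suc i) B"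
        using F unfolding const_after_def by blast+
      then show "F (Suc i) (T j i) - F (Suc i) (T j (Suc i)) = 0" by simp
    qed
  qed auto
  then show "weight F n 0 k T = weight F n p k (\<lambda>j i. min (T j i) B)"
    unfolding weight_def Fm by (intro sum.cong[OF refl]) (simp only: lessThan_iff)
qed

section \<open>Jumps collected by a family of paths\<close>

context
  fixes n :: nat and t \<alpha> :: real and f :: tuple
  assumes f: "f \<in> Dtuples n {0..t}" and t: "0 < t" and \<alpha>: "0 \<le> \<alpha>"
begin

lemma jump_line_null: "null_tuple (jump_line n t)"
  unfolding jump_line_def using jump_regular[OF t] by (intro stretch_tuple_null)

lemma jump_line_standard: "standard n (jump_line n t)"
  unfolding jump_line_def using jump_regular[OF t] by (intro stretch_tuple_standard)

lemma jump_line_hi: "i \<in> {1..n} \<Longrightarrow> 0 \<le> x \<Longrightarrow> jump_line n t i (hi x) = (if t + real i \<le> x then 1 else 0)"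
  using stretch_hi[of i n x "jump t i"] by (simp add: jump_line_def stretch_tuple_def jump_def)

lemma jump_line_lo: "i \<in> {1..n} \<Longrightarrow> 0 \<le> x \<Longrightarrow> jump_line n t i (lo x) = (if t + real i < x then 1 else 0)"
  using stretch_lo[of i n x "jump t i"] left_lim_jump[OF t] by (simp add: jump_line_def stretch_tuple_def)

lemma jump_line_block:
  assumes "i \<in> {1..n}"
  shows "jump_line n t i (lo (re z)) \<le> jump_line n t i z" "jump_line n t i z \<le> jump_line n t i (hi (re z))"
proof -
  have "staged_tuple n (jump_line n t)" using jump_line_null jump_line_standard standard_staged by (simp add: staged_tuple_def)
  from staged_tuple_mono[OF this assms, of "lo (re z)" z] staged_tuple_mono[OF this assms, of z "hi (re z)"]
  show "jump_line n t i (lo (re z)) \<le> jump_line n t i z" "jump_line n t i z \<le> jump_line n t i (hi (re z))" by simp_all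
qed

lemma jump_line_before: "i \<in> {1..n} \<Longrightarrow> re z < t + real i \<Longrightarrow> jump_line n t i z = 0"
  using jump_line_block[of i z] jump_line_lo[of i "re z"] jump_line_hi[of i "re z"] by simp

lemma jump_line_after: "i \<in> {1..n} \<Longrightarrow> t + real i < re z \<Longrightarrow> jump_line n t i z = 1"
  using jump_line_block[of i z] jump_line_lo[of i "re z"] jump_line_hi[of i "re z"] by simp

lemma jump_line_mono:
  assumes "i \<in> {1..n}" "z \<le> w"
  shows "jump_line n t i z \<le> jump_line n t i w"
proof (cases "re z = re w")
  case True
  have "staged_tuple n (jump_line n t)" using jump_line_null jump_line_standard standard_staged by (simp add: staged_tuple_def)
  then show ?thesis using staged_tuple_mono[OF _ assms] True by blast
next
  case False
  then have "re z < re w" using re_mono[OF assms(2)] by simp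
  then show ?thesis
    using jump_line_block(2)[OF assms(1), of z] jump_line_block(1)[OF assms(1), of w] jump_line_hi[OF assms(1), of "re z"] jump_line_lo[OF assms(1), of "re w"]
    by (auto split: if_splits)
qed

lemma extend_staged: "staged_tuple n (extend n t \<alpha> f)"
proof -
  have c: "null_tuple (extend n t \<alpha> f)"
    using embed_null[OF f t] jump_line_null unfolding null_tuple_def extend_def
    by (auto intro!: continuous_on_add continuous_on_mult continuous_on_const)
  have "standard n (extend n t \<alpha> f)"
    unfolding standard_def
  proof (intro allI impI conjI)
    fix i z assume i: "i < n"
    note E = embed_standard[OF f t, unfolded standard_def, rule_format, OF i]
    note S = jump_line_standard[unfolded standard_def, rule_format, OF i]
    show "extend n t \<alpha> f (Suc i) z = extend n t \<alpha> f (Suc i) (lo (re z))" if "real n * sub z \<le> real (n - Suc i)"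
      unfolding extend_def using conjunct1[OF E] conjunct1[OF S] that by metis
    show "extend n t \<alpha> f (Suc i) z = extend n t \<alpha> f (Suc i) (hi (re z))" if "real (n - i) \<le> real n * sub z"
      unfolding extend_def using conjunct1[OF conjunct2[OF E]] conjunct1[OF conjunct2[OF S]] that by metis
    fix w assume w: "re w = re z \<and> sub z \<le> sub w"
    have "embed n t f (Suc i) z \<le> embed n t f (Suc i) w" "jump_line n t (Suc i) z \<le> jump_line n t (Suc i) w"
      using conjunct2[OF conjunct2[OF E]] conjunct2[OF conjunct2[OF S]] w by blast+
    then show "extend n t \<alpha> f (Suc i) z \<le> extend n t \<alpha> f (Suc i) w"
      unfolding extend_def using \<alpha> by (intro add_mono mult_left_mono) auto
  qed
  then show ?thesis using c standard_staged by (simp add: staged_tuple_def)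
qed

lemma extend_cont: "cont_tuple (extend n t \<alpha> f)" and embed_cont: "cont_tuple (embed n t f)"
  using extend_staged embed_null[OF f t] by (auto simp: staged_tuple_def null_tuple_def)

lemma extend_early: "i \<in> {1..n} \<Longrightarrow> z \<le> hi t \<Longrightarrow> extend n t \<alpha> f i z = embed n t f i z"
  using jump_line_before[of i z] t by (simp add: extend_def)

lemma weight_extend:
  "weight (extend n t \<alpha> f) n p k T = weight (embed n t f) n p k T +
     \<alpha> * (\<Sum>i\<in>{p..<n}. real (Suc i) * (\<Sum>j<k. jump_line n t (Suc i) (T j i) - jump_line n t (Suc i) (T j (Suc i))))"
proof -
  have "weight (extend n t \<alpha> f) n p k T = weight (embed n t f) n p k T +
     \<alpha> * (\<Sum>j<k. \<Sum>i\<in>{p..<n}. real (Suc i) * (jump_line n t (Suc i) (T j i) - jump_line n t (Suc i) (T j (Suc i))))"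
    unfolding weight_def sum_distrib_left sum.distrib[symmetric] extend_def
    by (intro sum.cong refl) (simp only: algebra_simps)
  also have "(\<Sum>j<k. \<Sum>i\<in>{p..<n}. real (Suc i) * (jump_line n t (Suc i) (T j i) - jump_line n t (Suc i) (T j (Suc i)))) =
     (\<Sum>i\<in>{p..<n}. real (Suc i) * (\<Sum>j<k. jump_line n t (Suc i) (T j i) - jump_line n t (Suc i) (T j (Suc i))))"
    unfolding sum_distrib_left by (rule sum.swap)
  finally show ?thesis .
qed

lemma jump_line_bounds:
  assumes "i \<in> {1..n}"
  shows "0 \<le> jump_line n t i z" "jump_line n t i z \<le> 1"
  using jump_line_block[OF assms, of z] jump_line_lo[OF assms, of "re z"] jump_line_hi[OF assms, of "re z"]
  by (auto split: if_splits)

text \<open>A stretched jump may be shared by several paths, \<open>q i\<close> being the total part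
  collected; increments over successive paths telescope, so \<open>q i \<le> 1\<close>. Each line of
  \<open>I\<close> is assigned a path that collects part of its jump, and this assignment is
  injective. If \<open>I\<close> has \<open>k\<close> members, it is onto, so every path
  collects.\<close>

lemma collected_jumps:
  assumes T: "T \<in> arrays n 0 k a b" and k: "0 < k"
  defines "q \<equiv> \<lambda>i. \<Sum>j<k. jump_line n t (Suc i) (T j i) - jump_line n t (Suc i) (T j (Suc i))"
  defines "I \<equiv> {i. i < n \<and> 0 < q i}"
  shows "(\<Sum>i\<in>{0..<n}. real (Suc i) * q i) \<le> real (sum Suc I)"
    and "card I \<le> k"
    and "i \<in> I \<Longrightarrow> i < n \<and> jump_line n t (Suc i) a < jump_line n t (Suc i) b"
    and "card I = k \<Longrightarrow> j < k \<Longrightarrow> \<exists>i\<in>I. t + real (Suc i) \<le> re (T j i)"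
proof -
  have pos: "0 \<le> jump_line n t (Suc i) (T j i) - jump_line n t (Suc i) (T j (Suc i))" if "j < k" "i < n" for i j
    using jump_line_mono[of "Suc i" "T j (Suc i)" "T j i"] arraysD(3)[OF T that(1), of i] that by simp
  have le: "q i \<le> jump_line n t (Suc i) b - jump_line n t (Suc i) a" if i: "i < n" for i
  proof -
    have part: "Suc m \<le> k \<Longrightarrow> (\<Sum>j<Suc m. jump_line n t (Suc i) (T j i) - jump_line n t (Suc i) (T j (Suc i))) \<le>
        jump_line n t (Suc i) (T m i) - jump_line n t (Suc i) a" for m
    proof (induction m)
      case 0
      have "a \<le> T 0 (Suc i)" using arrays_range(1)[OF T, of 0 "Suc i"] 0 i by simp
      then show ?case using jump_line_mono[of "Suc i" a "T 0 (Suc i)"] i by simp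
    next
      case (Suc m)
      have "jump_line n t (Suc i) (T m i) \<le> jump_line n t (Suc i) (T (Suc m) (Suc i))"
        using arraysD(4)[OF T, of m i] Suc.prems i by (intro jump_line_mono) auto
      then show ?case using Suc by simp
    qed
    obtain m where m: "k = Suc m" using k by (cases k) auto
    have "T m i \<le> b" using arrays_range(2)[OF T, of m i] i m by simp
    then have "jump_line n t (Suc i) (T m i) \<le> jump_line n t (Suc i) b" using i by (intro jump_line_mono) auto
    then show ?thesis using part[of m] m by (simp add: q_def)
  qed
  have q0: "0 \<le> q i" if "i < n" for i unfolding q_def using pos that by (intro sum_nonneg) auto
  have q1: "q i \<le> 1" if "i < n" for i
    using le[OF that] jump_line_bounds[of "Suc i" b] jump_line_bounds[of "Suc i" a] that by simp
  have finI: "finite I" by (simp add: I_def)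
  have "(\<Sum>i\<in>{0..<n}. real (Suc i) * q i) = (\<Sum>i\<in>I. real (Suc i) * q i)"
  proof (rule sum.mono_neutral_right)
    show "\<forall>i\<in>{0..<n} - I. real (Suc i) * q i = 0"
      using q0 by (force simp: I_def)
  qed (auto simp: I_def)
  also have "\<dots> \<le> (\<Sum>i\<in>I. real (Suc i) * 1)"
    using q1 by (intro sum_mono mult_left_mono) (auto simp: I_def)
  finally show "(\<Sum>i\<in>{0..<n}. real (Suc i) * q i) \<le> real (sum Suc I)" by simp
  have ex: "\<exists>j<k. jump_line n t (Suc i) (T j (Suc i)) < jump_line n t (Suc i) (T j i)" if "i \<in> I" for i
  proof (rule ccontr)
    assume "\<not> ?thesis"
    then have "q i \<le> 0" unfolding q_def by (intro sum_nonpos) force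
    then show False using that by (simp add: I_def)
  qed
  then have "\<forall>i\<in>I. \<exists>j. j < k \<and> jump_line n t (Suc i) (T j (Suc i)) < jump_line n t (Suc i) (T j i)" by blast
  from bchoice[OF this] obtain pick where
    "\<forall>i\<in>I. pick i < k \<and> jump_line n t (Suc i) (T (pick i) (Suc i)) < jump_line n t (Suc i) (T (pick i) i)" ..
  then have pick: "\<And>i. i \<in> I \<Longrightarrow> pick i < k"
     "\<And>i. i \<in> I \<Longrightarrow> jump_line n t (Suc i) (T (pick i) (Suc i)) < jump_line n t (Suc i) (T (pick i) i)" by simp_all
  have cross: "re (T (pick i) (Suc i)) \<le> t + real (Suc i)" "t + real (Suc i) \<le> re (T (pick i) i)" if "i \<in> I" for i
  proof -
    have i: "Suc i \<in> {1..n}" using that by (auto simp: I_def)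
    show "re (T (pick i) (Suc i)) \<le> t + real (Suc i)"
      using jump_line_after[OF i, of "T (pick i) (Suc i)"] jump_line_bounds(2)[OF i, of "T (pick i) i"] pick(2)[OF that]
      by (rule_tac ccontr) simp
    show "t + real (Suc i) \<le> re (T (pick i) i)"
      using jump_line_before[OF i, of "T (pick i) i"] jump_line_bounds(1)[OF i, of "T (pick i) (Suc i)"] pick(2)[OF that]
      by (rule_tac ccontr) simp
  qed
  \<comment> \<open>For \<open>i < i'\<close> a path visits line \<open>i' + 1\<close> before line
    \<open>i + 1\<close>, but the jump of line \<open>i' + 1\<close> happens later, so no path
    collects from both.\<close>
  have less: "pick i \<noteq> pick i'" if "i \<in> I" "i' \<in> I" "i < i'" for i i'
  proof
    assume eq: "pick i = pick i'"
    have "T (pick i) i' \<le> T (pick i) (Suc i)"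
      using arrays_antimono[OF T pick(1)[OF that(1)], of "Suc i" i'] that by (simp add: I_def)
    then have "re (T (pick i) i') \<le> re (T (pick i) (Suc i))" by (rule re_mono)
    then show False using cross(1)[OF that(1)] cross(2)[OF that(2)] eq that(3) by simp
  qed
  have inj: "inj_on pick I"
  proof (rule inj_onI)
    fix i i' assume "i \<in> I" "i' \<in> I" "pick i = pick i'"
    then show "i = i'" using less[of i i'] less[of i' i] by (cases i i' rule: linorder_cases) auto
  qed
  have sub: "pick ` I \<subseteq> {..<k}" using pick(1) by blast
  show "card I \<le> k" using card_inj_on_le[OF inj sub] by (simp only: finite_lessThan card_lessThan simp_thms)
  show "i < n \<and> jump_line n t (Suc i) a < jump_line n t (Suc i) b" if "i \<in> I"
  proof -
    have "i < n" "0 < q i" using that unfolding I_def by simp_all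
    then have "q i \<le> jump_line n t (Suc i) b - jump_line n t (Suc i) a" by (intro le)
    with \<open>0 < q i\<close> \<open>i < n\<close> show ?thesis by linarith
  qed
  assume "card I = k" "j < k"
  have "pick ` I = {..<k}"
    by (rule card_subset_eq[OF _ sub]) (simp_all add: card_image[OF inj] \<open>card I = k\<close>)
  then have "j \<in> pick ` I" using \<open>j < k\<close> by simp
  then obtain i where i: "j = pick i" "i \<in> I" by (rule imageE)
  show "\<exists>i\<in>I. t + real (Suc i) \<le> re (T j i)"
    by (rule bexI[OF _ i(2)]) (simp only: i(1) cross(2)[OF i(2)])
qed

text \<open>By time \<open>b\<close> exactly the lines \<open>1\<close> to \<open>d\<close> have
  jumped. If the paths collect the \<open>k\<close> latest of these, each of them stays in the lines
  above \<open>d - k\<close> until after \<open>t\<close>; any other choice loses at least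
  \<open>\<alpha>\<close>, which by \<open>gain\<close> outweighs what the additional lines can
  yield. For \<open>d \<le> k\<close> all jumps are available and no line is excluded.\<close>

lemma lpp_extend_after_horizon:
  assumes ab: "a \<le> hi t" "hi t \<le> b" and k: "0 < k" "k \<le> n" and d: "d \<le> n"
    and Jb: "\<And>i. i < n \<Longrightarrow> jump_line n t (Suc i) b = (if i < d then 1 else 0)"
    and gain: "0 < d - k \<Longrightarrow> lpp (embed n t f) n 0 k a (hi t) \<le> lpp (embed n t f) n (d - k) k a (hi t) + \<alpha>"
  shows "lpp (extend n t \<alpha> f) n 0 k a b = lpp (embed n t f) n (d - k) k a (hi t) + \<alpha> * real (sum Suc {d - k..<d})"
proof (rule antisym)
  define M where "M = d - k"
  have Mk: "M + k \<le> n" using d k by (auto simp: M_def)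
  show "lpp (extend n t \<alpha> f) n 0 k a b \<le> lpp (embed n t f) n (d - k) k a (hi t) + \<alpha> * real (sum Suc {d - k..<d})"
  proof (rule lpp_least)
    fix T assume T: "T \<in> arrays n 0 k a b"
    define q where "q i = (\<Sum>j<k. jump_line n t (Suc i) (T j i) - jump_line n t (Suc i) (T j (Suc i)))" for i
    define I where "I = {i. i < n \<and> 0 < q i}"
    note cj = collected_jumps[OF T k(1), folded q_def, folded I_def]
    have Id: "I \<subseteq> {0..<d}"
    proof
      fix i assume "i \<in> I"
      then have "i < n" "jump_line n t (Suc i) a < jump_line n t (Suc i) b" using cj(3) by auto
      then show "i \<in> {0..<d}" using Jb[of i] jump_line_bounds(1)[of "Suc i" a] by (auto split: if_splits)
    qed
    have finI: "finite I" by (simp add: I_def)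
    have w: "weight (extend n t \<alpha> f) n 0 k T \<le> weight (embed n t f) n 0 k T + \<alpha> * real (sum Suc I)"
      using weight_extend[of 0 k T] mult_left_mono[OF cj(1) \<alpha>] by (simp add: q_def)
    have w0: "weight (embed n t f) n 0 k T \<le> lpp (embed n t f) n 0 k a (hi t)"
      using arrays_truncate[OF T ab(1) _ _ embed_const[OF f t], of 0] arraysD(2)[OF T] ab(2)
        lpp_upper[OF embed_cont] by simp
    show "weight (extend n t \<alpha> f) n 0 k T \<le> lpp (embed n t f) n (d - k) k a (hi t) + \<alpha> * real (sum Suc {d - k..<d})"
    proof (cases "M = 0")
      case True
      have "sum Suc I \<le> sum Suc {M..<d}" using sum_largest(1)[OF finI Id cj(2)] by (simp add: M_def)
      then have "\<alpha> * real (sum Suc I) \<le> \<alpha> * real (sum Suc {M..<d})"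
        using \<alpha> by (intro mult_left_mono) (simp_all only: of_nat_le_iff)
      then show ?thesis using w w0 True by (simp add: M_def)
    next
      case False
      then have dk: "k < d" by (simp add: M_def)
      show ?thesis
      proof (cases "I = {M..<d}")
        case True
        then have card: "card I = k" using dk by (simp add: M_def)
        \<comment> \<open>As many collected jumps as paths: every path collects one in some line
          \<open>i + 1\<close> with \<open>i \<ge> M\<close>, so it is still above level
          \<open>M\<close> after time \<open>t\<close>.\<close>
        have far: "hi t \<le> T j M" if j: "j < k" for j
        proof -
          obtain i where i: "i \<in> I" "t + real (Suc i) \<le> re (T j i)" using cj(4)[OF card j] by blast
          then have "T j i \<le> T j M" using arrays_antimono[OF T j, of M i] True d by simp
          then have "t < re (T j M)" using re_mono[of "T j i" "T j M"] i(2) by simp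
          then show ?thesis using t by (simp add: less_imp_le)
        qed
        have "weight (embed n t f) n 0 k T \<le> lpp (embed n t f) n M k a (hi t)"
          using arrays_truncate[OF T ab(1) _ far embed_const[OF f t]] Mk lpp_upper[OF embed_cont] by simp
        then show ?thesis using w True by (simp add: M_def)
      next
        case ne: False
        \<comment> \<open>One unit of jump weight is lost, worth \<open>\<alpha>\<close>, which is
          what \<open>gain\<close> charges for the excluded lines.\<close>
        have "sum Suc I + 1 \<le> sum Suc {M..<d}"
          using sum_largest(2)[OF finI Id cj(2)] ne by (simp add: M_def)
        then have "real (sum Suc I) + 1 \<le> real (sum Suc {M..<d})"
          by (metis of_nat_1 of_nat_add of_nat_le_iff)
        then have "\<alpha> * (real (sum Suc I) + 1) \<le> \<alpha> * real (sum Suc {M..<d})" using \<alpha> by (rule mult_left_mono)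
        moreover have "weight (embed n t f) n 0 k T \<le> lpp (embed n t f) n M k a (hi t) + \<alpha>" using w0 gain False by (simp add: M_def)
        moreover have "\<alpha> * (real (sum Suc I) + 1) = \<alpha> * real (sum Suc I) + \<alpha>" by (simp only: distrib_left mult_1_right)
        ultimately show ?thesis using w by (simp only: M_def)
      qed
    qed
  qed (use ab k in auto)
  have "lpp (extend n t \<alpha> f) n M k a (hi t) = lpp (embed n t f) n M k a (hi t)"
    by (rule lpp_cong) (auto intro: extend_early)
  moreover have "lpp (extend n t \<alpha> f) n M k a (hi t) + (\<Sum>j<k. extend n t \<alpha> f (Suc (M + j)) b - extend n t \<alpha> f (Suc (M + j)) (hi t)) \<le> lpp (extend n t \<alpha> f) n 0 k a b"
    using ab Mk by (intro lpp_extend_end extend_cont) auto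
  moreover have "(\<Sum>j<k. extend n t \<alpha> f (Suc (M + j)) b - extend n t \<alpha> f (Suc (M + j)) (hi t)) = \<alpha> * real (sum Suc {M..<d})"
  proof -
    have "extend n t \<alpha> f (Suc i) b - extend n t \<alpha> f (Suc i) (hi t) = (if i < d then \<alpha> * real (Suc i) else 0)" if "i < n" for i
    proof -
      have "embed n t f (Suc i) b = embed n t f (Suc i) (hi t)" using embed_const[OF f t] ab(2) unfolding const_after_def by blast
      moreover have "jump_line n t (Suc i) (hi t) = 0" using that t by (intro jump_line_before) auto
      ultimately show ?thesis using Jb[OF that] by (simp add: extend_def)
    qed
    then have "(\<Sum>j<k. extend n t \<alpha> f (Suc (M + j)) b - extend n t \<alpha> f (Suc (M + j)) (hi t)) =
       (\<Sum>j<k. if M + j < d then \<alpha> * real (Suc (M + j)) else 0)"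
      using Mk by (intro sum.cong) auto
    also have "\<dots> = (\<Sum>i\<in>{M..<M + k}. if i < d then \<alpha> * real (Suc i) else 0)" by (rule sum_shift_lessThan)
    also have "\<dots> = (\<Sum>i\<in>{M..<d}. \<alpha> * real (Suc i))"
      by (intro sum.mono_neutral_cong_right) (auto simp: M_def)
    finally show ?thesis by (simp add: sum_distrib_left)
  qed
  ultimately show "lpp (embed n t f) n (d - k) k a (hi t) + \<alpha> * real (sum Suc {d - k..<d}) \<le> lpp (extend n t \<alpha> f) n 0 k a b"
    by (simp add: M_def)
qed

end

text \<open>Along the last row entries decrease, and along the diagonal direction
  \<open>(i,j)\<close>, \<open>(i+1,j+1)\<close> they decrease as well, which leads every entry down
  to the last row.\<close>

lemma GT_bound:
  assumes g: "g \<in> GTpatterns n" and ij: "1 \<le> i" "i \<le> j" "j \<le> n"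
  shows "g i n \<le> g 1 n" "g n n \<le> g i j"
proof -
  have GT: "g i (j - 1) \<le> g i j" "g (i + 1) j \<le> g i (j - 1)" if "1 \<le> i" "i \<le> j - 1" "j \<le> n" for i j
    using g that unfolding GTpatterns_def by auto
  have dec: "g l n \<le> g i n" if "i \<le> l" "1 \<le> i" "l \<le> n" for i l
    using that(1,3)
  proof (induction l rule: dec_induct)
    case (step m)
    have "g (Suc m) n \<le> g m n" using GT[of m n] step that(2) by force
    then show ?case using step by simp
  qed simp
  show "g i n \<le> g 1 n" using dec[of 1 i] ij by simp
  have "g (i + (n - j)) n \<le> g i j"
    using ij(3,1,2)
  proof (induction j arbitrary: i rule: inc_induct)
    case (step m)
    have "g (Suc i + (n - Suc m)) n \<le> g (Suc i) (Suc m)" using step by (intro step.IH) auto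
    moreover have "g (i + 1) (Suc m) \<le> g i m" using GT(2)[of i "Suc m"] step by simp
    moreover have "Suc i + (n - Suc m) = i + (n - m)" using step by simp
    ultimately show ?case by (simp only: Suc_eq_plus1)
  qed simp
  moreover have "g n n \<le> g (i + (n - j)) n" using ij by (intro dec) auto
  ultimately show "g n n \<le> g i j" by simp
qed

section \<open>Last passage values of the continuation\<close>

context
  fixes n :: nat and t \<alpha> :: real and f :: tuple
  assumes f: "f \<in> Dtuples n {0..t}" and t: "0 < t" and \<alpha>: "0 \<le> \<alpha>"
    and gain: "\<And>M k. 0 < M \<Longrightarrow> 0 < k \<Longrightarrow> M + k \<le> n \<Longrightarrow>
      lpp (embed n t f) n 0 k bot (hi t) \<le> lpp (embed n t f) n M k bot (hi t) + \<alpha>"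
begin

text \<open>Here \<open>d\<close> counts the lines that have jumped by time \<open>y\<close>; it is
  the index of the step of \<open>Delta\<close> that contains \<open>y\<close>.\<close>

lemma lpp_extend_bot:
  assumes "t \<le> y" "0 < k" "k \<le> n"
  defines "d \<equiv> min n (nat \<lfloor>y - t\<rfloor>)"
  shows "lpp (extend n t \<alpha> f) n 0 k bot (hi y) =
    lpp (embed n t f) n (d - k) k bot (hi t) + \<alpha> * real (sum Suc {d - k..<d})"
proof (rule lpp_extend_after_horizon[OF f t \<alpha>])
  show "hi t \<le> hi y" using assms t by simp
  show "jump_line n t (Suc i) (hi y) = (if i < d then 1 else 0)" if "i < n" for i
  proof -
    have "t + real (Suc i) \<le> y \<longleftrightarrow> int (Suc i) \<le> \<lfloor>y - t\<rfloor>"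
      unfolding le_floor_iff by (simp add: algebra_simps)
    also have "\<dots> \<longleftrightarrow> i < d" using that by (auto simp: d_def)
    finally show ?thesis using jump_line_hi[OF f t \<alpha>, of "Suc i" y] that assms t by simp
  qed
  show "lpp (embed n t f) n 0 k bot (hi t) \<le> lpp (embed n t f) n (d - k) k bot (hi t) + \<alpha>" if "0 < d - k"
    using that assms by (intro gain) auto
qed (use assms in \<open>auto simp: d_def\<close>)

text \<open>All \<open>n\<close> jumps have happened by time \<open>s\<close>, so the
  \<open>k\<close> latest are those of the last \<open>k\<close> lines. For \<open>z \<le> t\<close>
  the paths are thereby confined to these lines from the start; for \<open>z > t\<close> only jumps
  contribute, and \<open>sum_largest\<close> settles which of the remaining ones are taken.\<close>

lemma lpp_extend_from:
  assumes s: "t + real n \<le> s" and z: "0 \<le> z" "z \<le> s" and k: "0 < k" "k \<le> n"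
  shows "lpp (extend n t \<alpha> f) n 0 k (lo z) (hi s) =
    (\<Sum>i\<in>{n - k..<n}. extend n t \<alpha> f (Suc i) (hi s) - extend n t \<alpha> f (Suc i) (lo z))"
proof -
  let ?E = "embed n t f" and ?X = "extend n t \<alpha> f" and ?J = "jump_line n t"
  have ts: "t \<le> s" using s by simp
  have Ec: "cont_tuple ?E"
    using embed_null[OF f t] by (auto simp: null_tuple_def)
  have Es: "?E i (hi s) = ?E i (hi t)" for i
    using ts t by (intro const_afterD[OF embed_const[OF f t]]) simp
  have Js: "?J (Suc i) (hi s) = 1" if "i < n" for i
    using jump_line_hi[OF f t \<alpha>, of "Suc i" s] that s t by simp
  show ?thesis
  proof (cases "z \<le> t")
    case True
    have early: "?J (Suc i) (lo z) = 0" if "i < n" for i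
      using jump_line_before[OF f t \<alpha>, of "Suc i" "lo z"] that True z t by simp
    \<comment> \<open>\<open>gain\<close> is only available from time \<open>bot\<close>. Straight
      paths in the last \<open>k\<close> lines are put in front of the given ones; for these lines
      the value is an exact increment by \<open>lpp_full\<close>, so the initial part
      cancels.\<close>
    have g: "lpp ?E n 0 k (lo z) (hi t) \<le> lpp ?E n (n - k) k (lo z) (hi t) + \<alpha>" if "0 < n - k"
    proof -
      have zt: "bot \<le> lo z" "lo z \<le> hi t" using True z t by simp_all
      have "(\<Sum>j<k. ?E (Suc (n - k + j)) (lo z) - ?E (Suc (n - k + j)) bot) + lpp ?E n 0 k (lo z) (hi t)
          \<le> lpp ?E n 0 k bot (hi t)"
        using k by (intro lpp_extend_start[OF Ec zt]) simp
      also have "\<dots> \<le> lpp ?E n (n - k) k bot (hi t) + \<alpha>" using that k by (intro gain) auto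
      also have "lpp ?E n (n - k) k bot (hi t) =
          (\<Sum>j<k. ?E (Suc (n - k + j)) (hi t) - ?E (Suc (n - k + j)) bot)"
        using k by (intro lpp_full[OF Ec]) auto
      finally have "lpp ?E n 0 k (lo z) (hi t) \<le>
          (\<Sum>j<k. ?E (Suc (n - k + j)) (hi t) - ?E (Suc (n - k + j)) (lo z)) + \<alpha>"
        by (simp add: sum_subtractf)
      also have "(\<Sum>j<k. ?E (Suc (n - k + j)) (hi t) - ?E (Suc (n - k + j)) (lo z)) = lpp ?E n (n - k) k (lo z) (hi t)"
        using k zt by (intro lpp_full[OF Ec, symmetric]) auto
      finally show ?thesis .
    qed
    have "lpp ?X n 0 k (lo z) (hi s) = lpp ?E n (n - k) k (lo z) (hi t) + \<alpha> * real (sum Suc {n - k..<n})"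
      using True z t ts k g Js by (intro lpp_extend_after_horizon[OF f t \<alpha>]) auto
    also have "lpp ?E n (n - k) k (lo z) (hi t) = (\<Sum>j<k. ?E (Suc (n - k + j)) (hi t) - ?E (Suc (n - k + j)) (lo z))"
      using k True z t by (intro lpp_full[OF Ec]) auto
    also have "\<dots> = (\<Sum>i\<in>{n - k..<n}. ?E (Suc i) (hi t) - ?E (Suc i) (lo z))"
      using sum_shift_lessThan[of "\<lambda>i. ?E (Suc i) (hi t) - ?E (Suc i) (lo z)" "n - k" k] k by simp
    also have "\<alpha> * real (sum Suc {n - k..<n}) = (\<Sum>i\<in>{n - k..<n}. \<alpha> * real (Suc i))"
      by (simp add: sum_distrib_left)
    finally have "lpp ?X n 0 k (lo z) (hi s) =
      (\<Sum>i\<in>{n - k..<n}. ?E (Suc i) (hi t) - ?E (Suc i) (lo z) + \<alpha> * real (Suc i))"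
      by (simp only: sum.distrib)
    also have "\<dots> = (\<Sum>i\<in>{n - k..<n}. ?X (Suc i) (hi s) - ?X (Suc i) (lo z))"
      using Es Js early by (intro sum.cong) (simp_all add: extend_def)
    finally show ?thesis .
  next
    case False
    then have tz: "hi t \<le> lo z" using t by (simp add: less_imp_le)
    have Xc: "cont_tuple ?X" by (rule extend_cont[OF f t \<alpha>])
    have zs: "lo z \<le> hi s" using z by simp
    \<comment> \<open>Number of indices \<open>i\<close> with \<open>t + real (Suc i) < z\<close>. A
      jump exactly at time \<open>z\<close> is still ahead, since paths start at
      \<open>lo z\<close>.\<close>
    define c where "c = nat \<lceil>z - t - 1\<rceil>"
    have c: "c \<le> i \<longleftrightarrow> z \<le> t + real (Suc i)" for i
      unfolding c_def nat_ceiling_le_eq by (simp add: algebra_simps)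
    have Jz: "?J (Suc i) (lo z) = (if c \<le> i then 0 else 1)" if "i < n" for i
      using jump_line_lo[OF f t \<alpha>, of "Suc i" z] that z(1) c[of i] by (simp add: not_less)
    have inc: "?X (Suc i) (hi s) - ?X (Suc i) (lo z) = (if c \<le> i then \<alpha> * real (Suc i) else 0)" if "i < n" for i
    proof -
      have "?E (Suc i) (lo z) = ?E (Suc i) (hi t)"
        by (rule const_afterD[OF embed_const[OF f t] tz])
      then show ?thesis using Es Js[OF that] Jz[OF that] by (simp add: extend_def)
    qed
    have val: "(\<Sum>i\<in>{n - k..<n}. ?X (Suc i) (hi s) - ?X (Suc i) (lo z)) = \<alpha> * real (sum Suc {max c (n - k)..<n})"
    proof -
      have "(\<Sum>i\<in>{n - k..<n}. ?X (Suc i) (hi s) - ?X (Suc i) (lo z)) =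
        (\<Sum>i\<in>{n - k..<n}. if c \<le> i then \<alpha> * real (Suc i) else 0)"
        using inc by (intro sum.cong) auto
      also have "\<dots> = (\<Sum>i\<in>{max c (n - k)..<n}. \<alpha> * real (Suc i))"
        by (intro sum.mono_neutral_cong_right) auto
      finally show ?thesis by (simp add: sum_distrib_left)
    qed
    show ?thesis
    proof (rule antisym)
      have "(\<Sum>j<k. ?X (Suc (n - k + j)) (hi s) - ?X (Suc (n - k + j)) (lo z)) \<le> lpp ?X n 0 k (lo z) (hi s)"
        using k by (intro lpp_straight[OF Xc zs]) auto
      then show "(\<Sum>i\<in>{n - k..<n}. ?X (Suc i) (hi s) - ?X (Suc i) (lo z)) \<le> lpp ?X n 0 k (lo z) (hi s)"
        using sum_shift_lessThan[of "\<lambda>i. ?X (Suc i) (hi s) - ?X (Suc i) (lo z)" "n - k" k] k by simp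
      show "lpp ?X n 0 k (lo z) (hi s) \<le> (\<Sum>i\<in>{n - k..<n}. ?X (Suc i) (hi s) - ?X (Suc i) (lo z))"
      proof (rule lpp_least[OF zs])
        fix T assume T: "T \<in> arrays n 0 k (lo z) (hi s)"
        define q where "q i = (\<Sum>j<k. ?J (Suc i) (T j i) - ?J (Suc i) (T j (Suc i)))" for i
        define I where "I = {i. i < n \<and> 0 < q i}"
        note cj = collected_jumps[OF f t \<alpha> T k(1), folded q_def, folded I_def]
        have Ic: "I \<subseteq> {c..<n}"
        proof
          fix i assume "i \<in> I"
          then have i: "i < n" "?J (Suc i) (lo z) < ?J (Suc i) (hi s)" using cj(3) by auto
          then show "i \<in> {c..<n}" using Jz[OF i(1)] Js[OF i(1)] by (auto split: if_splits)
        qed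
        have "?E i (T j l) = ?E i (hi t)" if "j < k" "l \<le> n" for i j l
        proof -
          have "lo z \<le> T j l" using arrays_range(1)[OF T that(1), of l] that(2) by simp
          then have "hi t \<le> T j l" using tz by (rule order_trans[rotated])
          then show ?thesis by (rule const_afterD[OF embed_const[OF f t]])
        qed
        then have "weight ?E n 0 k T = 0" unfolding weight_def by (simp add: sum.neutral)
        then have "weight ?X n 0 k T \<le> \<alpha> * real (sum Suc I)"
          using weight_extend[OF f t \<alpha>, of 0 k T] mult_left_mono[OF cj(1) \<alpha>] by (simp add: q_def)
        also have "\<dots> \<le> \<alpha> * real (sum Suc {max c (n - k)..<n})"
          using sum_largest(1)[OF _ Ic cj(2)] \<alpha> by (intro mult_left_mono) (simp_all only: of_nat_le_iff, simp add: I_def)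
        finally show "weight ?X n 0 k T \<le> (\<Sum>i\<in>{n - k..<n}. ?X (Suc i) (hi s) - ?X (Suc i) (lo z))"
          using val by simp
      qed (use k in simp)
    qed
  qed
qed

end

section \<open>Time reversal\<close>

lemma components_reflect:
  fixes S :: "real set"
  shows "components ((\<lambda>x. s - x) ` S) = (\<lambda>C. (\<lambda>x. s - x) ` C) ` components S"
proof -
  let ?r = "\<lambda>x::real. s - x"
  have inv: "?r ` ?r ` A = A" for A by (simp add: image_image)
  have conn: "connected (?r ` A)" if "connected A" for A
    using that by (intro connected_continuous_image continuous_intros)
  have half: "?r ` C \<in> components (?r ` S)" if "C \<in> components S" for C S
    unfolding in_components_maximal
  proof (intro conjI allI impI)
    note C = that[unfolded in_components_maximal]
    show "?r ` C \<noteq> {}" "?r ` C \<subseteq> ?r ` S" "connected (?r ` C)" using C conn by auto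
    fix D assume D: "D \<noteq> {} \<and> ?r ` C \<subseteq> D \<and> D \<subseteq> ?r ` S \<and> connected D"
    have "C \<subseteq> ?r ` D" using D image_mono[of "?r ` C" D ?r] by (simp only: inv)
    moreover have "?r ` D \<subseteq> S" using D image_mono[of D "?r ` S" ?r] by (simp only: inv)
    ultimately have "?r ` D = C"
      using C[THEN conjunct2, THEN conjunct2, THEN conjunct2, THEN spec, of "?r ` D"] D conn[of D] by simp
    then show "D = ?r ` C" using inv[of D] by simp
  qed
  show ?thesis
  proof (intro equalityI subsetI)
    fix D assume "D \<in> components (?r ` S)"
    then have "?r ` D \<in> components S" using half[of D "?r ` S"] by (simp only: inv)
    then have "?r ` ?r ` D \<in> (\<lambda>C. ?r ` C) ` components S" by (rule imageI)
    then show "D \<in> (\<lambda>C. ?r ` C) ` components S" by (simp only: inv)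
  next
    fix D assume "D \<in> (\<lambda>C. ?r ` C) ` components S"
    then show "D \<in> components (?r ` S)" using half by blast
  qed
qed

text \<open>Reversing time alone would make paths move towards larger lines; renumbering the lines
  as well turns their images into paths again.\<close>

definition reflect :: "nat \<Rightarrow> real \<Rightarrow> real \<times> nat \<Rightarrow> real \<times> nat" where
  "reflect n s = (\<lambda>(x, i). (s - x, n + 1 - i))"

lemma df_reflect:
  fixes U V :: tuple
  assumes A: "\<And>i. closed (slice A i)" "\<And>i. slice A i \<subseteq> {0..s}" "snd ` A \<subseteq> {1..n}"
    and UV: "\<And>i a b. i \<in> {1..n} \<Longrightarrow> 0 \<le> a \<Longrightarrow> a \<le> b \<Longrightarrow> b \<le> s \<Longrightarrow>
      V i b - left_lim (V i) a = U (n + 1 - i) (s - a) - left_lim (U (n + 1 - i)) (s - b)"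
  shows "df V A = df U (reflect n s ` A)"
proof -
  let ?r = "\<lambda>x::real. s - x"
  have sl: "slice (reflect n s ` A) (n + 1 - i) = ?r ` slice A i" if "i \<in> {1..n}" for i
  proof (intro equalityI subsetI)
    fix x assume "x \<in> slice (reflect n s ` A) (n + 1 - i)"
    then obtain y j where y: "(y, j) \<in> A" "x = s - y" "n + 1 - i = n + 1 - j"
      by (auto simp: slice_def reflect_def)
    moreover have "j \<in> {1..n}" using A(3) y(1) by force
    ultimately have "i = j" using that by auto
    then show "x \<in> ?r ` slice A i" using y by (auto simp: slice_def)
  qed (force simp: slice_def reflect_def)
  have inj: "inj_on (\<lambda>i. n + 1 - i) (snd ` A)"
    using A(3) by (intro inj_onI) force
  have "snd ` reflect n s ` A = (\<lambda>i. n + 1 - i) ` snd ` A"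
    by (force simp: reflect_def image_image case_prod_beta)
  then have "df U (reflect n s ` A) = (\<Sum>i\<in>snd ` A. \<Sum>C\<in>components (slice (reflect n s ` A) (n + 1 - i)).
      U (n + 1 - i) (Sup C) - left_lim (U (n + 1 - i)) (Inf C))"
    unfolding df_def using inj by (simp add: sum.reindex)
  also have "\<dots> = df V A"
    unfolding df_def
  proof (rule sum.cong[OF refl])
    fix i assume "i \<in> snd ` A"
    then have i: "i \<in> {1..n}" using A(3) by blast
    have injC: "inj_on (\<lambda>C. ?r ` C) (components (slice A i))"
      by (rule inj_onI) (simp add: inj_image_eq_iff inj_def)
    have "(\<Sum>C\<in>components (slice (reflect n s ` A) (n + 1 - i)). U (n + 1 - i) (Sup C) - left_lim (U (n + 1 - i)) (Inf C))
      = (\<Sum>C\<in>components (slice A i). U (n + 1 - i) (Sup (?r ` C)) - left_lim (U (n + 1 - i)) (Inf (?r ` C)))"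
      unfolding sl[OF i] components_reflect using injC by (simp add: sum.reindex)
    also have "\<dots> = (\<Sum>C\<in>components (slice A i). V i (Sup C) - left_lim (V i) (Inf C))"
    proof (rule sum.cong[OF refl])
      fix C assume C: "C \<in> components (slice A i)"
      have "closed C" using closed_components[OF A(1) C] .
      moreover have Cs: "C \<subseteq> {0..s}" using in_components_subset[OF C] A(2)[of i] by blast
      ultimately have "compact C" using compact_Int_closed[of "{0..s}" C] by (simp add: Int_absorb1)
      moreover have "connected C" using in_components_connected[OF C] .
      ultimately obtain a b where ab: "C = {a..b}" using connected_compact_interval_1[of C] by auto
      have le: "a \<le> b" using in_components_nonempty[OF C] ab by simp
      have "?r ` C = {s - b..s - a}" unfolding ab by (rule image_diff_atLeastAtMost)
      moreover have "0 \<le> a" "b \<le> s" using Cs ab le by auto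
      ultimately show "U (n + 1 - i) (Sup (?r ` C)) - left_lim (U (n + 1 - i)) (Inf (?r ` C)) = V i (Sup C) - left_lim (V i) (Inf C)"
        using UV[OF i, of a b] le ab by simp
    qed
    finally show "(\<Sum>C\<in>components (slice (reflect n s ` A) (n + 1 - i)). U (n + 1 - i) (Sup C) - left_lim (U (n + 1 - i)) (Inf C))
      = (\<Sum>C\<in>components (slice A i). V i (Sup C) - left_lim (V i) (Inf C))" .
  qed
  finally show ?thesis ..
qed

lemma paths_slice:
  assumes "\<pi> \<in> paths (a, n) (b, 1)"
  shows "closed (slice \<pi> i)" "slice \<pi> i \<subseteq> {a..b}" "snd ` \<pi> \<subseteq> {1..n}"
proof -
  obtain \<tau> where \<tau>: "\<tau> n = a" "\<tau> 0 = b" "\<And>i. i \<in> {1..n} \<Longrightarrow> \<tau> i \<le> \<tau> (i - 1)"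
    "\<pi> = (\<Union>i\<in>{1..n}. {\<tau> i..\<tau> (i - 1)} \<times> {i})"
    using assms unfolding paths_def by auto
  have anti: "\<tau> j \<le> \<tau> i" if "i \<le> j" "j \<le> n" for i j
    using that
  proof (induction j rule: dec_induct)
    case (step m)
    then show ?case using \<tau>(3)[of "Suc m"] by simp
  qed simp
  have sl: "slice \<pi> i = (if i \<in> {1..n} then {\<tau> i..\<tau> (i - 1)} else {})"
    by (auto simp: slice_def \<tau>(4))
  then show "closed (slice \<pi> i)" by simp
  show "slice \<pi> i \<subseteq> {a..b}"
  proof (cases "i \<in> {1..n}")
    case True
    then have "\<tau> n \<le> \<tau> i" "\<tau> (i - 1) \<le> \<tau> 0" by (auto intro!: anti)
    then show ?thesis using sl True \<tau>(1,2) by simp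
  next
    case False
    then show ?thesis by (auto simp: slice_def \<tau>(4))
  qed
  show "snd ` \<pi> \<subseteq> {1..n}" by (auto simp: \<tau>(4))
qed

lemma paths_reflect:
  assumes "\<pi> \<in> paths (a, n) (b, 1)"
  shows "reflect n s ` \<pi> \<in> paths (s - b, n) (s - a, 1)"
proof -
  obtain \<tau> where \<tau>: "\<tau> n = a" "\<tau> 0 = b" "\<And>i. i \<in> {1..n} \<Longrightarrow> \<tau> i \<le> \<tau> (i - 1)"
    "\<pi> = (\<Union>i\<in>{1..n}. {\<tau> i..\<tau> (i - 1)} \<times> {i})"
    using assms unfolding paths_def by auto
  define \<sigma> where "\<sigma> i = s - \<tau> (n - i)" for i
  have line: "reflect n s ` ({\<tau> i..\<tau> (i - 1)} \<times> {i}) = {\<sigma> (n + 1 - i)..\<sigma> (n + 1 - i - 1)} \<times> {n + 1 - i}"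
    if i: "i \<in> {1..n}" for i
  proof -
    have "n - (n + 1 - i) = i - 1" "n - (n + 1 - i - 1) = i" using i by auto
    then have eq: "{\<sigma> (n + 1 - i)..\<sigma> (n + 1 - i - 1)} = (\<lambda>x. s - x) ` {\<tau> i..\<tau> (i - 1)}"
      unfolding \<sigma>_def image_diff_atLeastAtMost by simp
    have "reflect n s ` (A \<times> {i}) = (\<lambda>x. s - x) ` A \<times> {n + 1 - i}" for A
      by (force simp: reflect_def)
    then show ?thesis unfolding eq .
  qed
  have lines: "(\<lambda>i. n + 1 - i) ` {1..n} = {1..n}"
  proof (intro equalityI subsetI)
    fix i assume "i \<in> {1..n}"
    then have "i = n + 1 - (n + 1 - i)" "n + 1 - i \<in> {1..n}" by auto
    then show "i \<in> (\<lambda>i. n + 1 - i) ` {1..n}" by (rule image_eqI)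
  qed auto
  have "reflect n s ` \<pi> = (\<Union>i\<in>{1..n}. reflect n s ` ({\<tau> i..\<tau> (i - 1)} \<times> {i}))"
    unfolding \<tau>(4) image_UN ..
  also have "\<dots> = (\<Union>i\<in>{1..n}. {\<sigma> (n + 1 - i)..\<sigma> (n + 1 - i - 1)} \<times> {n + 1 - i})"
    using line by (intro SUP_cong refl)
  also have "\<dots> = (\<Union>i\<in>(\<lambda>i. n + 1 - i) ` {1..n}. {\<sigma> i..\<sigma> (i - 1)} \<times> {i})" by simp
  finally have "reflect n s ` \<pi> = (\<Union>i\<in>{1..n}. {\<sigma> i..\<sigma> (i - 1)} \<times> {i})" unfolding lines .
  moreover have "\<sigma> i \<le> \<sigma> (i - 1)" if "i \<in> {1..n}" for i
  proof -
    have i: "n - (i - 1) \<in> {1..n}" "n - (i - 1) - 1 = n - i" using that by auto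
    show ?thesis using \<tau>(3)[OF i(1)] unfolding \<sigma>_def i(2) by linarith
  qed
  moreover have "\<sigma> n = s - b" "\<sigma> 0 = s - a" by (simp_all add: \<sigma>_def \<tau>)
  ultimately show ?thesis unfolding paths_def by (intro CollectI exI[of _ \<sigma>]) auto
qed

lemma reflect_reflect:
  assumes "snd ` A \<subseteq> {1..n}"
  shows "reflect n s ` reflect n s ` A = A"
proof -
  have "reflect n s (reflect n s z) = z" if "z \<in> A" for z
  proof -
    have "snd z \<in> {1..n}" using assms that by blast
    then show ?thesis by (auto simp: reflect_def case_prod_beta intro: prod_eqI)
  qed
  then show ?thesis by (simp add: image_image)
qed

lemma last_passage_reflect:
  fixes U V :: tuple
  assumes y: "0 \<le> y" "y \<le> s"
    and UV: "\<And>i a b. i \<in> {1..n} \<Longrightarrow> 0 \<le> a \<Longrightarrow> a \<le> b \<Longrightarrow> b \<le> s \<Longrightarrow>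
      V i b - left_lim (V i) a = U (n + 1 - i) (s - a) - left_lim (U (n + 1 - i)) (s - b)"
  shows "last_passage V k (0, n) (y, 1) = last_passage U k (s - y, n) (s, 1)"
proof -
  let ?D = "disjoint_path_tuples k (0, n) (y, 1)" and ?D' = "disjoint_path_tuples k (s - y, n) (s, 1)"
  let ?\<phi> = "reflect n s"
  have mem: "(\<lambda>j. ?\<phi> ` \<pi> j) \<in> disjoint_path_tuples k (s - b, n) (s - a, 1)"
    if "\<pi> \<in> disjoint_path_tuples k (a, n) (b, 1)" for \<pi> a b
    unfolding disjoint_path_tuples_def
  proof (intro CollectI conjI ballI impI)
    fix i assume i: "i \<in> {1..k}"
    then have pi: "\<pi> i \<in> paths (a, n) (b, 1)" using that unfolding disjoint_path_tuples_def by blast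
    then show "?\<phi> ` \<pi> i \<in> paths (s - b, n) (s - a, 1)" by (rule paths_reflect)
    fix j assume j: "j \<in> {1..k}" "i \<noteq> j"
    then have pj: "\<pi> j \<in> paths (a, n) (b, 1)" using that unfolding disjoint_path_tuples_def by blast
    have "inj_on ?\<phi> (\<pi> i \<union> \<pi> j)"
    proof (rule inj_onI)
      fix z w assume zw: "z \<in> \<pi> i \<union> \<pi> j" "w \<in> \<pi> i \<union> \<pi> j" "?\<phi> z = ?\<phi> w"
      have "snd z \<in> {1..n}" "snd w \<in> {1..n}"
        using zw paths_slice(3)[OF pi] paths_slice(3)[OF pj] by blast+
      then show "z = w" using zw(3) by (auto simp: reflect_def case_prod_beta intro!: prod_eqI)
    qed
    then have "?\<phi> ` \<pi> i \<inter> ?\<phi> ` \<pi> j = ?\<phi> ` (\<pi> i \<inter> \<pi> j)" by (simp add: inj_on_image_Int)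
    then show "finite (?\<phi> ` \<pi> i \<inter> ?\<phi> ` \<pi> j)" using that i j unfolding disjoint_path_tuples_def by simp
  qed
  have df: "df V (\<Union>j\<in>{1..k}. \<pi> j) = df U (\<Union>j\<in>{1..k}. ?\<phi> ` \<pi> j)" if \<pi>: "\<pi> \<in> ?D" for \<pi>
  proof -
    have p: "\<pi> j \<in> paths (0, n) (y, 1)" if "j \<in> {1..k}" for j
      using \<pi> that unfolding disjoint_path_tuples_def by blast
    have sl: "slice (\<Union>j\<in>{1..k}. \<pi> j) i = (\<Union>j\<in>{1..k}. slice (\<pi> j) i)" for i by (auto simp: slice_def)
    have "df V (\<Union>j\<in>{1..k}. \<pi> j) = df U (?\<phi> ` (\<Union>j\<in>{1..k}. \<pi> j))"
    proof (rule df_reflect[where s = s and n = n and V = V and U = U])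
      show "closed (slice (\<Union>j\<in>{1..k}. \<pi> j) i)" for i
        unfolding sl using paths_slice(1)[OF p] by (intro closed_UN) auto
      show "slice (\<Union>j\<in>{1..k}. \<pi> j) i \<subseteq> {0..s}" for i
        unfolding sl using paths_slice(2)[OF p] y(2) by (intro UN_least) (force simp: subset_iff)
      show "snd ` (\<Union>j\<in>{1..k}. \<pi> j) \<subseteq> {1..n}"
        unfolding image_UN by (intro UN_least paths_slice(3)[OF p])
    qed (rule UV)
    then show ?thesis by (simp only: image_UN)
  qed
  have "(\<lambda>\<pi>. df V (\<Union>j\<in>{1..k}. \<pi> j)) ` ?D = (\<lambda>\<pi>. df U (\<Union>j\<in>{1..k}. \<pi> j)) ` ?D'"
  proof (intro equalityI subsetI)
    fix r assume "r \<in> (\<lambda>\<pi>. df V (\<Union>j\<in>{1..k}. \<pi> j)) ` ?D"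
    then obtain \<pi> where "\<pi> \<in> ?D" "r = df V (\<Union>j\<in>{1..k}. \<pi> j)" by blast
    then show "r \<in> (\<lambda>\<pi>. df U (\<Union>j\<in>{1..k}. \<pi> j)) ` ?D'"
      using mem[of \<pi> 0 y] df[of \<pi>] by (intro image_eqI[of _ _ "\<lambda>j. ?\<phi> ` \<pi> j"]) simp_all
  next
    fix r assume "r \<in> (\<lambda>\<pi>. df U (\<Union>j\<in>{1..k}. \<pi> j)) ` ?D'"
    then obtain \<pi> where \<pi>: "\<pi> \<in> ?D'" "r = df U (\<Union>j\<in>{1..k}. \<pi> j)" by blast
    let ?\<rho> = "\<lambda>j. ?\<phi> ` \<pi> j"
    have \<rho>: "?\<rho> \<in> ?D" using mem[OF \<pi>(1)] by simp
    have "?\<phi> ` ?\<rho> j = \<pi> j" if "j \<in> {1..k}" for j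
    proof -
      have "\<pi> j \<in> paths (s - y, n) (s, 1)" using \<pi>(1) that unfolding disjoint_path_tuples_def by blast
      then show ?thesis by (intro reflect_reflect paths_slice(3))
    qed
    then have "(\<Union>j\<in>{1..k}. ?\<phi> ` ?\<rho> j) = (\<Union>j\<in>{1..k}. \<pi> j)" by (intro SUP_cong refl)
    then have "r = df V (\<Union>j\<in>{1..k}. ?\<rho> j)" using df[OF \<rho>] \<pi>(2) by simp
    then show "r \<in> (\<lambda>\<pi>. df V (\<Union>j\<in>{1..k}. \<pi> j)) ` ?D" using \<rho> by blast
  qed
  then show ?thesis unfolding last_passage_def by simp
qed

text \<open>As \<open>y\<close> increases to \<open>x\<close>, the time \<open>s - y\<close>
  decreases to \<open>s - x\<close>, so the lower block ends converge to the upper end of block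
  \<open>s - x\<close>.\<close>

lemma left_lim_reflected:
  assumes X: "continuous_on UNIV X" and x: "0 \<le> x" "x \<le> s"
    and g: "\<And>y. 0 \<le> y \<Longrightarrow> y < x \<Longrightarrow> g y = X (hi s) - X (lo (s - y))"
  shows "left_lim g x = X (hi s) - X (hi (s - x))"
proof (cases "x = 0")
  case True then show ?thesis by (simp add: left_lim_def)
next
  case False
  then have xp: "0 < x" using x by simp
  have "filterlim (\<lambda>y. s - y) (at_right (s - x)) (at_left x)"
    unfolding filterlim_at
  proof (intro conjI)
    show "((\<lambda>y. s - y) \<longlongrightarrow> s - x) (at_left x)" by (intro tendsto_intros)
    show "\<forall>\<^sub>F y in at_left x. s - y \<in> {s - x<..} \<and> s - y \<noteq> s - x"
      by (auto simp: eventually_at_filter)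
  qed
  moreover have "((\<lambda>y. X (lo y)) \<longlongrightarrow> X (hi (s - x))) (at_right (s - x))"
    using x by (intro tendsto_hi X) auto
  ultimately have "((\<lambda>y. X (lo (s - y))) \<longlongrightarrow> X (hi (s - x))) (at_left x)"
    by (rule filterlim_compose[rotated])
  then have "((\<lambda>y. X (hi s) - X (lo (s - y))) \<longlongrightarrow> X (hi s) - X (hi (s - x))) (at_left x)"
    by (intro tendsto_intros)
  moreover have "\<forall>\<^sub>F y in at_left x. X (hi s) - X (lo (s - y)) = g y"
    unfolding eventually_at_left[OF xp] using xp g by (intro exI[of _ 0]) auto
  ultimately have "(g \<longlongrightarrow> X (hi s) - X (hi (s - x))) (at_left x)" by (rule Lim_transform_eventually)
  then show ?thesis by (rule left_lim_tendsto[OF xp])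
qed

text \<open>Reflection turns the inner reversal into last passage from \<open>s - y\<close> to
  \<open>s\<close>. By \<open>lam\<close>, adding the \<open>k\<close>-th path adds exactly line
  \<open>n + 1 - k\<close> of \<open>F\<close>, so \<open>W\<close> produces the increments of
  single lines of \<open>F\<close>, which the outer reversal puts back in order.\<close>

lemma Rmap_Wmap_Rmap:
  fixes u :: tuple
  assumes H: "staged_tuple n H" and n: "1 \<le> n" and F: "null_tuple F"
    and u: "\<And>i x. i \<in> {1..n} \<Longrightarrow> 0 \<le> x \<Longrightarrow> x \<le> s \<Longrightarrow> u i x = H i (hi x)"
    and lam: "\<And>k z. k \<le> n \<Longrightarrow> 0 \<le> z \<Longrightarrow> z \<le> s \<Longrightarrow>
      lpp H n 0 k (lo z) (hi s) = (\<Sum>i\<in>{n - k..<n}. F (Suc i) (hi s) - F (Suc i) (lo z))"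
    and i: "i \<in> {1..n}" and x: "0 \<le> x" "x < s"
  shows "Rmap n s (Wmap n s (Rmap n s (tuple_restrict n {0..s} u))) i x = F i (hi x)"
proof -
  have s: "0 \<le> s" using x by simp
  have H': "continuous_on UNIV (H i)" "H i bot = 0" for i
    using H by (auto simp: staged_tuple_def null_tuple_def)
  have ul: "left_lim (u i) x = H i (lo x)" if "i \<in> {1..n}" "0 \<le> x" "x \<le> s" for i x
    using that u by (intro left_lim_boundary H') auto
  define V where "V = Rmap n s (tuple_restrict n {0..s} u)"
  have V: "V i x = H (n + 1 - i) (hi s) - H (n + 1 - i) (lo (s - x))"
    if "i \<in> {1..n}" "0 \<le> x" "x \<le> s" for i x
  proof -
    have i': "n + 1 - i \<in> {1..n}" using that by auto
    have "left_lim (tuple_restrict n {0..s} u (n + 1 - i)) (s - x) = H (n + 1 - i) (lo (s - x))"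
      using that u i' by (intro left_lim_boundary H') (auto simp: tuple_restrict_def)
    moreover have "tuple_restrict n {0..s} u (n + 1 - i) s = H (n + 1 - i) (hi s)"
      using u[OF i' s] i' s by (simp add: tuple_restrict_def)
    ultimately show ?thesis using that by (simp add: V_def Rmap_def)
  qed
  have Vl: "left_lim (V i) x = H (n + 1 - i) (hi s) - H (n + 1 - i) (hi (s - x))"
    if "i \<in> {1..n}" "0 \<le> x" "x \<le> s" for i x
    using that V by (intro left_lim_reflected H') auto
  have lp: "last_passage V k (0, n) (y, 1) = (\<Sum>i\<in>{n - k..<n}. F (Suc i) (hi s) - F (Suc i) (lo (s - y)))"
    if "k \<le> n" "0 \<le> y" "y \<le> s" for k y
  proof -
    have "last_passage V k (0, n) (y, 1) = last_passage u k (s - y, n) (s, 1)"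
    proof (rule last_passage_reflect[OF that(2,3)])
      fix i a b assume i: "i \<in> {1..n}" and ab: "0 \<le> a" "a \<le> b" "b \<le> s"
      have i': "n + 1 - i \<in> {1..n}" using i by auto
      show "V i b - left_lim (V i) a = u (n + 1 - i) (s - a) - left_lim (u (n + 1 - i)) (s - b)"
        using V[OF i, of b] Vl[OF i, of a] u[OF i', of "s - a"] ul[OF i', of "s - b"] ab by simp
    qed
    also have "\<dots> = lpp H n 0 k (lo (s - y)) (hi s)"
      using last_passage_eq_lpp[OF H, of "s - y" s 0 k u] u ul n that by simp
    also have "\<dots> = (\<Sum>i\<in>{n - k..<n}. F (Suc i) (hi s) - F (Suc i) (lo (s - y)))"
      using that by (intro lam) auto
    finally show ?thesis .
  qed
  define k where "k = n + 1 - i"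
  have k: "k \<in> {1..n}" "n - (k - 1) = i" "n - k = i - 1" using i by (auto simp: k_def)
  have W: "Wmap n s V k y = F i (hi s) - F i (lo (s - y))" if "0 \<le> y" "y \<le> s" for y
  proof -
    have "{n - k..<n} = insert (i - 1) {n - (k - 1)..<n}" using k i by auto
    then have "(\<Sum>l\<in>{n - k..<n}. F (Suc l) (hi s) - F (Suc l) (lo (s - y))) =
      F i (hi s) - F i (lo (s - y)) + (\<Sum>l\<in>{n - (k - 1)..<n}. F (Suc l) (hi s) - F (Suc l) (lo (s - y)))"
    proof -
      have "i - 1 \<notin> {n - (k - 1)..<n}" "Suc (i - 1) = i" using k i by auto
      then show ?thesis unfolding \<open>{n - k..<n} = _\<close> by (subst sum.insert) simp_all
    qed
    moreover have "Wmap n s V k y = last_passage V k (0, n) (y, 1) - last_passage V (k - 1) (0, n) (y, 1)"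
      using that k by (simp add: Wmap_def)
    moreover have "k \<le> n" "k - 1 \<le> n" using k by auto
    ultimately show ?thesis using lp[OF _ that] by simp
  qed
  have F': "continuous_on UNIV (F i)" "F i bot = 0" using F by (auto simp: null_tuple_def)
  have "left_lim (Wmap n s V k) (s - x) = F i (hi s) - F i (hi (s - (s - x)))"
    using x W by (intro left_lim_reflected F') auto
  moreover have "Wmap n s V k s = F i (hi s)" using W[of s] s F'(2) by (simp add: lo_0)
  ultimately show ?thesis using i x by (simp add: Rmap_def V_def k_def)
qed

text \<open>On a compact set the approximants coincide with the limit for all large
  \<open>s\<close>, so uniform convergence is immediate. The description in \<open>Mmap\<close>
  determines the tuple through pointwise limits and extensionality.\<close>

lemma Mmap_eq_boundary:
  fixes u :: tuple
  assumes H: "staged_tuple n H" and n: "1 \<le> n" and F: "staged_tuple n F"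
    and u: "\<And>i x. i \<in> {1..n} \<Longrightarrow> 0 \<le> x \<Longrightarrow> u i x = H i (hi x)"
    and lam: "\<And>s k z. s0 \<le> s \<Longrightarrow> k \<le> n \<Longrightarrow> 0 \<le> z \<Longrightarrow> z \<le> s \<Longrightarrow>
      lpp H n 0 k (lo z) (hi s) = (\<Sum>i\<in>{n - k..<n}. F (Suc i) (hi s) - F (Suc i) (lo z))"
  shows "Mmap n u = boundary n {0..} F"
proof -
  let ?M = "\<lambda>s. Rmap n s (Wmap n s (Rmap n s (tuple_restrict n {0..s} u)))"
  let ?B = "boundary n {0..} F"
  let ?P = "\<lambda>h. h \<in> Dtuples n {0..} \<and> (\<forall>i\<in>{1..n}. \<forall>K. compact K \<and> K \<subseteq> {0..} \<longrightarrow>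
           uniform_limit K (\<lambda>s. ?M s i) (h i) at_top)"
  have ev: "\<forall>\<^sub>F s in at_top. \<forall>x\<in>K. ?M s i x = ?B i x" if K: "compact K" "K \<subseteq> {0..}" and i: "i \<in> {1..n}" for K i
  proof -
    obtain c where c: "\<And>x. x \<in> K \<Longrightarrow> \<bar>x\<bar> \<le> c"
      using compact_imp_bounded[OF K(1)] unfolding bounded_real by blast
    have "\<forall>x\<in>K. ?M s i x = ?B i x" if "max s0 (c + 1) \<le> s" for s
    proof
      fix x assume x: "x \<in> K"
      then have "0 \<le> x" "x < s" using K(2) c[OF x] that by auto
      moreover have "s0 \<le> s" using that by simp
      ultimately have "?M s i x = F i (hi x)"
        using F u lam i by (intro Rmap_Wmap_Rmap[OF H n]) (auto simp: staged_tuple_def)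
      then show "?M s i x = ?B i x" using i \<open>0 \<le> x\<close> by (simp add: boundary_def)
    qed
    then show ?thesis by (rule eventually_at_top_linorderI)
  qed
  have B: "?P ?B"
  proof (intro conjI ballI allI impI)
    show "?B \<in> Dtuples n {0..}" by (intro boundary_Dtuples F) auto
    fix i K assume i: "i \<in> {1..n}" and K: "compact K \<and> K \<subseteq> {0::real..}"
    show "uniform_limit K (\<lambda>s. ?M s i) (?B i) at_top"
    proof (rule uniform_limitI)
      fix e :: real assume "0 < e"
      then show "\<forall>\<^sub>F s in at_top. \<forall>x\<in>K. dist (?M s i x) (?B i x) < e"
        using ev[OF conjunct1[OF K] conjunct2[OF K] i] by (auto elim!: eventually_mono)
    qed
  qed
  have uniq: "h = ?B" if h: "?P h" for h
  proof (intro ext)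
    fix i x
    have hE: "h \<in> {1..n} \<rightarrow>\<^sub>E ({0..} \<rightarrow>\<^sub>E UNIV)" "?B \<in> {1..n} \<rightarrow>\<^sub>E ({0..} \<rightarrow>\<^sub>E UNIV)"
      using h B by (auto simp: Dtuples_def)
    show "h i x = ?B i x"
    proof (cases "i \<in> {1..n}")
      case i: True
      show ?thesis
      proof (cases "0 \<le> x")
        case True
        have lim: "((\<lambda>s. ?M s i x) \<longlongrightarrow> g i x) at_top" if "?P g" for g
        proof -
          have "compact {x} \<and> {x} \<subseteq> {0..}" using True by simp
          then have "uniform_limit {x} (\<lambda>s. ?M s i) (g i) at_top" using conjunct2[OF that] i by blast
          then show ?thesis by (rule tendsto_uniform_limitI) simp
        qed
        show ?thesis using tendsto_unique[OF _ lim[OF h] lim[OF B]] by simp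
      next
        case False
        then show ?thesis
          using PiE_arb[OF PiE_mem[OF hE(1) i]] PiE_arb[OF PiE_mem[OF hE(2) i]] by simp
      qed
    next
      case False
      then show ?thesis using PiE_arb[OF hE(1)] PiE_arb[OF hE(2)] by simp
    qed
  qed
  show ?thesis unfolding Mmap_def using B uniq by (rule the_equality)
qed


section \<open>The inverse of RSK\<close>

lemma Delta_sum_0: "Delta_sum n \<alpha> g k 0 = 0"
  by (simp add: Delta_sum_def)

lemma real_sum_Suc: "(\<Sum>i=1 + M..d. \<alpha> * real i) = \<alpha> * real (sum Suc {M..<d})"
proof -
  have "{1 + M..d} = Suc ` {M..<d}" by (simp add: image_Suc_atLeastLessThan atLeastLessThanSuc_atLeastAtMost)
  then have "(\<Sum>i=1 + M..d. \<alpha> * real i) = (\<Sum>i\<in>Suc ` {M..<d}. \<alpha> * real i)" by (simp only:)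
  also have "\<dots> = \<alpha> * real (sum Suc {M..<d})" by (subst sum.reindex) (simp_all add: sum_distrib_left)
  finally show ?thesis .
qed

theorem Mmap_Omap_RSK:
  assumes n: "1 \<le> n" and t: "0 < t" and f: "f \<in> Dtuples n {0..t}"
  shows "tuple_restrict n {0..t} (Mmap n (Omap n t (RSK n t f))) = f"
proof -
  let ?E = "embed n t f"
  define g where "g = Gmap n t f"
  define \<alpha> where "\<alpha> = real (n - 1) * (g 1 n - g n n)"
  note Es = embed_staged[OF f t] and En = embed_null[OF f t]
  note Eb = embed_boundary[OF f t]
  have g: "g \<in> GTpatterns n" unfolding g_def using Eb by (intro Gmap_GTpatterns[OF Es n t])
  have top: "g n n \<le> g 1 n" using GT_bound(1)[OF g, of n n] n by simp
  then have \<alpha>: "0 \<le> \<alpha>" by (simp add: \<alpha>_def)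
  have gsum: "lpp ?E n M k bot (hi t) = (\<Sum>i=1..k. g i (n - M))" if "0 < k" "M + k \<le> n" for M k
  proof -
    have "(\<Sum>i=1..k. g i (n - M)) = last_passage f k (0, n) (t, n - (n - M) + 1)"
      unfolding g_def using that by (intro Gmap_sum) auto
    also have "n - (n - M) + 1 = Suc M" using that by simp
    also have "last_passage f k (0, n) (t, Suc M) = lpp ?E n M k (lo 0) (hi t)"
      using that t Eb by (intro last_passage_eq_lpp Es) auto
    finally show ?thesis by (simp add: lo_0)
  qed
  \<comment> \<open>Since \<open>M \<ge> 1\<close>, at most \<open>n - 1\<close> paths are involved;
    this accounts for the factor \<open>n - 1\<close> in \<open>\<alpha>\<close>.\<close>
  have gain: "lpp ?E n 0 k bot (hi t) \<le> lpp ?E n M k bot (hi t) + \<alpha>" if "0 < M" "0 < k" "M + k \<le> n" for M k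
  proof -
    have "lpp ?E n 0 k bot (hi t) - lpp ?E n M k bot (hi t) = (\<Sum>i=1..k. g i n - g i (n - M))"
      using gsum[of k 0] gsum[of k M] that by (simp add: sum_subtractf)
    also have "\<dots> \<le> (\<Sum>i=1..k. g 1 n - g n n)"
      using that by (intro sum_mono diff_mono GT_bound[OF g]) auto
    also have "\<dots> = real k * (g 1 n - g n n)" by simp
    also have "\<dots> \<le> \<alpha>" unfolding \<alpha>_def using that top by (intro mult_right_mono) auto
    finally show ?thesis by simp
  qed
  let ?F = "extend n t \<alpha> f"
  have Fs: "staged_tuple n ?F" by (rule extend_staged[OF f t \<alpha>])
  have Fn: "null_tuple ?F" using Fs by (simp add: staged_tuple_def)
  define H where "H = melon n (n - 1) ?F"
  have Hs: "staged_tuple n H" unfolding H_def using n by (intro staged_tuple_melon Fs) auto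
  have Hsum: "lpp ?F n 0 k bot b = (\<Sum>j<k. H (Suc j) b)" if "k \<le> n" for k b
    using lpp_eq_melon_sum[OF Fn, of 0 n k b] that n by (simp add: H_def)
  define u where "u = Omap n t (RSK n t f)"
  \<comment> \<open>Up to \<open>t\<close> no jump has happened and the melon gives
    \<open>W f\<close>. After \<open>t\<close> its partial sums are the values of
    \<open>lpp_extend_bot\<close>, and these coincide with the formula that defines
    \<open>Delta\<close>.\<close>
  have u: "u i x = H i (hi x)" if i: "i \<in> {1..n}" and x: "0 \<le> x" for i x
  proof -
    obtain i' where i': "i = Suc i'" using i by (cases i) auto
    have diff: "H i b = lpp ?F n 0 i bot b - lpp ?F n 0 (i - 1) bot b" for b
      using Hsum[of i b] Hsum[of i' b] i i' by simp
    show ?thesis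
    proof (cases "x \<le> t")
      case True
      have eq: "lpp ?F n 0 k bot (hi x) = last_passage f k (0, n) (x, 1)" if "k \<le> n" for k
      proof -
        have "lpp ?F n 0 k bot (hi x) = lpp ?E n 0 k bot (hi x)"
        proof (rule lpp_cong)
          fix l z assume "l \<in> {Suc 0..n}" "bot \<le> z" "z \<le> hi x"
          moreover have "hi x \<le> hi t" using True x t by simp
          ultimately show "?F l z = ?E l z" by (intro extend_early[OF f t \<alpha>]) auto
        qed
        also have "\<dots> = last_passage f k (0, n) (x, Suc 0)"
          unfolding lo_0[symmetric] using that x True Eb n by (intro last_passage_eq_lpp[symmetric] Es) auto
        finally show ?thesis by simp
      qed
      have "i \<le> n" "i - 1 \<le> n" using i by auto
      then have "H i (hi x) = Wmap n t f i x"
        using eq[of i] eq[of "i - 1"] i x True by (simp add: diff Wmap_def)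
      then show ?thesis using i x True by (simp add: u_def Omap_def RSK_def tuple_concat_def)
    next
      case False
      define d where "d = min n (nat \<lfloor>x - t\<rfloor>)"
      have D: "lpp ?F n 0 k bot (hi x) = Delta_sum n \<alpha> g d k" if "k \<le> n" for k
      proof (cases "k = 0")
        case True then show ?thesis by (simp add: lpp_0 Delta_sum_0)
      next
        case k: False
        have "lpp ?F n 0 k bot (hi x) = lpp ?E n (d - k) k bot (hi t) + \<alpha> * real (sum Suc {d - k..<d})"
          unfolding d_def using that k False by (intro lpp_extend_bot[OF f t \<alpha> gain]) auto
        also have "lpp ?E n (d - k) k bot (hi t) = (\<Sum>l=1..k. g l (n - (d - k)))"
          using that k by (intro gsum) (auto simp: d_def)
        finally show ?thesis by (simp only: Delta_sum_def real_sum_Suc add.commute)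
      qed
      have "u i x = Delta n t \<alpha> g i x"
        using i x False by (simp add: u_def Omap_def RSK_def tuple_concat_def g_def \<alpha>_def)
      also have "\<dots> = (if d = 0 then g i n else Delta_sum n \<alpha> g d i - Delta_sum n \<alpha> g d (i - 1))"
        unfolding Delta_def d_def Let_def using i False by simp
      also have "\<dots> = Delta_sum n \<alpha> g d i - Delta_sum n \<alpha> g d (i - 1)"
        using i' by (simp add: Delta_sum_def)
      also have "\<dots> = H i (hi x)"       proof -
        have "i \<le> n" "i - 1 \<le> n" using i by auto
        then show ?thesis using D[of i] D[of "i - 1"] diff[of "hi x"] by simp
      qed
      finally show ?thesis .
    qed
  qed
  have "Mmap n u = boundary n {0..} ?F"
  proof (rule Mmap_eq_boundary[OF Hs n Fs u])
    fix s z :: real and k :: nat assume s: "t + real n \<le> s" and k: "k \<le> n" and z: "0 \<le> z" "z \<le> s"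
    \<comment> \<open>Here the isometry is used for paths starting at an arbitrary time
      \<open>z\<close>, where \<open>H\<close> itself need not have simple last passage
      values.\<close>
    have "lpp H n 0 k (lo z) (hi s) = lpp ?F n 0 k (lo z) (hi s)"
      unfolding H_def using n k z by (intro lpp_melon Fn) auto
    then show "lpp H n 0 k (lo z) (hi s) = (\<Sum>i\<in>{n - k..<n}. ?F (Suc i) (hi s) - ?F (Suc i) (lo z))"
      using lpp_extend_from[OF f t \<alpha> gain s z _ k] by (cases "k = 0") (simp_all add: lpp_0)
  qed
  then have "tuple_restrict n {0..t} (Mmap n u) i x = f i x" for i x
  proof -
    have fE: "f \<in> {1..n} \<rightarrow>\<^sub>E ({0..t} \<rightarrow>\<^sub>E UNIV)" using f by (simp add: Dtuples_def)
    assume M: "Mmap n u = boundary n {0..} ?F"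
    show ?thesis
    proof (cases "i \<in> {1..n}")
      case i: True
      show ?thesis
      proof (cases "x \<in> {0..t}")
        case True
        then have "?F i (hi x) = ?E i (hi x)" using i t by (intro extend_early[OF f t \<alpha>]) auto
        then show ?thesis using Eb[OF i, of x] i True by (simp add: tuple_restrict_def M boundary_def)
      next
        case False
        then show ?thesis using PiE_arb[OF PiE_mem[OF fE i] False] i by (auto simp: tuple_restrict_def)
      qed
    next
      case False
      then show ?thesis using PiE_arb[OF fE False] by (auto simp: tuple_restrict_def)
    qed
  qed
  then show ?thesis unfolding u_def by (intro ext)
qed

text \<open>The formula is checked only as a left inverse, on tuples. This gives injectivity, and
  with surjectivity of \<open>RSK\<close> it identifies the inverse on the whole target.\<close>

theorem proposition6p4:
  fixes n :: nat and t :: real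
  assumes "n \<ge> 1" and "t > 0"
  shows "bij_betw (RSK n t) (Dtuples n {0..t}) (RSKtarget n t) \<and>
    (\<forall>p\<in>RSKtarget n t.
       inv_into (Dtuples n {0..t}) (RSK n t) p
         = (tuple_restrict n {0..t} \<circ> Mmap n \<circ> Omap n t) p)"
proof -
  let ?D = "Dtuples n {0..t}" and ?T = "RSKtarget n t"
  let ?inv = "tuple_restrict n {0..t} \<circ> Mmap n \<circ> Omap n t"
  have left: "?inv (RSK n t f) = f" if "f \<in> ?D" for f
    using Mmap_Omap_RSK[OF assms that] by simp
  have inj: "inj_on (RSK n t) ?D" using left by (rule inj_on_inverseI)
  have into: "RSK n t f \<in> ?T" if "f \<in> ?D" for f
    using embed_boundary[OF that assms(2)]
    by (intro RSK_in_target[OF embed_staged[OF that assms(2)] assms])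
  have surj: "\<exists>f\<in>?D. RSK n t f = p" if "p \<in> ?T" for p
    using RSK_surj[OF assms, of "fst p" "snd p"] that by simp
  have "RSK n t ` ?D = ?T" using into surj by blast
  moreover have "inv_into ?D (RSK n t) p = ?inv p" if p: "p \<in> ?T" for p
  proof -
    obtain f where f: "f \<in> ?D" "RSK n t f = p" using surj[OF p] by blast
    then show ?thesis using inv_into_f_f[OF inj f(1)] left[OF f(1)] by simp
  qed
  ultimately show ?thesis using inj by (simp add: bij_betw_def)
qed

end
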